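(* Suppose $u=(\rho,m)$ is an entropy solution to the isentropic Euler equations with $\gamma=3$ with $\|\rho\|_{L^\infty(B_2)}+\|m/\rho\|_{L^\infty(B_2)}\le\Gamma$ and $\operatorname{ess\,inf}_{(t,x)\in B_2}\rho(t,x)\ge M>0$. Suppose $\overline u=(\overline\rho,\overline m)$ is a fixed (constant) non-vacuum state, i.e. $\overline\rho>0$. Then there are $\varepsilon_0=\varepsilon_0(\Gamma,M)>0$ and $\widetilde C=\widetilde C(\Gamma,M)$, depending only on $\Gamma$ and $M$, such that with $\alpha=\frac1{21}$, for any $0<\varepsilon<\varepsilon_0$, $$\int_{B_2}(\lambda_1(\overline u)-\lambda_1(u))_+\,dx\,dt<\varepsilon\quad\text{implies}\quad\operatorname*{ess\,sup}_{(t,x)\in B_1}(\lambda_1(\overline u)-\lambda_1(u(t,x)))_+<\widetilde C\varepsilon^\alpha,$$ $$\int_{B_2}(\lambda_2(u)-\lambda_2(\overline u))_+\,dx\,dt<\varepsilon\quad\text{implies}\quad\operatorname*{ess\,sup}_{(t,x)\in B_1}(\lambda_2(u(t,x))-\lambda_2(\overline u))_+<\widetilde C\varepsilon^\alpha.$$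
   Context: $B_r\subset\mathbb{R}^2$ is the space-time ball of radius $r$ centered at the origin, with coordinates $(t,x)$. The isentropic Euler equations with $\gamma=3$ are $$\rho_t+m_x=0,\qquad m_t+\left(\frac{m^2}{\rho}+\frac{\rho^3}{12}\right)_x=0,$$ with unknown $u=(\rho,m)$ and flux $f(\rho,m)=(m,\,m^2/\rho+\rho^3/12)$. An entropy solution (here on $B_2$) satisfies the system in the sense of distributions and satisfies $\eta(u)_t+q(u)_x\le 0$ in the sense of distributions for every pair $(\eta,q)$ of functions of the state $(\rho,m)$ such that $\eta$ is convex, $\eta,q\in C(\mathbb{R}^+\times\mathbb{R})$ and $q'=\eta' f'$. The Riemann invariants are $\lambda_1(\rho,m)=\frac m\rho-\frac\rho2$ and $\lambda_2(\rho,m)=\frac m\rho+\frac\rho2$. $(s)_+=\max(s,0)$. *)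

theory Defs
  imports "HOL-Analysis.Analysis" "HOL-Probability.Essential_Supremum"
begin

(* Points of space-time are pairs (t, x), states are pairs (rho, m). The norm on real \<times> real is
   the Euclidean one, so ball 0 r is the round disc. *)
type_synonym plane = "real \<times> real"

definition dir_deriv :: "plane \<Rightarrow> (plane \<Rightarrow> real) \<Rightarrow> plane \<Rightarrow> real" where
  "dir_deriv v f z = frechet_derivative f (at z) v"

fun C_diff :: "nat \<Rightarrow> (plane \<Rightarrow> real) \<Rightarrow> bool" where
  "C_diff 0 f \<longleftrightarrow> continuous_on UNIV f"
| "C_diff (Suc k) f \<longleftrightarrow> (\<forall>z. f differentiable at z) \<and> (\<forall>v. C_diff k (dir_deriv v f))"

(* Elements of the space of test functions on U, extended by zero to the whole plane. *)
definition test_function :: "plane set \<Rightarrow> (plane \<Rightarrow> real) \<Rightarrow> bool" where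
  "test_function U \<phi> \<longleftrightarrow> (\<forall>k. C_diff k \<phi>) \<and>
     compact (closure {z. \<phi> z \<noteq> 0}) \<and> closure {z. \<phi> z \<noteq> 0} \<subseteq> U"

definition locally_integrable :: "plane set \<Rightarrow> (plane \<Rightarrow> real) \<Rightarrow> bool" where
  "locally_integrable U f \<longleftrightarrow> (\<forall>K. compact K \<and> K \<subseteq> U \<longrightarrow> set_integrable lebesgue K f)"

(* The value of the distribution g_t + h_x at the test function \<phi>. *)
definition weak_div :: "plane set \<Rightarrow> (plane \<Rightarrow> real) \<Rightarrow> (plane \<Rightarrow> real) \<Rightarrow> (plane \<Rightarrow> real) \<Rightarrow> real" where
  "weak_div U g h \<phi> =
     - (LINT z:U|lebesgue. g z * dir_deriv (1, 0) \<phi> z + h z * dir_deriv (0, 1) \<phi> z)"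

definition weak_div_zero :: "plane set \<Rightarrow> (plane \<Rightarrow> real) \<Rightarrow> (plane \<Rightarrow> real) \<Rightarrow> bool" where
  "weak_div_zero U g h \<longleftrightarrow> locally_integrable U g \<and> locally_integrable U h \<and>
     (\<forall>\<phi>. test_function U \<phi> \<longrightarrow> weak_div U g h \<phi> = 0)"

definition weak_div_nonpos :: "plane set \<Rightarrow> (plane \<Rightarrow> real) \<Rightarrow> (plane \<Rightarrow> real) \<Rightarrow> bool" where
  "weak_div_nonpos U g h \<longleftrightarrow> locally_integrable U g \<and> locally_integrable U h \<and>
     (\<forall>\<phi>. test_function U \<phi> \<and> (\<forall>z. 0 \<le> \<phi> z) \<longrightarrow> weak_div U g h \<phi> \<le> 0)"

definition states :: "plane set" where
  "states = {0<..} \<times> UNIV"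

definition flux :: "plane \<Rightarrow> plane" where
  "flux = (\<lambda>(\<rho>, m). (m, m\<^sup>2 / \<rho> + \<rho> ^ 3 / 12))"

(* \<eta> and q are only continuous, so q' = \<eta>' f' is read in the sense of distributions on the state
   space. Its component in direction v is  D_v q = (\<Sum>i. (f' v)_i D_i \<eta>);  testing with \<phi> and moving
   all derivatives off q and \<eta> gives the identity below. *)
definition entropy_pair :: "(plane \<Rightarrow> real) \<Rightarrow> (plane \<Rightarrow> real) \<Rightarrow> bool" where
  "entropy_pair \<eta> q \<longleftrightarrow>
     convex_on states \<eta> \<and> continuous_on states \<eta> \<and> continuous_on states q \<and>
     (\<forall>\<phi> v. test_function states \<phi> \<longrightarrow>
        (LINT w:states|lebesgue. q w * dir_deriv v \<phi> w) =
        (LINT w:states|lebesgue.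
           \<eta> w * (\<Sum>i\<in>Basis. dir_deriv i (\<lambda>w'. \<phi> w' * (frechet_derivative flux (at w') v \<bullet> i)) w)))"

definition entropy_solution :: "plane set \<Rightarrow> (plane \<Rightarrow> plane) \<Rightarrow> bool" where
  "entropy_solution U u \<longleftrightarrow>
     u \<in> borel_measurable (lebesgue_on U) \<and> (AE z in lebesgue_on U. u z \<in> states) \<and>
     weak_div_zero U (\<lambda>z. fst (u z)) (\<lambda>z. fst (flux (u z))) \<and>
     weak_div_zero U (\<lambda>z. snd (u z)) (\<lambda>z. snd (flux (u z))) \<and>
     (\<forall>\<eta> q. entropy_pair \<eta> q \<longrightarrow> weak_div_nonpos U (\<lambda>z. \<eta> (u z)) (\<lambda>z. q (u z)))"

definition lambda1 :: "plane \<Rightarrow> real" where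
  "lambda1 = (\<lambda>(\<rho>, m). m / \<rho> - \<rho> / 2)"

definition lambda2 :: "plane \<Rightarrow> real" where
  "lambda2 = (\<lambda>(\<rho>, m). m / \<rho> + \<rho> / 2)"

definition ess_sup_on :: "plane set \<Rightarrow> (plane \<Rightarrow> real) \<Rightarrow> ereal" where
  "ess_sup_on A f = esssup (lebesgue_on A) (\<lambda>z. ereal (f z))"

definition ess_inf_on :: "plane set \<Rightarrow> (plane \<Rightarrow> real) \<Rightarrow> ereal" where
  "ess_inf_on A f = - ess_sup_on A (\<lambda>z. - f z)"

definition Linf_norm :: "plane set \<Rightarrow> (plane \<Rightarrow> real) \<Rightarrow> ereal" where
  "Linf_norm A f = ess_sup_on A (\<lambda>z. \<bar>f z\<bar>)"

definition pos_part :: "real \<Rightarrow> real" where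
  "pos_part s = max s 0"

end

theory Submission
  imports Defs
begin

text \<open>For \<gamma> = 3 the system is diagonal on the kinetic level: integrating a convex function \<open>g\<close> of one
real variable over the interval between the two Riemann invariants of a state gives a convex
entropy, and integrating \<open>v * g v\<close> gives its flux (\<open>entropy_pair_kinetic\<close>). Choosing \<open>g\<close> to vanish
on one side of a level singles out one Riemann invariant. Write \<open>w\<close> for the excess of that invariant
over the reference value, say \<open>w = lambda1 ubar - lambda1 u\<close>, and let \<open>(E, Q)\<close> and \<open>(E', Q')\<close> be the
entropies with \<open>g v = pos_part (lambda1 ubar - l - v)\<close> for two levels \<open>l < l'\<close>. They live on the sets
where \<open>w\<close> exceeds \<open>l\<close> and \<open>l'\<close>.

A nonlinear gain comes from an interaction functional. If two nonnegative densities of compact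
support satisfy \<open>a_t + b_x \<le> F\<close> and \<open>a'_t + b'_x \<le> F'\<close>, then the time derivative of the integral of
\<open>a(t, x) a'(t, y)\<close> over \<open>x < y\<close> shows that the integral of \<open>b a' - a b'\<close> is at most twice the product
of the \<open>L^1\<close> norms of \<open>F\<close> and \<open>F'\<close> (\<open>interaction_estimate\<close>). For the entropies above
\<open>Q E' - E Q'\<close> is nonnegative, because the mean velocity \<open>Q / E\<close> decreases when the level is
raised; and with \<open>l' = l + d\<close> and \<open>d \<le> M\<close> it is at least \<open>d^5 / 12\<close> where \<open>w > l + 2 d\<close>
(\<open>interaction_nonneg\<close>, \<open>interaction_lower_bound\<close>). Here the lower bound \<open>M\<close> on the
density keeps the interval between the Riemann invariants at least \<open>d\<close> long.

After localisation by a cutoff, \<open>F\<close> and \<open>F'\<close> are bounded and supported where \<open>w > l\<close>. Hence the measure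
of \<open>{w > l + 2 d}\<close> in a smaller disc is bounded by a constant times \<open>d^(-5)\<close> times the square of the
measure of \<open>{w > l}\<close> in a larger one (\<open>de_giorgi_step\<close>, \<open>level_set_step\<close>). This recursion is
superlinear, so a De Giorgi iteration (\<open>level_set_iteration\<close>) shows that \<open>w \<le> 2 \<delta>\<close> almost everywhere
on the unit disc as soon as \<open>{w > \<delta>}\<close> has measure at most a constant times \<open>\<delta>^5\<close>. By the Markov
inequality that measure is at most \<open>\<epsilon> / \<delta>\<close>, so \<open>\<delta> = \<epsilon>^(1/21)\<close> qualifies when \<open>\<epsilon>\<close> is small.\<close>

section \<open>Elementary smooth functions of the plane\<close>

text \<open>Differentiating \<open>exp (- 1 / x)\<close> repeatedly produces only combinations of these functions, so
the family is closed under differentiation up to linear combinations.\<close>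
definition flat :: "nat \<Rightarrow> real \<Rightarrow> real" where
  "flat n x = (if x \<le> 0 then 0 else exp (- (1 / x)) / x ^ n)"

lemma flat_nonneg: "0 \<le> flat n x"
  by (simp add: flat_def)

text \<open>The power series of \<open>exp (1 / x)\<close> dominates its term of order \<open>n + k\<close>; this flatness at the
origin of every order is what makes \<open>flat n\<close> differentiable there.\<close>
lemma flat_le_power:
  assumes "0 < x"
  shows "flat n x \<le> fact (n + k) * x ^ k"
proof -
  have "(1 / x) ^ (n + k) / fact (n + k) \<le> exp (1 / x)"
  proof -
    have "inverse (fact (n + k)) *\<^sub>R (1 / x) ^ (n + k) \<le> (\<Sum>i. inverse (fact i) *\<^sub>R (1 / x) ^ i)"
      using assms summable_exp_generic[of "1 / x"]
      by (intro sum_le_suminf[where I = "{n + k}", simplified]) auto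
    then show ?thesis
      by (simp add: exp_def field_simps)
  qed
  then have "1 \<le> exp (1 / x) * fact (n + k) * x ^ (n + k)"
    using assms by (simp add: power_one_over divide_simps mult_ac)
  then have "exp (- (1 / x)) * 1 \<le> exp (- (1 / x)) * (exp (1 / x) * fact (n + k) * x ^ (n + k))"
    by (intro mult_left_mono) auto
  also have "\<dots> = fact (n + k) * x ^ (n + k)"
    by (simp add: exp_minus)
  finally have "exp (- (1 / x)) / x ^ n \<le> fact (n + k) * x ^ (n + k) / x ^ n"
    using assms by (intro divide_right_mono) auto
  then show ?thesis
    using assms by (simp add: flat_def power_add)
qed

lemma DERIV_flat: "(flat n has_real_derivative flat (n + 2) x - real n * flat (n + 1) x) (at x)"
proof (cases x "0::real" rule: linorder_cases)
  case less
  have "((\<lambda>_. 0) has_real_derivative 0) (at x)"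
    by simp
  then have "(flat n has_real_derivative 0) (at x)"
    by (rule has_field_derivative_transform_within_open[where S = "{..<0}"])
       (use less in \<open>auto simp: flat_def\<close>)
  then show ?thesis
    using less by (simp add: flat_def)
next
  case equal
  have "((\<lambda>h. flat n h / h) \<longlongrightarrow> 0) (at 0)"
  proof (rule Lim_null_comparison)
    show "((\<lambda>h. fact (n + 2) * \<bar>h\<bar>) \<longlongrightarrow> 0) (at (0::real))"
      by (auto intro!: tendsto_eq_intros)
    have "norm (flat n h / h) \<le> fact (n + 2) * \<bar>h\<bar>" if "h \<noteq> 0" for h :: real
    proof (cases "h > 0")
      case True
      have "flat n h / h \<le> fact (n + 2) * h ^ 2 / h"
        using flat_le_power[OF True, of n 2] True by (intro divide_right_mono) auto
      then show ?thesis
        using True flat_nonneg[of n h] by (simp add: power2_eq_square)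
    next
      case False
      then have "flat n h = 0"
        by (simp add: flat_def)
      then show ?thesis
        by (simp only: div_0 norm_zero) simp
    qed
    then show "\<forall>\<^sub>F h in at 0. norm (flat n h / h) \<le> fact (n + 2) * \<bar>h\<bar>"
      by (auto simp: eventually_at_filter)
  qed
  then show ?thesis
    using equal by (simp add: DERIV_def flat_def[of _ 0])
next
  case greater
  have "((\<lambda>x. exp (- (1 / x)) / x ^ n) has_real_derivative
      exp (- (1 / x)) / x ^ (n + 2) - real n * (exp (- (1 / x)) / x ^ (n + 1))) (at x)"
  proof -
    have "((\<lambda>x. exp (- (1 / x)) / x ^ n) has_real_derivative
        (exp (- (1 / x)) * (1 / x\<^sup>2) * x ^ n - exp (- (1 / x)) * (real n * x ^ (n - 1))) /
        (x ^ n * x ^ n)) (at x)"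
      using greater
      by (auto intro!: derivative_eq_intros simp: power2_eq_square)
    moreover have "(exp (- (1 / x)) * (1 / x\<^sup>2) * x ^ n - exp (- (1 / x)) * (real n * x ^ (n - 1))) /
        (x ^ n * x ^ n) = exp (- (1 / x)) / x ^ (n + 2) - real n * (exp (- (1 / x)) / x ^ (n + 1))"
      using greater by (cases n) (simp_all add: divide_simps power2_eq_square, simp_all add: algebra_simps)
    ultimately show ?thesis
      by simp
  qed
  then have "(flat n has_real_derivative
      exp (- (1 / x)) / x ^ (n + 2) - real n * (exp (- (1 / x)) / x ^ (n + 1))) (at x)"
    by (rule has_field_derivative_transform_within_open[where S = "{0<..}"])
       (use greater in \<open>auto simp: flat_def\<close>)
  then show ?thesis
    using greater by (simp add: flat_def)
qed

definition bump :: "real \<Rightarrow> real" where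
  "bump x = flat 0 x * flat 0 (1 - x)"

lemma bump_nonneg: "0 \<le> bump x"
  by (simp add: bump_def flat_nonneg)

lemma bump_eq_0: "x \<le> 0 \<or> 1 \<le> x \<Longrightarrow> bump x = 0"
  by (auto simp: bump_def flat_def)

lemma isCont_bump: "isCont bump x"
proof -
  have "isCont (\<lambda>x. flat 0 (1 - x)) x"
    by (rule isCont_o2[where g = "flat 0"]) (auto intro!: continuous_intros DERIV_isCont[OF DERIV_flat])
  then show ?thesis
    unfolding bump_def[abs_def] by (intro continuous_mult DERIV_isCont[OF DERIV_flat])
qed

text \<open>The primitive is only determined up to a constant, which the differences in
\<open>smooth_step\<close> and in the normalising factor of \<open>mollifier\<close> remove.\<close>
definition bump_primitive :: "real \<Rightarrow> real" where
  "bump_primitive = (SOME F. \<forall>x. (F has_real_derivative bump x) (at x))"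

lemma DERIV_bump_primitive: "(bump_primitive has_real_derivative bump x) (at x)"
proof -
  have "\<exists>F. \<forall>x. (F has_real_derivative bump x) (at x)"
    using einterval_antiderivative[of "-\<infinity>" "\<infinity>" bump] isCont_bump
    by (auto simp: has_real_derivative_iff_has_vector_derivative)
  from someI_ex[OF this] show ?thesis
    unfolding bump_primitive_def by blast
qed

lemma bump_primitive_less: "bump_primitive 0 < bump_primitive 1"
proof (rule DERIV_pos_imp_increasing_open[where f = bump_primitive])
  show "continuous_on {0..1} bump_primitive"
    by (intro continuous_at_imp_continuous_on ballI DERIV_isCont[OF DERIV_bump_primitive])
next
  fix x :: real assume "0 < x" "x < 1"
  then have "0 < bump x"
    by (simp add: bump_def flat_def)
  then show "\<exists>y. (bump_primitive has_real_derivative y) (at x) \<and> 0 < y"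
    using DERIV_bump_primitive by blast
qed simp

definition mollifier :: "real \<Rightarrow> real" where
  "mollifier x = bump x / (bump_primitive 1 - bump_primitive 0)"

definition smooth_step :: "real \<Rightarrow> real" where
  "smooth_step x = (bump_primitive x - bump_primitive 0) / (bump_primitive 1 - bump_primitive 0)"

lemma mollifier_nonneg: "0 \<le> mollifier x"
  using bump_primitive_less by (simp add: mollifier_def bump_nonneg)

lemma mollifier_eq_0: "x \<le> 0 \<or> 1 \<le> x \<Longrightarrow> mollifier x = 0"
  by (simp add: mollifier_def bump_eq_0)

lemma isCont_mollifier: "isCont mollifier x"
  unfolding mollifier_def[abs_def] using bump_primitive_less
  by (intro continuous_intros isCont_bump) auto

lemma DERIV_smooth_step: "(smooth_step has_real_derivative mollifier x) (at x)"
  unfolding smooth_step_def[abs_def] mollifier_def using bump_primitive_less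
  by (auto intro!: derivative_eq_intros DERIV_bump_primitive)

lemma smooth_step_mono: "x \<le> y \<Longrightarrow> smooth_step x \<le> smooth_step y"
  by (rule DERIV_nonneg_imp_nondecreasing[where f = smooth_step]) (use DERIV_smooth_step mollifier_nonneg in blast)+

lemma smooth_step_eq_0:
  assumes "x \<le> 0"
  shows "smooth_step x = 0"
proof -
  have "smooth_step 0 \<le> smooth_step x"
    using assms
  proof (rule DERIV_nonpos_imp_nonincreasing[where f = smooth_step])
    fix y :: real assume "x \<le> y" "y \<le> 0"
    then show "\<exists>d. (smooth_step has_real_derivative d) (at y) \<and> d \<le> 0"
      using DERIV_smooth_step[of y] mollifier_eq_0[of y] by auto
  qed
  with smooth_step_mono[OF assms] show ?thesis
    by (simp add: smooth_step_def)
qed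

lemma smooth_step_eq_1:
  assumes "1 \<le> x"
  shows "smooth_step x = 1"
proof -
  have "smooth_step x \<le> smooth_step 1"
    using assms
  proof (rule DERIV_nonpos_imp_nonincreasing[where f = smooth_step])
    fix y :: real assume "1 \<le> y" "y \<le> x"
    then show "\<exists>d. (smooth_step has_real_derivative d) (at y) \<and> d \<le> 0"
      using DERIV_smooth_step[of y] mollifier_eq_0[of y] by auto
  qed
  with smooth_step_mono[OF assms] show ?thesis
    using bump_primitive_less by (simp add: smooth_step_def)
qed

lemma smooth_step_bounds: "0 \<le> smooth_step x" "smooth_step x \<le> 1"
  using smooth_step_eq_0[of "min x 0"] smooth_step_mono[of "min x 0" x]
    smooth_step_eq_1[of "max x 1"] smooth_step_mono[of x "max x 1"] by auto

text \<open>An algebra of functions that contains the cutoffs and kernels used below. Membership is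
preserved by every directional derivative, so its members are of class \<open>C_diff k\<close> for all \<open>k\<close>
without any calculus of higher derivatives.\<close>
inductive smooth :: "(plane \<Rightarrow> real) \<Rightarrow> bool" where
  smooth_const: "smooth (\<lambda>_. c)"
| smooth_fst: "smooth fst"
| smooth_snd: "smooth snd"
| smooth_add: "smooth f \<Longrightarrow> smooth g \<Longrightarrow> smooth (\<lambda>z. f z + g z)"
| smooth_mult: "smooth f \<Longrightarrow> smooth g \<Longrightarrow> smooth (\<lambda>z. f z * g z)"
| smooth_flat: "smooth f \<Longrightarrow> smooth (\<lambda>z. flat n (f z))"
| smooth_smooth_step: "smooth f \<Longrightarrow> smooth (\<lambda>z. smooth_step (f z))"

lemma smooth_diff: "smooth f \<Longrightarrow> smooth g \<Longrightarrow> smooth (\<lambda>z. f z - g z)"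
  using smooth_add[of f "\<lambda>z. (-1) * g z"] smooth_mult[OF smooth_const, of g "-1"] by simp

lemma smooth_bump:
  assumes "smooth f"
  shows "smooth (\<lambda>z. bump (f z))"
  unfolding bump_def by (intro smooth_mult smooth_flat smooth_diff smooth_const assms)

lemma smooth_mollifier:
  assumes "smooth f"
  shows "smooth (\<lambda>z. mollifier (f z))"
  using smooth_mult[OF smooth_const smooth_bump[OF assms],
      of "1 / (bump_primitive 1 - bump_primitive 0)"]
  by (simp add: mollifier_def)

lemma dir_deriv_eq: "(f has_derivative f') (at z) \<Longrightarrow> dir_deriv v f z = f' v"
  by (simp add: dir_deriv_def frechet_derivative_at[symmetric])

lemma smooth_derivative:
  assumes "smooth f"
  shows "(\<forall>z. f differentiable at z) \<and> (\<forall>v. smooth (dir_deriv v f))"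
  using assms
proof induction
  case (smooth_const c)
  have "dir_deriv v (\<lambda>_. c) = (\<lambda>_. 0)" for v
    by (rule ext) (simp add: dir_deriv_eq[OF has_derivative_const])
  then show ?case
    by (auto intro: smooth.smooth_const)
next
  case smooth_fst
  have D: "(fst has_derivative fst) (at z)" for z :: plane
    using has_derivative_fst[OF has_derivative_ident[of "at z"]] by simp
  then have "dir_deriv v fst = (\<lambda>_. fst v)" for v
    by (intro ext dir_deriv_eq)
  with D show ?case
    by (auto intro: smooth.smooth_const simp: differentiable_def)
next
  case smooth_snd
  have D: "(snd has_derivative snd) (at z)" for z :: plane
    using has_derivative_snd[OF has_derivative_ident[of "at z"]] by simp
  then have "dir_deriv v snd = (\<lambda>_. snd v)" for v
    by (intro ext dir_deriv_eq)
  with D show ?case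
    by (auto intro: smooth.smooth_const simp: differentiable_def)
next
  case (smooth_add f g)
  then have df: "(f has_derivative frechet_derivative f (at z)) (at z)"
    and dg: "(g has_derivative frechet_derivative g (at z)) (at z)" for z
    unfolding frechet_derivative_works[symmetric] by blast+
  have "dir_deriv v (\<lambda>z. f z + g z) = (\<lambda>z. dir_deriv v f z + dir_deriv v g z)" for v
    by (rule ext) (simp add: dir_deriv_eq[OF has_derivative_add[OF df dg]] dir_deriv_def)
  moreover have "smooth (\<lambda>z. dir_deriv v f z + dir_deriv v g z)" for v
    using smooth_add by (intro smooth.smooth_add) blast+
  moreover have "(\<lambda>z. f z + g z) differentiable at z" for z
    using has_derivative_add[OF df dg] unfolding differentiable_def by blast
  ultimately show ?case
    by simp
next
  case (smooth_mult f g)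
  then have df: "(f has_derivative frechet_derivative f (at z)) (at z)"
    and dg: "(g has_derivative frechet_derivative g (at z)) (at z)" for z
    unfolding frechet_derivative_works[symmetric] by blast+
  have "dir_deriv v (\<lambda>z. f z * g z) = (\<lambda>z. f z * dir_deriv v g z + dir_deriv v f z * g z)" for v
    by (rule ext) (simp add: dir_deriv_eq[OF has_derivative_mult[OF df dg]] dir_deriv_def)
  moreover have "smooth (\<lambda>z. f z * dir_deriv v g z + dir_deriv v f z * g z)" for v
    using smooth_mult by (intro smooth.smooth_add smooth.smooth_mult) blast+
  moreover have "(\<lambda>z. f z * g z) differentiable at z" for z
    using has_derivative_mult[OF df dg] unfolding differentiable_def by blast
  ultimately show ?case
    by simp
next
  case (smooth_flat f n)
  then have df: "(f has_derivative frechet_derivative f (at z)) (at z)" for z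
    unfolding frechet_derivative_works[symmetric] by blast+
  have D: "((\<lambda>z. flat n (f z)) has_derivative
      (\<lambda>v. frechet_derivative f (at z) v * (flat (n + 2) (f z) - real n * flat (n + 1) (f z)))) (at z)" for z
    using DERIV_compose_FDERIV[OF DERIV_flat df] .
  have "dir_deriv v (\<lambda>z. flat n (f z)) =
      (\<lambda>z. dir_deriv v f z * (flat (n + 2) (f z) - real n * flat (n + 1) (f z)))" for v
    by (rule ext) (simp add: dir_deriv_eq[OF D] dir_deriv_def)
  moreover have "smooth (\<lambda>z. dir_deriv v f z * (flat (n + 2) (f z) - real n * flat (n + 1) (f z)))" for v
    using smooth_flat by (intro smooth.smooth_mult smooth.smooth_flat smooth_diff smooth.smooth_const) blast+
  moreover have "(\<lambda>z. flat n (f z)) differentiable at z" for z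
    using D unfolding differentiable_def by blast
  ultimately show ?case
    by simp
next
  case (smooth_smooth_step f)
  then have df: "(f has_derivative frechet_derivative f (at z)) (at z)" for z
    unfolding frechet_derivative_works[symmetric] by blast+
  have D: "((\<lambda>z. smooth_step (f z)) has_derivative
      (\<lambda>v. frechet_derivative f (at z) v * mollifier (f z))) (at z)" for z
    using DERIV_compose_FDERIV[OF DERIV_smooth_step df] .
  have "dir_deriv v (\<lambda>z. smooth_step (f z)) = (\<lambda>z. dir_deriv v f z * mollifier (f z))" for v
    by (rule ext) (simp add: dir_deriv_eq[OF D] dir_deriv_def)
  moreover have "smooth (\<lambda>z. dir_deriv v f z * mollifier (f z))" for v
    using smooth_smooth_step by (intro smooth.smooth_mult smooth_mollifier) blast+
  moreover have "(\<lambda>z. smooth_step (f z)) differentiable at z" for z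
    using D unfolding differentiable_def by blast
  ultimately show ?case
    by simp
qed

lemma smooth_has_derivative:
  "smooth f \<Longrightarrow> (f has_derivative (\<lambda>v. dir_deriv v f z)) (at z)"
  using smooth_derivative[of f] unfolding dir_deriv_def frechet_derivative_works[symmetric] by blast

lemma smooth_dir_deriv: "smooth f \<Longrightarrow> smooth (dir_deriv v f)"
  using smooth_derivative[of f] by blast

lemma smooth_continuous_on: "smooth f \<Longrightarrow> continuous_on S f"
  using smooth_derivative[of f]
  by (intro continuous_at_imp_continuous_on ballI differentiable_imp_continuous_within) blast

lemma smooth_measurable: "smooth f \<Longrightarrow> f \<in> borel_measurable borel"
  by (intro borel_measurable_continuous_onI smooth_continuous_on)

lemma smooth_C_diff: "smooth f \<Longrightarrow> C_diff k f"
proof (induction k arbitrary: f)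
  case 0
  then show ?case
    by (simp add: smooth_continuous_on)
next
  case (Suc k)
  then show ?case
    using smooth_derivative[of f] by simp
qed

(* Points of the plane are treated as vectors, not as explicit pairs of coordinates. *)
declare split_paired_All [simp del] split_paired_Ex [simp del]

section \<open>Integration by parts for compactly supported functions\<close>

text \<open>For open sets this is continuous differentiability, stated with the directional derivatives
that occur in the weak formulations.\<close>
definition C1_on :: "plane set \<Rightarrow> (plane \<Rightarrow> real) \<Rightarrow> bool" where
  "C1_on S h \<longleftrightarrow> (\<forall>z\<in>S. h differentiable at z) \<and> (\<forall>v. continuous_on S (dir_deriv v h))"

lemma C1_on_has_derivative:
  "C1_on S h \<Longrightarrow> z \<in> S \<Longrightarrow> (h has_derivative (\<lambda>v. dir_deriv v h z)) (at z)"
  unfolding C1_on_def dir_deriv_def frechet_derivative_works[symmetric] by blast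

lemma C1_on_dir_deriv: "C1_on S h \<Longrightarrow> continuous_on S (dir_deriv v h)"
  unfolding C1_on_def by blast

lemma C1_on_subset: "C1_on T h \<Longrightarrow> S \<subseteq> T \<Longrightarrow> C1_on S h"
  unfolding C1_on_def by (blast intro: continuous_on_subset)

lemma C1_on_continuous: "C1_on S h \<Longrightarrow> continuous_on S h"
  by (intro continuous_at_imp_continuous_on ballI differentiable_imp_continuous_within)
     (simp add: C1_on_def)

lemma C1_onI:
  assumes "\<And>z. z \<in> S \<Longrightarrow> (h has_derivative h' z) (at z)"
    and "\<And>v. continuous_on S (\<lambda>z. h' z v)"
  shows "C1_on S h"
proof -
  have "continuous_on S (dir_deriv v h)" for v
    using assms(2)[of v] by (rule continuous_on_eq) (simp add: dir_deriv_eq[OF assms(1)])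
  then show ?thesis
    using assms(1) unfolding C1_on_def differentiable_def by blast
qed

lemma dir_deriv_mult:
  assumes "C1_on S f" "C1_on S g" "z \<in> S"
  shows "dir_deriv v (\<lambda>z. f z * g z) z = f z * dir_deriv v g z + dir_deriv v f z * g z"
  by (rule dir_deriv_eq[OF has_derivative_mult])
     (use assms in \<open>blast intro: C1_on_has_derivative\<close>)+

lemma C1_on_mult:
  assumes "C1_on S f" "C1_on S g"
  shows "C1_on S (\<lambda>z. f z * g z)"
proof (rule C1_onI)
  show "((\<lambda>z. f z * g z) has_derivative (\<lambda>v. f z * dir_deriv v g z + dir_deriv v f z * g z)) (at z)"
    if "z \<in> S" for z
    by (rule has_derivative_mult) (use assms that in \<open>blast intro: C1_on_has_derivative\<close>)+
  show "continuous_on S (\<lambda>z. f z * dir_deriv v g z + dir_deriv v f z * g z)" for v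
    using assms assms[THEN C1_on_continuous] unfolding C1_on_def
    by (intro continuous_on_add continuous_on_mult) blast+
qed

lemma dir_deriv_outside_support:
  assumes "closed K" "\<And>z. z \<notin> K \<Longrightarrow> f z = 0" "z \<notin> K"
  shows "(f has_derivative (\<lambda>_. 0)) (at z)" "dir_deriv v f z = 0"
proof -
  have "((\<lambda>_. 0::real) has_derivative (\<lambda>_. 0)) (at z)"
    by simp
  then show D: "(f has_derivative (\<lambda>_. 0)) (at z)"
    by (rule has_derivative_transform_within_open[where s = "- K"])
       (use assms in \<open>auto simp: open_Compl\<close>)
  show "dir_deriv v f z = 0"
    using dir_deriv_eq[OF D] by simp
qed

text \<open>Kinetic entropies involve the velocity \<open>m / \<rho>\<close>, which is singular at vacuum. Multiplied by a
test function on the state space they vanish near vacuum, and the two open sets \<open>S\<close> and \<open>- K\<close> cover the plane.\<close>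
lemma continuous_on_cutoff:
  fixes h :: "plane \<Rightarrow> real"
  assumes "open S" "continuous_on S h" "closed K" "K \<subseteq> S" "\<And>z. z \<notin> K \<Longrightarrow> h z = 0"
  shows "continuous_on UNIV h"
proof -
  have "continuous_on (- K) h"
    by (rule continuous_on_eq[where f = "\<lambda>_. 0"]) (use assms(5) in auto)
  then have "continuous_on (S \<union> - K) h"
    using assms by (intro continuous_on_open_Un) (auto simp: open_Compl)
  moreover have "S \<union> - K = UNIV"
    using assms(4) by auto
  ultimately show ?thesis
    by simp
qed

lemma C1_on_cutoff_mult:
  assumes "open S" "C1_on S h" "C1_on UNIV \<phi>" "closed K" "K \<subseteq> S" "\<And>z. z \<notin> K \<Longrightarrow> \<phi> z = 0"
  shows "C1_on UNIV (\<lambda>z. h z * \<phi> z)"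
proof -
  have \<phi>: "C1_on S \<phi>"
    by (rule C1_on_subset[OF assms(3) subset_UNIV])
  have C1: "C1_on S (\<lambda>z. h z * \<phi> z)"
    by (rule C1_on_mult[OF assms(2) \<phi>])
  have "(\<lambda>z. h z * \<phi> z) differentiable at z" for z
  proof (cases "z \<in> S")
    case True
    then show ?thesis
      using C1 by (simp add: C1_on_def)
  next
    case False
    then have "z \<notin> K"
      using assms(5) by auto
    then show ?thesis
      using dir_deriv_outside_support(1)[of K "\<lambda>z. h z * \<phi> z" z] assms(4,6)
      unfolding differentiable_def by auto
  qed
  moreover have "continuous_on UNIV (dir_deriv v (\<lambda>z. h z * \<phi> z))" for v
    using assms(4,6)
    by (intro continuous_on_cutoff[OF \<open>open S\<close> C1_on_dir_deriv[OF C1] assms(4,5)]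
        dir_deriv_outside_support(2)[of K]) simp_all
  ultimately show ?thesis
    unfolding C1_on_def by blast
qed

lemma integrable_compact_support:
  fixes f :: "plane \<Rightarrow> real"
  assumes "continuous_on UNIV f" "compact K" "\<And>z. z \<notin> K \<Longrightarrow> f z = 0"
  shows "integrable lborel f"
proof -
  have "integrable lborel (\<lambda>z. indicator K z *\<^sub>R f z)"
    using assms by (intro borel_integrable_compact) (auto intro: continuous_on_subset)
  moreover have "(\<lambda>z. indicator K z *\<^sub>R f z) = f"
    using assms(3) by (intro ext) (auto simp: indicator_def)
  ultimately show ?thesis
    by simp
qed

lemma lborel_integral_translation:
  fixes f :: "plane \<Rightarrow> real"
  assumes "f \<in> borel_measurable borel"
  shows "(LINT z|lborel. f (z + c)) = (LINT z|lborel. f z)"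
proof -
  have "(LINT z|lborel. f z) = (LINT z|distr lborel borel ((+) c). f z)"
    by (simp add: lborel_distr_plus)
  also have "\<dots> = (LINT z|lborel. f (c + z))"
    using assms by (intro integral_distr) auto
  finally show ?thesis
    by (simp add: add.commute)
qed

text \<open>By translation invariance the difference quotients of \<open>f\<close> in direction \<open>v\<close> have integral zero.
By the mean value theorem they are bounded by the supremum of the derivative, so dominated
convergence passes this to the derivative itself.\<close>
lemma integral_dir_deriv_eq_0:
  assumes C1: "C1_on UNIV f" and K: "compact K" "\<And>z. z \<notin> K \<Longrightarrow> f z = 0"
  shows "(LINT z|lborel. dir_deriv v f z) = 0"
proof -
  let ?D = "dir_deriv v f"
  have contf: "continuous_on UNIV f"
    by (rule C1_on_continuous[OF C1])
  have meas: "f \<in> borel_measurable borel"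
    using contf by (rule borel_measurable_continuous_onI)
  have D0: "?D z = 0" if "z \<notin> K" for z
    using K that by (intro dir_deriv_outside_support(2)[of K]) (auto simp: compact_imp_closed)
  have contD: "continuous_on UNIV ?D"
    by (rule C1_on_dir_deriv[OF C1])
  obtain B where B: "\<And>z. \<bar>?D z\<bar> \<le> B"
  proof -
    have "bounded (?D ` K)"
      using K(1) contD by (intro compact_imp_bounded compact_continuous_image)
        (auto intro: continuous_on_subset)
    then obtain b where b: "\<And>z. z \<in> K \<Longrightarrow> \<bar>?D z\<bar> \<le> b"
      by (auto simp: bounded_iff)
    show ?thesis
    proof
      show "\<bar>?D z\<bar> \<le> max b 0" for z
        using b[of z] D0[of z] by (cases "z \<in> K") auto
    qed
  qed
  obtain R where R: "\<And>z. z \<in> K \<Longrightarrow> norm z \<le> R"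
    using compact_imp_bounded[OF K(1)] by (auto simp: bounded_iff)
  define h where "h n = inverse (real (Suc n))" for n
  have h: "0 < h n" "h n \<le> 1" for n
    by (auto simp: h_def divide_simps)
  have line: "((\<lambda>t. f (z + t *\<^sub>R v)) has_real_derivative ?D (z + t *\<^sub>R v)) (at t)" for z t
  proof -
    have "((\<lambda>t. z + t *\<^sub>R v) has_derivative (\<lambda>s. s *\<^sub>R v)) (at t)"
      by (auto intro!: derivative_eq_intros)
    from has_derivative_compose[OF this C1_on_has_derivative[OF C1 UNIV_I]]
    have "((\<lambda>t. f (z + t *\<^sub>R v)) has_derivative (\<lambda>s. dir_deriv (s *\<^sub>R v) f (z + t *\<^sub>R v))) (at t)" .
    moreover have "dir_deriv (s *\<^sub>R v) f (z + t *\<^sub>R v) = ?D (z + t *\<^sub>R v) * s" for s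
      using linear_scale[OF has_derivative_linear[OF C1_on_has_derivative[OF C1 UNIV_I]]]
      by simp
    ultimately show ?thesis
      by (simp add: has_field_derivative_def)
  qed
  define q where "q n z = (f (z + h n *\<^sub>R v) - f z) / h n" for n z
  have q_bound: "\<bar>q n z\<bar> \<le> B" for n z
  proof -
    from MVT2[of 0 "h n", OF h(1) line] obtain \<xi> where
      "f (z + h n *\<^sub>R v) - f (z + 0 *\<^sub>R v) = (h n - 0) * ?D (z + \<xi> *\<^sub>R v)"
      by blast
    then have "q n z = ?D (z + \<xi> *\<^sub>R v)"
      using h(1)[of n] by (simp add: q_def)
    with B show ?thesis
      by simp
  qed
  have q_0: "q n z = 0" if "z \<notin> cball 0 (R + norm v)" for n z
  proof -
    have "norm (h n *\<^sub>R v) \<le> norm v"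
      using h[of n] by (simp add: mult_left_le_one_le)
    then have "norm z \<le> norm (z + h n *\<^sub>R v) + norm v"
      using norm_triangle_ineq4[of "z + h n *\<^sub>R v" "h n *\<^sub>R v"] by simp
    then have "z \<notin> K" "z + h n *\<^sub>R v \<notin> K"
      using that R[of z] R[of "z + h n *\<^sub>R v"] norm_ge_zero[of v] by (auto simp del: norm_ge_zero)
    then show ?thesis
      by (simp add: q_def K(2))
  qed
  have q_int: "(LINT z|lborel. q n z) = 0" for n
  proof -
    have i1: "integrable lborel f"
      by (rule integrable_compact_support[OF contf K])
    have "integrable lborel (\<lambda>z. f (z + h n *\<^sub>R v))"
    proof (rule integrable_compact_support)
      show "continuous_on UNIV (\<lambda>z. f (z + h n *\<^sub>R v))"
        by (rule continuous_on_compose2[OF contf]) (auto intro!: continuous_intros)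
      show "compact ((+) (- (h n *\<^sub>R v)) ` K)"
        using K(1) by (rule compact_translation)
      show "f (z + h n *\<^sub>R v) = 0" if "z \<notin> (+) (- (h n *\<^sub>R v)) ` K" for z
        using that by (intro K(2)) (auto simp: image_iff)
    qed
    then have "(LINT z|lborel. q n z) = ((LINT z|lborel. f (z + h n *\<^sub>R v)) - (LINT z|lborel. f z)) / h n"
      using i1 by (simp add: q_def)
    then show ?thesis
      using lborel_integral_translation[OF meas, of "h n *\<^sub>R v"] by simp
  qed
  have "(\<lambda>n. LINT z|lborel. q n z) \<longlonglongrightarrow> (LINT z|lborel. ?D z)"
  proof (rule integral_dominated_convergence)
    show "?D \<in> borel_measurable lborel"
      using borel_measurable_continuous_onI[OF contD] by simp
    show "q n \<in> borel_measurable lborel" for n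
      using meas unfolding q_def[abs_def] by measurable
    show "integrable lborel (\<lambda>z::plane. B * indicator (cball 0 (R + norm v)) z)"
      by (intro integrable_mult_right integrable_real_indicator)
         (use emeasure_bounded_finite[OF bounded_cball, of "0::plane" "R + norm v"] in auto)
    show "AE z in lborel. norm (q n z) \<le> B * indicator (cball 0 (R + norm v)) z" for n
      using q_bound q_0 by (auto simp: indicator_def simp del: mem_cball)
    have "(\<lambda>n. q n z) \<longlonglongrightarrow> ?D z" for z
    proof -
      have "((\<lambda>t. (f (z + t *\<^sub>R v) - f z) / t) \<longlongrightarrow> ?D z) (at 0)"
        using line[of z 0] by (simp add: DERIV_def)
      moreover have "filterlim h (at 0) sequentially"
        unfolding filterlim_at using LIMSEQ_inverse_real_of_nat h
        by (auto simp: h_def[abs_def])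
      ultimately show ?thesis
        unfolding q_def by (rule filterlim_compose)
    qed
    then show "AE z in lborel. (\<lambda>n. q n z) \<longlonglongrightarrow> ?D z"
      by simp
  qed
  then show ?thesis
    by (simp add: q_int LIMSEQ_const_iff)
qed

lemma set_lebesgue_integral_eq_lborel:
  fixes f :: "plane \<Rightarrow> real"
  assumes "f \<in> borel_measurable lborel" "\<And>z. z \<notin> S \<Longrightarrow> f z = 0"
  shows "(LINT z:S|lebesgue. f z) = (LINT z|lborel. f z)"
proof -
  have "(LINT z:S|lebesgue. f z) = (LINT z|lebesgue. f z)"
    unfolding set_lebesgue_integral_def
    by (rule Bochner_Integration.integral_cong) (use assms(2) in \<open>auto simp: indicator_def\<close>)
  then show ?thesis
    using assms(1) by (simp add: integral_completion)
qed

lemma integration_by_parts: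
  assumes S: "open S" and h: "C1_on S h" and \<phi>: "C1_on UNIV \<phi>"
    and K: "compact K" "K \<subseteq> S" "\<And>z. z \<notin> K \<Longrightarrow> \<phi> z = 0"
  shows "integrable lborel (\<lambda>z. h z * dir_deriv v \<phi> z)"
    and "integrable lborel (\<lambda>z. dir_deriv v h z * \<phi> z)"
    and "(LINT z|lborel. h z * dir_deriv v \<phi> z) = - (LINT z|lborel. dir_deriv v h z * \<phi> z)"
proof -
  have cl: "closed K"
    by (rule compact_imp_closed[OF K(1)])
  have \<phi>': "C1_on S \<phi>"
    by (rule C1_on_subset[OF \<phi> subset_UNIV])
  have d\<phi>: "dir_deriv v \<phi> z = 0" if "z \<notin> K" for z
    by (rule dir_deriv_outside_support(2)[OF cl K(3) that])
  show i1: "integrable lborel (\<lambda>z. h z * dir_deriv v \<phi> z)"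
    using d\<phi>
    by (intro integrable_compact_support[OF _ K(1)] continuous_on_cutoff[OF S _ cl K(2)]
        continuous_on_mult C1_on_continuous[OF h] C1_on_dir_deriv[OF \<phi>']) simp_all
  show i2: "integrable lborel (\<lambda>z. dir_deriv v h z * \<phi> z)"
    using K(3)
    by (intro integrable_compact_support[OF _ K(1)] continuous_on_cutoff[OF S _ cl K(2)]
        continuous_on_mult C1_on_continuous[OF \<phi>'] C1_on_dir_deriv[OF h]) simp_all
  have "dir_deriv v (\<lambda>z. h z * \<phi> z) z = h z * dir_deriv v \<phi> z + dir_deriv v h z * \<phi> z" for z
  proof (cases "z \<in> S")
    case True
    then show ?thesis
      by (rule dir_deriv_mult[OF h \<phi>'])
  next
    case False
    then have "z \<notin> K"
      using K(2) by auto
    then show ?thesis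
      using d\<phi> K(3) by (simp add: dir_deriv_outside_support(2)[OF cl])
  qed
  then have "(LINT z|lborel. h z * dir_deriv v \<phi> z + dir_deriv v h z * \<phi> z) = 0"
    using integral_dir_deriv_eq_0[OF C1_on_cutoff_mult[OF S h \<phi> cl K(2,3)] K(1), of v] K(3)
    by simp
  then show "(LINT z|lborel. h z * dir_deriv v \<phi> z) = - (LINT z|lborel. dir_deriv v h z * \<phi> z)"
    using i1 i2 by simp
qed

section \<open>Kinetic entropies\<close>

text \<open>A function with a supporting affine function at each point of a convex set is convex there.
This avoids second derivatives, which kinetic entropies need not have.\<close>
lemma convex_on_if_supported:
  fixes f :: "'a::real_inner \<Rightarrow> real"
  assumes "convex S"
    and supp: "\<And>z. z \<in> S \<Longrightarrow> \<exists>p c. f z = c + p \<bullet> z \<and> (\<forall>y\<in>S. c + p \<bullet> y \<le> f y)"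
  shows "convex_on S f"
proof (rule convex_onI)
  fix t :: real and x y assume t: "0 < t" "t < 1" and xy: "x \<in> S" "y \<in> S"
  let ?z = "(1 - t) *\<^sub>R x + t *\<^sub>R y"
  have "?z \<in> S"
    using assms(1) t xy by (simp add: convex_alt)
  from supp[OF this] obtain p c where z: "f ?z = c + p \<bullet> ?z"
    and le: "\<And>y. y \<in> S \<Longrightarrow> c + p \<bullet> y \<le> f y"
    by blast
  have "f ?z = (1 - t) * (c + p \<bullet> x) + t * (c + p \<bullet> y)"
    unfolding z by (simp add: inner_add_right algebra_simps)
  also have "\<dots> \<le> (1 - t) * f x + t * f y"
    using t xy by (intro add_mono mult_left_mono le) auto
  finally show "f ?z \<le> (1 - t) * f x + t * f y" .
qed (rule assms)

lemma secant_bounds: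
  fixes g :: "real \<Rightarrow> real"
  assumes "convex_on UNIV g" "a < b"
  defines "l \<equiv> \<lambda>v. (g b - g a) / (b - a) * (v - a) + g a"
  shows "v \<in> {a..b} \<Longrightarrow> g v \<le> l v" and "v \<notin> {a<..<b} \<Longrightarrow> l v \<le> g v"
proof -
  show "g v \<le> l v" if "v \<in> {a..b}"
    unfolding l_def using that assms(1) by (intro convex_onD_Icc') (auto intro: convex_on_subset)
  show "l v \<le> g v" if "v \<notin> {a<..<b}"
  proof (cases v a rule: linorder_cases)
    case equal
    then show ?thesis
      by (simp add: l_def)
  next
    case less
    have "g a \<le> (g b - g v) / (b - v) * (a - v) + g v"
      using less assms(1,2) by (intro convex_onD_Icc') (auto intro: convex_on_subset)
    then have "(g a - g v) * (b - v) \<le> (g b - g v) * (a - v)"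
      using less assms(2) by (simp add: field_simps)
    then have "(g b - g a) * (v - a) \<le> (g v - g a) * (b - a)"
      by (simp add: algebra_simps)
    then show ?thesis
      using assms(2) by (simp add: l_def field_simps)
  next
    case greater
    then have v: "b \<le> v" "a < v"
      using that by auto
    have "g b \<le> (g v - g a) / (v - a) * (b - a) + g a"
      using v assms(1,2) by (intro convex_onD_Icc') (auto intro: convex_on_subset)
    then have "(g b - g a) * (v - a) \<le> (g v - g a) * (b - a)"
      using v assms(2) by (simp add: field_simps)
    then show ?thesis
      using assms(2) by (simp add: l_def field_simps)
  qed
qed

text \<open>Extending the interval beyond \<open>{a..b}\<close> adds a nonnegative amount to the integral of \<open>h\<close>, and
shrinking it removes a nonpositive amount.\<close>
lemma increment_minimal:
  fixes H :: "real \<Rightarrow> real"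
  assumes H: "\<And>v. (H has_real_derivative h v) (at v)"
    and neg: "\<And>v. v \<in> {a..b} \<Longrightarrow> h v \<le> 0" and pos: "\<And>v. v \<notin> {a<..<b} \<Longrightarrow> 0 \<le> h v"
    and "a \<le> b" "x \<le> y"
  shows "H b - H a \<le> H y - H x"
proof -
  have inc: "H u \<le> H v" if "u \<le> v" "v \<le> a \<or> b \<le> u" for u v
    using that(1)
  proof (rule DERIV_nonneg_imp_nondecreasing)
    fix s assume "u \<le> s" "s \<le> v"
    with that(2) have "s \<notin> {a<..<b}"
      by auto
    then show "\<exists>d. (H has_real_derivative d) (at s) \<and> 0 \<le> d"
      using H pos by blast
  qed
  have dec: "H v \<le> H u" if "a \<le> u" "u \<le> v" "v \<le> b" for u v
    using that(2)
  proof (rule DERIV_nonpos_imp_nonincreasing)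
    fix s assume "u \<le> s" "s \<le> v"
    with that have "s \<in> {a..b}"
      by auto
    then show "\<exists>d. (H has_real_derivative d) (at s) \<and> d \<le> 0"
      using H neg by blast
  qed
  show ?thesis
    using inc[of x y] inc[of x a] inc[of b y] dec[of a b] dec[of a x] dec[of y b] assms(4,5)
    by linarith
qed

lemma lambda_less: "z \<in> states \<Longrightarrow> lambda1 z < lambda2 z"
  by (auto simp: states_def lambda1_def lambda2_def)

lemma open_states: "open states" and convex_states: "convex states"
  by (auto simp: states_def intro!: open_Times convex_Times)

text \<open>The integral of \<open>g\<close> between the Riemann invariants, for a primitive \<open>G\<close> of \<open>g\<close>.\<close>
definition kinetic_density :: "(real \<Rightarrow> real) \<Rightarrow> plane \<Rightarrow> real" where
  "kinetic_density G z = G (lambda2 z) - G (lambda1 z)"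

text \<open>At a given state subtract from \<open>g\<close> its secant between the two Riemann invariants. The integral of
the secant is an affine function of the state, because the integrals of \<open>1\<close> and \<open>v\<close> are density and
momentum. What remains is nonpositive between the invariants and nonnegative elsewhere, so its
integral is minimal at the given state. Hence the affine function supports the entropy there.\<close>
lemma convex_on_kinetic_density:
  assumes g: "convex_on UNIV g" and G: "\<And>v. (G has_real_derivative g v) (at v)"
  shows "convex_on states (kinetic_density G)"
proof (rule convex_on_if_supported[OF convex_states])
  fix z assume z: "z \<in> states"
  define a b where "a = lambda1 z" and "b = lambda2 z"
  have ab: "a < b"
    unfolding a_def b_def by (rule lambda_less[OF z])
  define s where "s = (g b - g a) / (b - a)"
  define L where "L v = s * (v\<^sup>2 / 2 - a * v) + g a * v" for v
  have L: "(L has_real_derivative s * (v - a) + g a) (at v)" for v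
    unfolding L_def[abs_def] by (auto intro!: derivative_eq_intros)
  have L_affine: "L (lambda2 y) - L (lambda1 y) = (g a - s * a, s) \<bullet> y" if "y \<in> states" for y
    using that by (cases y) (auto simp: states_def L_def lambda1_def lambda2_def field_simps power2_eq_square)
  have H: "((\<lambda>v. G v - L v) has_real_derivative g v - (s * (v - a) + g a)) (at v)" for v
    by (intro DERIV_diff G L)
  define c where "c = (G b - L b) - (G a - L a)"
  have "kinetic_density G z = c + (g a - s * a, s) \<bullet> z"
    using L_affine[OF z] by (simp add: kinetic_density_def c_def a_def b_def)
  moreover have "c + (g a - s * a, s) \<bullet> y \<le> kinetic_density G y" if "y \<in> states" for y
  proof -
    have "c \<le> (G (lambda2 y) - L (lambda2 y)) - (G (lambda1 y) - L (lambda1 y))"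
      unfolding c_def
      by (rule increment_minimal[OF H])
         (use secant_bounds[OF g ab] lambda_less[OF that] ab in \<open>auto simp: s_def\<close>)
    then show ?thesis
      using L_affine[OF that] by (simp add: kinetic_density_def)
  qed
  ultimately show "\<exists>p c. kinetic_density G z = c + p \<bullet> z \<and> (\<forall>y\<in>states. c + p \<bullet> y \<le> kinetic_density G y)"
    by blast
qed

text \<open>The differential of \<open>m / \<rho> + c * \<rho>\<close>, which is \<open>lambda1\<close> for \<open>c = - 1 / 2\<close> and \<open>lambda2\<close> for
\<open>c = 1 / 2\<close>.\<close>
definition d_lambda :: "real \<Rightarrow> plane \<Rightarrow> plane \<Rightarrow> real" where
  "d_lambda c z v = snd v / fst z - snd z * fst v / (fst z)\<^sup>2 + c * fst v"

lemma lambda_has_derivative: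
  assumes "z \<in> states"
  shows "(lambda1 has_derivative d_lambda (- 1 / 2) z) (at z)"
    and "(lambda2 has_derivative d_lambda (1 / 2) z) (at z)"
proof -
  have z: "fst z \<noteq> 0"
    using assms by (auto simp: states_def)
  have D: "((\<lambda>z. snd z / fst z + c * fst z) has_derivative d_lambda c z) (at z)" for c
    using z unfolding d_lambda_def
    by (auto intro!: derivative_eq_intros ext simp: field_simps power2_eq_square)
  have eq1: "lambda1 = (\<lambda>z. snd z / fst z + (- 1 / 2) * fst z)"
    by (auto simp: lambda1_def)
  show "(lambda1 has_derivative d_lambda (- 1 / 2) z) (at z)"
    unfolding eq1 by (rule D)
  have eq2: "lambda2 = (\<lambda>z. snd z / fst z + (1 / 2) * fst z)"
    by (auto simp: lambda2_def)
  show "(lambda2 has_derivative d_lambda (1 / 2) z) (at z)"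
    unfolding eq2 by (rule D)
qed

lemma continuous_on_lambda: "continuous_on states lambda1" "continuous_on states lambda2"
  using lambda_has_derivative
  by (auto intro!: continuous_at_imp_continuous_on has_derivative_continuous)

lemma kinetic_density_has_derivative:
  assumes G: "\<And>v. (G has_real_derivative g v) (at v)" and z: "z \<in> states"
  shows "(kinetic_density G has_derivative
    (\<lambda>v. g (lambda2 z) * d_lambda (1 / 2) z v - g (lambda1 z) * d_lambda (- 1 / 2) z v)) (at z)"
proof -
  have "((\<lambda>z. G (lambda2 z) - G (lambda1 z)) has_derivative
      (\<lambda>v. d_lambda (1 / 2) z v * g (lambda2 z) - d_lambda (- 1 / 2) z v * g (lambda1 z))) (at z)"
    by (intro has_derivative_diff DERIV_compose_FDERIV[OF G] lambda_has_derivative z)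
  then show ?thesis
    by (simp add: kinetic_density_def[abs_def] mult.commute)
qed

lemma C1_on_kinetic_density:
  assumes G: "\<And>v. (G has_real_derivative g v) (at v)" and g: "continuous_on UNIV g"
  shows "C1_on states (kinetic_density G)"
proof (rule C1_onI[OF kinetic_density_has_derivative[OF G]])
  have "continuous_on states (\<lambda>z. d_lambda c z v)" for c v
    unfolding d_lambda_def by (auto intro!: continuous_intros simp: states_def)
  then show "continuous_on states
      (\<lambda>z. g (lambda2 z) * d_lambda (1 / 2) z v - g (lambda1 z) * d_lambda (- 1 / 2) z v)" for v
    by (intro continuous_intros continuous_on_compose2[OF g continuous_on_lambda(1)]
        continuous_on_compose2[OF g continuous_on_lambda(2)]) auto
qed

definition d_flux :: "plane \<Rightarrow> plane \<Rightarrow> plane" where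
  "d_flux z v = (snd v, 2 * (snd z / fst z) * snd v - (snd z / fst z)\<^sup>2 * fst v + (fst z)\<^sup>2 / 4 * fst v)"

lemma flux_has_derivative:
  assumes "z \<in> states"
  shows "(flux has_derivative d_flux z) (at z)"
proof -
  have z: "fst z \<noteq> 0"
    using assms by (auto simp: states_def)
  have "((\<lambda>z. (snd z, (snd z)\<^sup>2 / fst z + (fst z) ^ 3 / 12)) has_derivative d_flux z) (at z)"
    using z unfolding d_flux_def
    by (auto intro!: derivative_eq_intros ext simp: field_simps power2_eq_square power3_eq_cube)
  moreover have "flux = (\<lambda>z. (snd z, (snd z)\<^sup>2 / fst z + (fst z) ^ 3 / 12))"
    by (auto simp: flux_def)
  ultimately show ?thesis
    by simp
qed

text \<open>Each Riemann invariant is also the characteristic speed of its own family: its differential is a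
left eigenvector of the Jacobian of the flux, with the invariant itself as eigenvalue. This is special
to \<gamma> = 3 and makes the kinetic flux compatible with the kinetic entropy.\<close>
lemma d_lambda_d_flux:
  assumes "z \<in> states"
  shows "d_lambda (- 1 / 2) z (d_flux z v) = lambda1 z * d_lambda (- 1 / 2) z v"
    and "d_lambda (1 / 2) z (d_flux z v) = lambda2 z * d_lambda (1 / 2) z v"
  using assms
  by (auto simp: states_def d_lambda_def d_flux_def lambda1_def lambda2_def split_beta)
     (simp_all add: field_simps power2_eq_square)

lemma sum_Basis_plane: "(\<Sum>i\<in>Basis. f i) = f (1, 0) + f ((0, 1)::plane)"
  by (simp add: Basis_prod_def sum.union_disjoint add.commute)

lemma test_functionD:
  assumes "test_function S \<phi>"
  shows "C1_on UNIV \<phi>"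
    and "\<exists>K. compact K \<and> K \<subseteq> S \<and> (\<forall>z. z \<notin> K \<longrightarrow> \<phi> z = 0)"
proof -
  have "C_diff (Suc 0) \<phi>"
    using assms by (simp only: test_function_def)
  then show "C1_on UNIV \<phi>"
    by (simp add: C1_on_def)
  have "compact (closure {z. \<phi> z \<noteq> 0}) \<and> closure {z. \<phi> z \<noteq> 0} \<subseteq> S \<and>
      (\<forall>z. z \<notin> closure {z. \<phi> z \<noteq> 0} \<longrightarrow> \<phi> z = 0)"
    using assms closure_subset[of "{z. \<phi> z \<noteq> 0}"] by (auto simp: test_function_def)
  then show "\<exists>K. compact K \<and> K \<subseteq> S \<and> (\<forall>z. z \<notin> K \<longrightarrow> \<phi> z = 0)"
    by blast
qed

text \<open>On the state space \<open>Dq = D\<eta> f'\<close> holds classically by \<open>d_lambda_d_flux\<close>. Integration by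
parts turns this into the distributional identity that defines entropy pairs.\<close>
theorem entropy_pair_kinetic:
  assumes g: "convex_on UNIV g"
    and G: "\<And>v. (G has_real_derivative g v) (at v)"
    and P: "\<And>v. (P has_real_derivative v * g v) (at v)"
  shows "entropy_pair (kinetic_density G) (kinetic_density P)"
  unfolding entropy_pair_def
proof (intro conjI allI impI)
  have contg: "continuous_on UNIV g"
    using g by (intro convex_on_continuous) auto
  then have contvg: "continuous_on UNIV (\<lambda>v. v * g v)"
    by (intro continuous_intros)
  note \<eta> = C1_on_kinetic_density[OF G contg] and q = C1_on_kinetic_density[OF P contvg]
  show "convex_on states (kinetic_density G)"
    by (rule convex_on_kinetic_density[OF g G])
  show "continuous_on states (kinetic_density G)" "continuous_on states (kinetic_density P)"
    by (intro C1_on_continuous \<eta> q)+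
  fix \<phi> v assume test: "test_function states \<phi>"
  obtain K where K: "compact K" "K \<subseteq> states" "\<And>z. z \<notin> K \<Longrightarrow> \<phi> z = 0"
    using test_functionD(2)[OF test] by blast
  note \<phi> = test_functionD(1)[OF test]
  define F where "F i w = frechet_derivative flux (at w) v \<bullet> i" for i w
  have F_eq: "F i w = d_flux w v \<bullet> i" if "w \<in> states" for i w
    unfolding F_def using frechet_derivative_at[OF flux_has_derivative[OF that]] by simp
  have F: "C1_on states (F i)" for i
  proof (rule C1_onI)
    fix w assume w: "w \<in> states"
    then have w0: "fst w \<noteq> 0"
      by (auto simp: states_def)
    have "((\<lambda>w. d_flux w v \<bullet> i) has_derivative
        (\<lambda>u. (2 * d_lambda 0 w u * snd v - 2 * (snd w / fst w) * d_lambda 0 w u * fst v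
          + fst w * fst u / 2 * fst v) * snd i)) (at w)"
      unfolding d_flux_def inner_prod_def using w0
      by (auto intro!: derivative_eq_intros ext simp: d_lambda_def field_simps power2_eq_square)
    then show "(F i has_derivative
        (\<lambda>u. (2 * d_lambda 0 w u * snd v - 2 * (snd w / fst w) * d_lambda 0 w u * fst v
          + fst w * fst u / 2 * fst v) * snd i)) (at w)"
      by (rule has_derivative_transform_within_open[OF _ open_states w]) (simp add: F_eq)
  next
    show "continuous_on states (\<lambda>w. (2 * d_lambda 0 w u * snd v
        - 2 * (snd w / fst w) * d_lambda 0 w u * fst v + fst w * fst u / 2 * fst v) * snd i)" for u
      unfolding d_lambda_def by (auto intro!: continuous_intros simp: states_def)
  qed
  define \<psi> where "\<psi> i = (\<lambda>w. \<phi> w * F i w)" for i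
  have \<psi>: "C1_on UNIV (\<psi> i)" for i
    using C1_on_cutoff_mult[OF open_states F \<phi> compact_imp_closed[OF K(1)] K(2,3)]
    by (simp add: \<psi>_def mult.commute)
  have \<psi>0: "\<psi> i z = 0" if "z \<notin> K" for i z
    using K(3)[OF that] by (simp add: \<psi>_def)
  note ibp_q = integration_by_parts[OF open_states q \<phi> K, of v]
  note ibp = integration_by_parts[OF open_states \<eta> \<psi> K(1,2) \<psi>0]
  have balance: "(\<Sum>i\<in>Basis. dir_deriv i (kinetic_density G) w * \<psi> i w) =
      dir_deriv v (kinetic_density P) w * \<phi> w" for w
  proof (cases "w \<in> states")
    case True
    have lin: "d_lambda c w (1, 0) * fst y + d_lambda c w (0, 1) * snd y = d_lambda c w y" for c y
      by (simp add: d_lambda_def algebra_simps)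
    have "(\<Sum>i\<in>Basis. dir_deriv i (kinetic_density G) w * \<psi> i w) =
        \<phi> w * (g (lambda2 w) * d_lambda (1 / 2) w (d_flux w v) - g (lambda1 w) * d_lambda (- 1 / 2) w (d_flux w v))"
      unfolding sum_Basis_plane \<psi>_def F_eq[OF True]
        dir_deriv_eq[OF kinetic_density_has_derivative[OF G True]] lin[symmetric, of _ "d_flux w v"]
      by (simp add: inner_prod_def algebra_simps)
    also have "\<dots> = dir_deriv v (kinetic_density P) w * \<phi> w"
      unfolding d_lambda_d_flux[OF True] dir_deriv_eq[OF kinetic_density_has_derivative[OF P True]]
      by (simp add: algebra_simps)
    finally show ?thesis .
  next
    case False
    then have "\<phi> w = 0"
      using K by blast
    then show ?thesis
      by (simp add: \<psi>_def)
  qed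
  have "(LINT w:states|lebesgue. kinetic_density P w * dir_deriv v \<phi> w) =
      (LINT w|lborel. kinetic_density P w * dir_deriv v \<phi> w)"
  proof (rule set_lebesgue_integral_eq_lborel[OF borel_measurable_integrable[OF ibp_q(1)]])
    show "kinetic_density P w * dir_deriv v \<phi> w = 0" if "w \<notin> states" for w
    proof -
      have "w \<notin> K"
        using that K(2) by auto
      then show ?thesis
        using dir_deriv_outside_support(2)[OF compact_imp_closed[OF K(1)] K(3)] by simp
    qed
  qed
  also have "\<dots> = - (LINT w|lborel. (\<Sum>i\<in>Basis. dir_deriv i (kinetic_density G) w * \<psi> i w))"
    unfolding balance by (rule ibp_q)
  also have "\<dots> = (\<Sum>i\<in>Basis. - (LINT w|lborel. dir_deriv i (kinetic_density G) w * \<psi> i w))"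
    using ibp(2) by (subst Bochner_Integration.integral_sum) (auto simp: sum_negf)
  also have "\<dots> = (\<Sum>i\<in>Basis. LINT w|lborel. kinetic_density G w * dir_deriv i (\<psi> i) w)"
    using ibp(3) by (intro sum.cong) auto
  also have "\<dots> = (LINT w|lborel. (\<Sum>i\<in>Basis. kinetic_density G w * dir_deriv i (\<psi> i) w))"
    using ibp(1) by (subst Bochner_Integration.integral_sum) auto
  also have "\<dots> = (LINT w|lborel. kinetic_density G w * (\<Sum>i\<in>Basis. dir_deriv i (\<psi> i) w))"
    by (simp add: sum_distrib_left)
  also have "\<dots> = (LINT w:states|lebesgue. kinetic_density G w * (\<Sum>i\<in>Basis. dir_deriv i (\<psi> i) w))"
  proof (rule set_lebesgue_integral_eq_lborel[symmetric])
    have "integrable lborel (\<lambda>w. kinetic_density G w * (\<Sum>i\<in>Basis. dir_deriv i (\<psi> i) w))"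
      unfolding sum_distrib_left using ibp(1) by (intro Bochner_Integration.integrable_sum) auto
    then show "(\<lambda>w. kinetic_density G w * (\<Sum>i\<in>Basis. dir_deriv i (\<psi> i) w)) \<in> borel_measurable lborel"
      by (rule borel_measurable_integrable)
    show "kinetic_density G w * (\<Sum>i\<in>Basis. dir_deriv i (\<psi> i) w) = 0" if "w \<notin> states" for w
    proof -
      have "w \<notin> K"
        using that K(2) by auto
      then show ?thesis
        using dir_deriv_outside_support(2)[OF compact_imp_closed[OF K(1)] \<psi>0] by simp
    qed
  qed
  finally show "(LINT w:states|lebesgue. kinetic_density P w * dir_deriv v \<phi> w) =
      (LINT w:states|lebesgue. kinetic_density G w *
        (\<Sum>i\<in>Basis. dir_deriv i (\<lambda>w'. \<phi> w' * (frechet_derivative flux (at w') v \<bullet> i)) w))"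
    by (simp only: \<psi>_def F_def)
qed

section \<open>Bilinear pairings against a kernel\<close>

definition pairing :: "(plane \<times> plane \<Rightarrow> real) \<Rightarrow> (plane \<Rightarrow> real) \<Rightarrow> (plane \<Rightarrow> real) \<Rightarrow> real" where
  "pairing k f g = (LINT p|(lborel \<Otimes>\<^sub>M lborel). f (fst p) * g (snd p) * k p)"

lemma integrable_pairing:
  fixes f g :: "plane \<Rightarrow> real"
  assumes f: "integrable lborel f" and g: "integrable lborel g"
    and k: "k \<in> borel_measurable (lborel \<Otimes>\<^sub>M lborel)" "\<And>p. \<bar>k p\<bar> \<le> B"
  shows "integrable (lborel \<Otimes>\<^sub>M lborel) (\<lambda>p. f (fst p) * g (snd p) * k p)"
proof -
  note [measurable] = borel_measurable_integrable[OF f] borel_measurable_integrable[OF g] k(1)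
  have "integrable (lborel \<Otimes>\<^sub>M lborel) (\<lambda>p. f (fst p) * g (snd p))"
    by (rule lborel_pair.Fubini_integrable) (use f g in \<open>simp_all add: abs_mult\<close>)
  then have "integrable (lborel \<Otimes>\<^sub>M lborel) (\<lambda>p. B * (f (fst p) * g (snd p)))"
    by simp
  then show ?thesis
  proof (rule Bochner_Integration.integrable_bound)
    have "\<bar>f (fst p) * g (snd p)\<bar> * \<bar>k p\<bar> \<le> \<bar>f (fst p) * g (snd p)\<bar> * \<bar>B\<bar>" for p
      using k(2)[of p] by (intro mult_left_mono) auto
    then show "AE p in (lborel \<Otimes>\<^sub>M lborel). norm (f (fst p) * g (snd p) * k p)
        \<le> norm (B * (f (fst p) * g (snd p)))"
      by (simp add: abs_mult mult_ac)
  qed measurable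
qed

lemma pairing_fst:
  fixes f g :: "plane \<Rightarrow> real"
  assumes "integrable (lborel \<Otimes>\<^sub>M lborel) (\<lambda>p. f (fst p) * g (snd p) * k p)"
  shows "pairing k f g = (LINT z|lborel. f z * (LINT z'|lborel. g z' * k (z, z')))"
    and "integrable lborel (\<lambda>z. f z * (LINT z'|lborel. g z' * k (z, z')))"
  using lborel_pair.integral_fst'[OF assms] lborel_pair.integrable_fst'[OF assms]
  by (simp_all add: pairing_def mult.assoc)

lemma pairing_swap:
  fixes f g :: "plane \<Rightarrow> real"
  assumes "integrable (lborel \<Otimes>\<^sub>M lborel) (\<lambda>p. f (fst p) * g (snd p) * k p)"
  shows "pairing k f g = pairing (\<lambda>p. k (snd p, fst p)) g f"
  using lborel_pair.integral_product_swap[OF borel_measurable_integrable[OF assms]]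
  by (simp add: pairing_def case_prod_unfold mult_ac)

lemma abs_pairing_le:
  fixes f g :: "plane \<Rightarrow> real"
  assumes "integrable (lborel \<Otimes>\<^sub>M lborel) (\<lambda>p. f (fst p) * g (snd p) * k p)"
    and f: "integrable lborel f" and c: "\<And>z. \<bar>LINT z'|lborel. g z' * k (z, z')\<bar> \<le> c"
  shows "\<bar>pairing k f g\<bar> \<le> c * (LINT z|lborel. \<bar>f z\<bar>)"
proof -
  have "\<bar>pairing k f g\<bar> \<le> (LINT z|lborel. \<bar>f z * (LINT z'|lborel. g z' * k (z, z'))\<bar>)"
    unfolding pairing_fst(1)[OF assms(1)] by (rule integral_abs_bound)
  also have "\<dots> \<le> (LINT z|lborel. c * \<bar>f z\<bar>)"
  proof (rule integral_mono)
    show "integrable lborel (\<lambda>z. \<bar>f z * (LINT z'|lborel. g z' * k (z, z'))\<bar>)"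
      using pairing_fst(2)[OF assms(1)] by (rule integrable_abs)
    show "integrable lborel (\<lambda>z. c * \<bar>f z\<bar>)"
      using f by simp
    show "\<bar>f z * (LINT z'|lborel. g z' * k (z, z'))\<bar> \<le> c * \<bar>f z\<bar>" for z
      using mult_right_mono[OF c[of z], of "\<bar>f z\<bar>"] by (simp add: abs_mult mult.commute)
  qed
  finally show ?thesis
    by simp
qed

text \<open>Densities, fluxes and sources after localisation all belong to this class.\<close>
definition bounded_supp :: "(plane \<Rightarrow> real) \<Rightarrow> bool" where
  "bounded_supp f \<longleftrightarrow> f \<in> borel_measurable borel \<and> (\<exists>B. \<forall>z. \<bar>f z\<bar> \<le> B) \<and> bounded {z. f z \<noteq> 0}"

lemma bounded_suppD:
  assumes "bounded_supp f"
  shows "\<exists>B R. f \<in> borel_measurable borel \<and> 0 \<le> B \<and> (\<forall>z. \<bar>f z\<bar> \<le> B) \<and>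
    (\<forall>z. z \<notin> cball 0 R \<longrightarrow> f z = 0)"
proof -
  from assms obtain B where B: "\<And>z. \<bar>f z\<bar> \<le> B"
    unfolding bounded_supp_def by blast
  from assms obtain R where "{z. f z \<noteq> 0} \<subseteq> cball 0 R"
    using bounded_subset_ballD[of "{z. f z \<noteq> 0}" 0] ball_subset_cball
    unfolding bounded_supp_def by blast
  then have "\<forall>z. z \<notin> cball 0 R \<longrightarrow> f z = 0"
    by blast
  moreover have "0 \<le> B"
    using B[of 0] by linarith
  ultimately show ?thesis
    using B assms unfolding bounded_supp_def by blast
qed

lemma integrable_indicator_cball: "integrable lborel (\<lambda>z::plane. (B::real) * indicator (cball 0 R) z)"
  by (intro integrable_mult_right integrable_real_indicator)
     (use emeasure_bounded_finite[OF bounded_cball, of "0::plane" R] in auto)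

lemma bounded_supp_integrable:
  assumes "bounded_supp f"
  shows "integrable lborel f"
proof -
  from assms obtain B R where f: "f \<in> borel_measurable borel" "0 \<le> B" "\<And>z. \<bar>f z\<bar> \<le> B"
    "\<And>z. z \<notin> cball 0 R \<Longrightarrow> f z = 0"
    using bounded_suppD by blast
  show ?thesis
  proof (rule Bochner_Integration.integrable_bound[OF integrable_indicator_cball[of B R]])
    show "AE z in lborel. norm (f z) \<le> norm (B * indicator (cball 0 R) z)"
      using f(2-4) by (intro AE_I2) (auto simp: indicator_def simp del: mem_cball)
  qed (use f(1) in simp)
qed

lemma bounded_supp_mult:
  assumes "bounded_supp f" "g \<in> borel_measurable borel" "\<And>z. \<bar>g z\<bar> \<le> B"
  shows "bounded_supp (\<lambda>z. f z * g z)"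
proof -
  from assms(1) obtain B' R where f: "f \<in> borel_measurable borel" "0 \<le> B'" "\<And>z. \<bar>f z\<bar> \<le> B'"
    "\<And>z. z \<notin> cball 0 R \<Longrightarrow> f z = 0"
    using bounded_suppD by blast
  have "\<bar>f z * g z\<bar> \<le> B' * B" for z
    unfolding abs_mult using f assms(3) by (intro mult_mono) auto
  moreover have "bounded {z. f z * g z \<noteq> 0}"
    using assms(1) unfolding bounded_supp_def by (auto intro: bounded_subset)
  ultimately show ?thesis
    using f(1) assms(2) unfolding bounded_supp_def by (intro conjI borel_measurable_times) blast+
qed

lemma integrable_bounded_supp_mult:
  assumes "bounded_supp f" "bounded_supp g"
  shows "integrable lborel (\<lambda>z. f z * g z)"
proof -
  obtain B R where "g \<in> borel_measurable borel" "0 \<le> B" "\<And>z. \<bar>g z\<bar> \<le> B"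
    "\<And>z. z \<notin> cball 0 R \<Longrightarrow> g z = 0"
    using bounded_suppD[OF assms(2)] by blast
  then show ?thesis
    by (intro bounded_supp_integrable bounded_supp_mult[OF assms(1)])
qed

lemma bounded_supp_continuous:
  assumes "continuous_on UNIV c" "\<And>z. z \<notin> cball 0 R \<Longrightarrow> c z = 0"
  shows "bounded_supp c"
proof -
  have "compact (c ` cball 0 R)"
    using assms(1) by (intro compact_continuous_image) (auto intro: continuous_on_subset)
  then have "bounded (c ` cball 0 R)"
    by (rule compact_imp_bounded)
  then obtain B where "\<forall>x\<in>c ` cball 0 R. norm x \<le> B"
    unfolding bounded_iff by blast
  then have B: "\<And>z. z \<in> cball 0 R \<Longrightarrow> \<bar>c z\<bar> \<le> B"
    by simp
  have "\<bar>c z\<bar> \<le> max B 0" for z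
    using B[of z] assms(2)[of z] by (cases "z \<in> cball 0 R") auto
  moreover have "{z. c z \<noteq> 0} \<subseteq> cball 0 R"
    using assms(2) by blast
  ultimately show ?thesis
    using borel_measurable_continuous_onI[OF assms(1)] bounded_cball[of "0::plane" R]
    unfolding bounded_supp_def by (blast intro: bounded_subset)
qed

text \<open>A Lebesgue measurable function is almost everywhere a limit of continuous functions. Truncating
these at the bound of \<open>g\<close> and cutting them off outside its support allows dominated convergence.\<close>
lemma L1_approximation_continuous:
  assumes g: "bounded_supp g" and "0 < e"
  shows "\<exists>c. continuous_on UNIV c \<and> (\<exists>R. \<forall>z. z \<notin> cball 0 R \<longrightarrow> c z = 0) \<and>
    (LINT z|lborel. \<bar>g z - c z\<bar>) < e"
proof -
  from g obtain B R where meas: "g \<in> borel_measurable borel" and B: "0 \<le> B" "\<And>z. \<bar>g z\<bar> \<le> B"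
    and R: "\<And>z. z \<notin> cball 0 R \<Longrightarrow> g z = 0"
    using bounded_suppD by blast
  have "g measurable_on UNIV"
    using meas by (intro lebesgue_measurable_imp_measurable_on) (auto intro: measurable_completion)
  then obtain N G where N: "negligible N" and G: "\<And>n. continuous_on UNIV (G n)"
    and lim: "\<And>z. z \<notin> N \<Longrightarrow> (\<lambda>n. G n z) \<longlonglongrightarrow> g z"
    unfolding measurable_on_def by auto
  define cut :: "plane \<Rightarrow> real" where "cut z = max 0 (min 1 (R + 1 - norm z))" for z
  define c where "c n z = cut z * max (- B) (min B (G n z))" for n z
  have cut: "0 \<le> cut z" "cut z \<le> 1" for z
    by (auto simp: cut_def)
  have cont: "continuous_on UNIV (c n)" for n
    unfolding c_def cut_def by (intro continuous_intros G)
  have c0: "c n z = 0" if "z \<notin> cball 0 (R + 1)" for n z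
    using that by (simp add: c_def cut_def)
  have c_bound: "\<bar>c n z\<bar> \<le> B" for n z
  proof -
    have "\<bar>c n z\<bar> \<le> 1 * B"
      unfolding c_def abs_mult using cut[of z] B by (intro mult_mono) auto
    then show ?thesis
      by simp
  qed
  have "(\<lambda>n. LINT z|lborel. \<bar>g z - c n z\<bar>) \<longlonglongrightarrow> (LINT z|lborel. (0::real) * indicator {0::plane} z)"
  proof (rule integral_dominated_convergence)
    show "integrable lborel (\<lambda>z::plane. (2 * B) * indicator (cball 0 (R + 1)) z)"
      by (rule integrable_indicator_cball)
    show "(\<lambda>z. \<bar>g z - c n z\<bar>) \<in> borel_measurable lborel" for n
      using meas borel_measurable_continuous_onI[OF cont] by simp
    have "norm \<bar>g z - c n z\<bar> \<le> 2 * B * indicator (cball 0 (R + 1)) z" for n z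
    proof (cases "z \<in> cball 0 (R + 1)")
      case True
      then show ?thesis
        using B(2)[of z] c_bound[of n z] by simp
    next
      case False
      then show ?thesis
        using R[of z] c0[of z n] by simp
    qed
    then show "AE z in lborel. norm \<bar>g z - c n z\<bar> \<le> 2 * B * indicator (cball 0 (R + 1)) z" for n
      by simp
    have "(\<lambda>n. \<bar>g z - c n z\<bar>) \<longlonglongrightarrow> 0" if "z \<notin> N" for z
    proof -
      have "(\<lambda>n. \<bar>g z - c n z\<bar>) \<longlonglongrightarrow> \<bar>g z - cut z * max (- B) (min B (g z))\<bar>"
        unfolding c_def by (intro tendsto_intros lim that)
      moreover have "cut z * max (- B) (min B (g z)) = g z"
      proof (cases "z \<in> cball 0 R")
        case True
        then have "cut z = 1"
          by (simp add: cut_def)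
        then show ?thesis
          using B(2)[of z] by auto
      next
        case False
        then show ?thesis
          using R B(1) by auto
      qed
      ultimately show ?thesis
        by simp
    qed
    note pointwise = this
    have "AE z in lborel. z \<notin> N"
    proof -
      have "AE z in lebesgue. z \<notin> N"
        using N by (simp add: negligible_iff_null_sets AE_not_in)
      then show ?thesis
        by (simp add: AE_completion_iff)
    qed
    then show "AE z in lborel. (\<lambda>n. \<bar>g z - c n z\<bar>) \<longlonglongrightarrow> 0 * indicator {0::plane} z"
      by (rule eventually_mono) (simp add: pointwise)
  qed simp
  then have "(\<lambda>n. LINT z|lborel. \<bar>g z - c n z\<bar>) \<longlonglongrightarrow> 0"
    by simp
  then have "\<forall>\<^sub>F n in sequentially. (LINT z|lborel. \<bar>g z - c n z\<bar>) < e"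
    using \<open>0 < e\<close> by (rule order_tendstoD)
  then obtain n where "(LINT z|lborel. \<bar>g z - c n z\<bar>) < e"
    by (auto simp: eventually_sequentially)
  with cont c0 show ?thesis
    by blast
qed

lemma compact_support_uniformly_continuous:
  fixes c :: "plane \<Rightarrow> real"
  assumes c: "continuous_on UNIV c" "\<And>z. z \<notin> cball 0 R \<Longrightarrow> c z = 0" and "0 < e"
  shows "\<exists>d>0. \<forall>z z'. dist z z' < d \<longrightarrow> \<bar>c z' - c z\<bar> \<le> e"
proof -
  have "uniformly_continuous_on (cball 0 (R + 1)) c"
    by (intro compact_uniformly_continuous continuous_on_subset[OF c(1)]) auto
  then obtain d where d: "0 < d" "\<And>z z'. z \<in> cball 0 (R + 1) \<Longrightarrow> z' \<in> cball 0 (R + 1) \<Longrightarrow>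
      dist z' z < d \<Longrightarrow> dist (c z') (c z) < e"
    using \<open>0 < e\<close> unfolding uniformly_continuous_on_def by blast
  have "\<bar>c z' - c z\<bar> \<le> e" if z: "dist z z' < min d 1" for z z'
  proof (cases "z \<in> cball 0 (R + 1) \<and> z' \<in> cball 0 (R + 1)")
    case True
    then have "dist (c z') (c z) < e"
      using z by (intro d(2)) (auto simp: dist_commute)
    then show ?thesis
      by (simp add: dist_real_def)
  next
    case False
    then have "z \<notin> cball 0 R" "z' \<notin> cball 0 R"
      using z norm_triangle_sub[of z z'] norm_triangle_sub[of z' z]
      by (auto simp: dist_norm norm_minus_commute)
    then show ?thesis
      using c(2) \<open>0 < e\<close> by simp
  qed
  then show ?thesis
    using d(1) by (intro exI[of _ "min d 1"]) auto
qed

section \<open>Mollifiers and kernels\<close>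

definition mollifier_deriv :: "real \<Rightarrow> real" where
  "mollifier_deriv x =
    (flat 2 x * flat 0 (1 - x) - flat 0 x * flat 2 (1 - x)) / (bump_primitive 1 - bump_primitive 0)"

lemma DERIV_mollifier: "(mollifier has_real_derivative mollifier_deriv x) (at x)"
proof -
  have D1: "(flat 0 has_real_derivative flat 2 x) (at x)" for x
    using DERIV_flat[of 0 x] by (simp add: numeral_2_eq_2)
  have "((\<lambda>x. flat 0 (1 - x)) has_real_derivative flat 2 (1 - x) * (- 1)) (at x)"
    by (rule DERIV_chain2[OF D1]) (auto intro!: derivative_eq_intros)
  from DERIV_mult[OF D1 this] show ?thesis
    unfolding mollifier_def[abs_def] mollifier_deriv_def bump_def
    by (intro DERIV_cdivide) (simp add: algebra_simps)
qed

lemma isCont_mollifier_deriv: "isCont mollifier_deriv x"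
proof -
  have "isCont (\<lambda>x. flat n (1 - x)) x" for n
    by (rule isCont_o2[where g = "flat n"]) (auto intro!: continuous_intros DERIV_isCont[OF DERIV_flat])
  then show ?thesis
    unfolding mollifier_deriv_def[abs_def] using bump_primitive_less
    by (intro continuous_intros DERIV_isCont[OF DERIV_flat]) auto
qed

lemma bounded_if_zero_outside:
  fixes f :: "real \<Rightarrow> real"
  assumes "\<And>x. isCont f x" "\<And>x. x \<le> 0 \<or> 1 \<le> x \<Longrightarrow> f x = 0"
  shows "\<exists>B>0. \<forall>x. \<bar>f x\<bar> \<le> B"
proof -
  have "compact (f ` {0..1})"
    using assms(1) by (intro compact_continuous_image continuous_at_imp_continuous_on) auto
  then have "bounded (f ` {0..1})"
    by (rule compact_imp_bounded)
  then obtain B where B: "\<forall>x\<in>f ` {0..1}. norm x \<le> B"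
    unfolding bounded_iff by blast
  have "\<bar>f x\<bar> \<le> max B 1" for x
    using B assms(2)[of x] by (cases "x \<in> {0..1}") (auto simp: max.coboundedI1)
  then show ?thesis
    by (intro exI[of _ "max B 1"]) auto
qed

lemma integral_mollifier: "(LINT x|lborel. mollifier x) = 1" "integrable lborel mollifier"
proof -
  have *: "(\<lambda>x. mollifier x * indicator {0..1} x) = mollifier"
  proof
    show "mollifier x * indicator {0..1} x = mollifier x" for x
      using mollifier_eq_0[of x] by (cases "x \<in> {0..1}") auto
  qed
  have "has_bochner_integral lborel (\<lambda>x. mollifier x * indicator {0..1} x) (smooth_step 1 - smooth_step 0)"
    by (rule has_bochner_integral_FTC_Icc_real) (use DERIV_smooth_step isCont_mollifier in auto)
  then have "has_bochner_integral lborel mollifier 1"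
    unfolding * by (simp add: smooth_step_eq_0 smooth_step_eq_1)
  then show "(LINT x|lborel. mollifier x) = 1" "integrable lborel mollifier"
    by (auto simp: has_bochner_integral_iff)
qed

definition scaled_mollifier :: "real \<Rightarrow> real \<Rightarrow> real" where
  "scaled_mollifier h x = mollifier (x / h) / h"

definition scaled_mollifier_deriv :: "real \<Rightarrow> real \<Rightarrow> real" where
  "scaled_mollifier_deriv h x = mollifier_deriv (x / h) / h\<^sup>2"

definition scaled_step :: "real \<Rightarrow> real \<Rightarrow> real" where
  "scaled_step h x = smooth_step (x / h)"

lemma DERIV_scaled_mollifier:
  assumes "h \<noteq> 0"
  shows "(scaled_mollifier h has_real_derivative scaled_mollifier_deriv h x) (at x)"
proof -
  have "((\<lambda>x. x / h) has_real_derivative 1 / h) (at x)"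
    using assms by (auto intro!: derivative_eq_intros)
  from DERIV_cdivide[OF DERIV_chain2[OF DERIV_mollifier this], of h] show ?thesis
    by (simp add: scaled_mollifier_def[abs_def] scaled_mollifier_deriv_def power2_eq_square)
qed

lemma DERIV_scaled_step:
  assumes "h \<noteq> 0"
  shows "(scaled_step h has_real_derivative scaled_mollifier h x) (at x)"
proof -
  have "((\<lambda>x. x / h) has_real_derivative 1 / h) (at x)"
    using assms by (auto intro!: derivative_eq_intros)
  from DERIV_chain2[OF DERIV_smooth_step this] show ?thesis
    by (simp add: scaled_step_def[abs_def] scaled_mollifier_def)
qed

lemma scaled_mollifier_nonneg: "0 < h \<Longrightarrow> 0 \<le> scaled_mollifier h x"
  by (simp add: scaled_mollifier_def mollifier_nonneg)

lemma scaled_mollifier_eq_0: "0 < h \<Longrightarrow> x \<le> 0 \<or> h \<le> x \<Longrightarrow> scaled_mollifier h x = 0"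
  by (simp add: scaled_mollifier_def mollifier_eq_0 divide_le_0_iff)

lemma scaled_mollifier_bounded: "0 < h \<Longrightarrow> \<exists>B>0. \<forall>x. \<bar>scaled_mollifier h x\<bar> \<le> B"
proof -
  assume "0 < h"
  obtain B where "0 < B" "\<And>x. \<bar>mollifier x\<bar> \<le> B"
    using bounded_if_zero_outside[OF isCont_mollifier mollifier_eq_0] by blast
  then show ?thesis
    using \<open>0 < h\<close> by (intro exI[of _ "B / h"]) (auto simp: scaled_mollifier_def divide_right_mono)
qed

lemma scaled_mollifier_deriv_bounded: "0 < h \<Longrightarrow> \<exists>B>0. \<forall>x. \<bar>scaled_mollifier_deriv h x\<bar> \<le> B"
proof -
  assume "0 < h"
  have "mollifier_deriv x = 0" if "x \<le> 0 \<or> 1 \<le> x" for x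
    using that by (auto simp: mollifier_deriv_def flat_def)
  then obtain B where "0 < B" "\<And>x. \<bar>mollifier_deriv x\<bar> \<le> B"
    using bounded_if_zero_outside[OF isCont_mollifier_deriv] by blast
  then show ?thesis
    using \<open>0 < h\<close> by (intro exI[of _ "B / h\<^sup>2"]) (auto simp: scaled_mollifier_deriv_def divide_right_mono)
qed

lemma scaled_step_bounds: "0 \<le> scaled_step h x" "scaled_step h x \<le> 1"
  by (simp_all add: scaled_step_def smooth_step_bounds)

lemma borel_measurable_scaled_mollifier [measurable]: "h \<noteq> 0 \<Longrightarrow> scaled_mollifier h \<in> borel_measurable borel"
  by (intro borel_measurable_continuous_onI continuous_at_imp_continuous_on ballI
      DERIV_isCont[OF DERIV_scaled_mollifier])

lemma borel_measurable_scaled_step [measurable]: "h \<noteq> 0 \<Longrightarrow> scaled_step h \<in> borel_measurable borel"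
  by (intro borel_measurable_continuous_onI continuous_at_imp_continuous_on ballI
      DERIV_isCont[OF DERIV_scaled_step])

lemma borel_measurable_scaled_mollifier_deriv [measurable]: "h \<noteq> 0 \<Longrightarrow> scaled_mollifier_deriv h \<in> borel_measurable borel"
proof -
  assume "h \<noteq> 0"
  then have "isCont (scaled_mollifier_deriv h) x" for x
    unfolding scaled_mollifier_deriv_def[abs_def]
    by (intro continuous_intros isCont_o2[OF _ isCont_mollifier_deriv]) auto
  then show ?thesis
    by (intro borel_measurable_continuous_onI continuous_at_imp_continuous_on ballI)
qed

lemma integral_scaled_mollifier:
  assumes "0 < h"
  shows "(LINT x|lborel. scaled_mollifier h (x - c)) = 1" "(LINT x|lborel. scaled_mollifier h (c - x)) = 1"
    "integrable lborel (\<lambda>x. scaled_mollifier h (x - c))" "integrable lborel (\<lambda>x. scaled_mollifier h (c - x))"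
proof -
  have eq: "scaled_mollifier h (x - c) = mollifier (- c / h + (1 / h) * x) / h"
    "scaled_mollifier h (c - x) = mollifier (c / h + (- 1 / h) * x) / h" for x
    by (simp_all add: scaled_mollifier_def diff_divide_distrib)
  show "(LINT x|lborel. scaled_mollifier h (x - c)) = 1"
    using lborel_integral_real_affine[of "1 / h" mollifier "- c / h"] assms
    by (simp add: eq integral_mollifier)
  show "(LINT x|lborel. scaled_mollifier h (c - x)) = 1"
    using lborel_integral_real_affine[of "- 1 / h" mollifier "c / h"] assms
    by (simp add: eq integral_mollifier)
  show "integrable lborel (\<lambda>x. scaled_mollifier h (x - c))"
    unfolding eq using assms
    by (intro integrable_divide lborel_integrable_real_affine integral_mollifier) auto
  show "integrable lborel (\<lambda>x. scaled_mollifier h (c - x))"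
    unfolding eq using assms
    by (intro integrable_divide lborel_integrable_real_affine integral_mollifier) auto
qed

lemma integral_tensor:
  fixes \<alpha> \<beta> :: "real \<Rightarrow> real"
  assumes "integrable lborel \<alpha>" "integrable lborel \<beta>"
  shows "integrable lborel (\<lambda>z. \<alpha> (fst z) * \<beta> (snd z))"
    and "(LINT z|lborel. \<alpha> (fst z) * \<beta> (snd z)) = (LINT t|lborel. \<alpha> t) * (LINT x|lborel. \<beta> x)"
proof -
  note [measurable] = assms[THEN borel_measurable_integrable]
  have "integrable (lborel \<Otimes>\<^sub>M lborel) (\<lambda>z. \<alpha> (fst z) * \<beta> (snd z))"
    by (rule lborel_pair.Fubini_integrable) (use assms in \<open>simp_all add: abs_mult\<close>)
  from this lborel_pair.integral_fst'[OF this]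
  show "integrable lborel (\<lambda>z. \<alpha> (fst z) * \<beta> (snd z))"
    and "(LINT z|lborel. \<alpha> (fst z) * \<beta> (snd z)) = (LINT t|lborel. \<alpha> t) * (LINT x|lborel. \<beta> x)"
    by (simp_all add: lborel_prod)
qed

text \<open>The three kernels compare two points \<open>(t, x)\<close> and \<open>(s, y)\<close> of space-time. \<open>step_kernel\<close> is a
smooth version of the indicator of \<open>t = s, x < y\<close>, the domain of the interaction functional. The
derivative of \<open>step_kernel\<close> in \<open>t\<close> is \<open>step_kernel_dt\<close> and that in \<open>s\<close> is its negative; its
derivative in \<open>y\<close> is \<open>delta_kernel\<close>, which approximates the identity, and that in \<open>x\<close> is its
negative.\<close>
definition delta_kernel :: "real \<Rightarrow> plane \<times> plane \<Rightarrow> real" where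
  "delta_kernel h p = scaled_mollifier h (fst (fst p) - fst (snd p)) * scaled_mollifier h (snd (snd p) - snd (fst p))"

definition step_kernel :: "real \<Rightarrow> plane \<times> plane \<Rightarrow> real" where
  "step_kernel h p = scaled_mollifier h (fst (fst p) - fst (snd p)) * scaled_step h (snd (snd p) - snd (fst p))"

definition step_kernel_dt :: "real \<Rightarrow> plane \<times> plane \<Rightarrow> real" where
  "step_kernel_dt h p = scaled_mollifier_deriv h (fst (fst p) - fst (snd p)) * scaled_step h (snd (snd p) - snd (fst p))"

lemmas kernel_defs = delta_kernel_def step_kernel_def step_kernel_dt_def

lemma borel_measurable_coordinates:
  "(fst :: plane \<Rightarrow> real) \<in> borel_measurable borel"
  "(snd :: plane \<Rightarrow> real) \<in> borel_measurable borel"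
  by (auto intro!: borel_measurable_continuous_onI continuous_intros)

lemma kernel_measurable:
  assumes "0 < h"
  shows "delta_kernel h \<in> borel_measurable (lborel \<Otimes>\<^sub>M lborel)"
    and "step_kernel h \<in> borel_measurable (lborel \<Otimes>\<^sub>M lborel)"
    and "step_kernel_dt h \<in> borel_measurable (lborel \<Otimes>\<^sub>M lborel)"
proof -
  have [measurable]: "scaled_mollifier h \<in> borel_measurable borel" "scaled_mollifier_deriv h \<in> borel_measurable borel"
    "scaled_step h \<in> borel_measurable borel"
    using assms borel_measurable_scaled_mollifier borel_measurable_scaled_mollifier_deriv borel_measurable_scaled_step by auto
  have [measurable]: "(fst :: plane \<Rightarrow> real) \<in> borel_measurable lborel"
    "(snd :: plane \<Rightarrow> real) \<in> borel_measurable lborel"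
    using borel_measurable_coordinates by simp_all
  show "delta_kernel h \<in> borel_measurable (lborel \<Otimes>\<^sub>M lborel)"
    and "step_kernel h \<in> borel_measurable (lborel \<Otimes>\<^sub>M lborel)"
    and "step_kernel_dt h \<in> borel_measurable (lborel \<Otimes>\<^sub>M lborel)"
    unfolding kernel_defs[abs_def] by measurable
qed

lemma kernel_bounded:
  assumes "0 < h"
  shows "\<exists>B. \<forall>p. \<bar>delta_kernel h p\<bar> \<le> B" "\<exists>B. \<forall>p. \<bar>step_kernel h p\<bar> \<le> B"
    "\<exists>B. \<forall>p. \<bar>step_kernel_dt h p\<bar> \<le> B"
proof -
  obtain B where B: "0 < B" "\<And>x. \<bar>scaled_mollifier h x\<bar> \<le> B"
    using scaled_mollifier_bounded[OF assms] by blast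
  obtain B' where B': "0 < B'" "\<And>x. \<bar>scaled_mollifier_deriv h x\<bar> \<le> B'"
    using scaled_mollifier_deriv_bounded[OF assms] by blast
  have scaled_step: "\<bar>scaled_step h x\<bar> \<le> 1" for x
    using scaled_step_bounds[of h x] by simp
  have "\<bar>delta_kernel h p\<bar> \<le> B * B" "\<bar>step_kernel h p\<bar> \<le> B * 1" "\<bar>step_kernel_dt h p\<bar> \<le> B' * 1" for p
    unfolding kernel_defs abs_mult using B B' scaled_step by (intro mult_mono; simp)+
  then show "\<exists>B. \<forall>p. \<bar>delta_kernel h p\<bar> \<le> B" "\<exists>B. \<forall>p. \<bar>step_kernel h p\<bar> \<le> B"
    "\<exists>B. \<forall>p. \<bar>step_kernel_dt h p\<bar> \<le> B"
    by blast+
qed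

lemma integrable_kernel:
  fixes f g :: "plane \<Rightarrow> real"
  assumes "0 < h" "integrable lborel f" "integrable lborel g"
  shows "integrable (lborel \<Otimes>\<^sub>M lborel) (\<lambda>p. f (fst p) * g (snd p) * delta_kernel h p)"
    and "integrable (lborel \<Otimes>\<^sub>M lborel) (\<lambda>p. f (fst p) * g (snd p) * step_kernel h p)"
    and "integrable (lborel \<Otimes>\<^sub>M lborel) (\<lambda>p. f (fst p) * g (snd p) * step_kernel_dt h p)"
  using integrable_pairing[OF assms(2,3)] kernel_measurable[OF assms(1)] kernel_bounded[OF assms(1)]
  by blast+

lemma delta_kernel_fst:
  assumes "0 < h"
  shows "integrable lborel (\<lambda>z. delta_kernel h (z, z'))" "(LINT z|lborel. delta_kernel h (z, z')) = 1"
  using integral_tensor[OF integral_scaled_mollifier(3,4)[OF assms], of "fst z'" "snd z'"] integral_scaled_mollifier[OF assms]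
  by (simp_all add: delta_kernel_def)

lemma delta_kernel_snd:
  assumes "0 < h"
  shows "integrable lborel (\<lambda>z'. delta_kernel h (z, z'))" "(LINT z'|lborel. delta_kernel h (z, z')) = 1"
  using integral_tensor[OF integral_scaled_mollifier(4,3)[OF assms], of "fst z" "snd z"] integral_scaled_mollifier[OF assms]
  by (simp_all add: delta_kernel_def)

lemma delta_kernel_nonneg: "0 < h \<Longrightarrow> 0 \<le> delta_kernel h p"
  by (simp add: delta_kernel_def scaled_mollifier_nonneg)

lemma delta_kernel_eq_0:
  assumes "0 < h" "2 * h < dist z z'"
  shows "delta_kernel h (z, z') = 0"
proof (rule ccontr)
  assume "delta_kernel h (z, z') \<noteq> 0"
  then have "\<bar>fst z - fst z'\<bar> \<le> h" "\<bar>snd z - snd z'\<bar> \<le> h"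
    using scaled_mollifier_eq_0[OF assms(1), of "fst z - fst z'"] scaled_mollifier_eq_0[OF assms(1), of "snd z' - snd z"]
    unfolding delta_kernel_def by force+
  then have "dist z z' \<le> 2 * h"
    using norm_Pair_le[of "fst z - fst z'" "snd z - snd z'"] by (simp add: dist_norm minus_prod_def)
  with assms(2) show False
    by simp
qed

text \<open>If the product is not integrable, its integral is zero by convention; the bound then needs only
that \<open>B\<close> is nonnegative, which holds because \<open>k\<close> is not identically zero.\<close>
lemma average_bound:
  fixes g k :: "plane \<Rightarrow> real"
  assumes k: "integrable lborel k" "(LINT z|lborel. k z) = 1" "\<And>z. 0 \<le> k z"
    and g: "\<And>z. k z \<noteq> 0 \<Longrightarrow> \<bar>g z\<bar> \<le> B"
  shows "\<bar>LINT z|lborel. g z * k z\<bar> \<le> B"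
proof (cases "integrable lborel (\<lambda>z. g z * k z)")
  case True
  have "\<bar>LINT z|lborel. g z * k z\<bar> \<le> (LINT z|lborel. \<bar>g z * k z\<bar>)"
    by (rule integral_abs_bound)
  also have "\<dots> \<le> (LINT z|lborel. B * k z)"
  proof (rule integral_mono)
    show "\<bar>g z * k z\<bar> \<le> B * k z" for z
      using g[of z] k(3)[of z] by (cases "k z = 0") (auto simp: abs_mult mult_right_mono)
  qed (use True k in simp_all)
  finally show ?thesis
    using k by simp
next
  case False
  have "0 \<le> B"
  proof (rule ccontr)
    assume "\<not> 0 \<le> B"
    then have "k z = 0" for z
      using g[of z] by (cases "k z = 0") auto
    then show False
      using k(2) by simp
  qed
  with False show ?thesis
    by (simp add: not_integrable_integral_eq)
qed

lemma pairing_split_right: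
  fixes f g :: "plane \<Rightarrow> real"
  assumes "0 < h" "integrable lborel f" "integrable lborel g" "integrable lborel c"
  shows "pairing (delta_kernel h) f g =
    pairing (delta_kernel h) f c + pairing (delta_kernel h) f (\<lambda>z. g z - c z)"
proof -
  note int = integrable_kernel(1)[OF assms(1,2)]
  have "f (fst p) * g (snd p) * delta_kernel h p =
      f (fst p) * c (snd p) * delta_kernel h p + f (fst p) * (g (snd p) - c (snd p)) * delta_kernel h p" for p
    by (simp add: algebra_simps)
  then show ?thesis
    unfolding pairing_def
    using Bochner_Integration.integral_add[OF int[OF assms(4)]
        int[OF Bochner_Integration.integrable_diff[OF assms(3,4)]]] by simp
qed

text \<open>Replacing \<open>g\<close> by a continuous function that is close in \<open>L^1\<close> costs at most the bound of \<open>f\<close> times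
the distance, once in the pairing and once in the limit. For continuous \<open>g\<close> uniform continuity
suffices, as the kernel averages over points at distance at most \<open>2 * h\<close>.\<close>
lemma pairing_delta_kernel_tendsto:
  assumes f: "bounded_supp f" and g: "bounded_supp g"
  shows "((\<lambda>h. pairing (delta_kernel h) f g) \<longlongrightarrow> (LINT z|lborel. f z * g z)) (at_right 0)"
proof (rule tendstoI)
  fix e :: real assume "0 < e"
  obtain B R where B: "f \<in> borel_measurable borel" "0 \<le> B" "\<And>z. \<bar>f z\<bar> \<le> B"
    "\<And>z. z \<notin> cball 0 R \<Longrightarrow> f z = 0"
    using bounded_suppD[OF f] by blast
  define N where "N = (LINT z|lborel. \<bar>f z\<bar>)"
  have N: "0 \<le> N"
    unfolding N_def by simp
  define e' where "e' = e / (2 * B + N + 1)"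
  have e': "0 < e'" "e' * (2 * B + N) < e"
    using \<open>0 < e\<close> B(2) N by (auto simp: e'_def field_simps)
  obtain c R' where c: "continuous_on UNIV c" "\<And>z. z \<notin> cball 0 R' \<Longrightarrow> c z = 0"
    "(LINT z|lborel. \<bar>g z - c z\<bar>) < e'"
    using L1_approximation_continuous[OF g e'(1)] by blast
  obtain d where d: "0 < d" "\<And>z z'. dist z z' < d \<Longrightarrow> \<bar>c z' - c z\<bar> \<le> e'"
    using compact_support_uniformly_continuous[OF c(1,2) e'(1)] by blast
  have supp_c: "bounded_supp c"
    by (rule bounded_supp_continuous[OF c(1,2)])
  note [simp] = f[THEN bounded_supp_integrable] g[THEN bounded_supp_integrable]
    supp_c[THEN bounded_supp_integrable]
  note prod_int = integrable_bounded_supp_mult[OF f]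
  have "dist (pairing (delta_kernel h) f g) (LINT z|lborel. f z * g z) < e" if h: "0 < h" "2 * h < d" for h
  proof -
    let ?k = "delta_kernel h"
    note int = integrable_kernel(1)[OF h(1)]
    have close: "\<bar>LINT z'|lborel. (c z' - c z) * ?k (z, z')\<bar> \<le> e'" for z
    proof (rule average_bound)
      show "\<bar>c z' - c z\<bar> \<le> e'" if "?k (z, z') \<noteq> 0" for z'
        using that delta_kernel_eq_0[OF h(1), of z z'] h(2) by (intro d(2)) force
    qed (use h(1) in \<open>auto simp: delta_kernel_snd delta_kernel_nonneg\<close>)
    have 1: "\<bar>pairing ?k f c - (LINT z|lborel. f z * c z)\<bar> \<le> e' * N"
    proof -
      have i: "integrable lborel (\<lambda>z. f z * (LINT z'|lborel. c z' * ?k (z, z')))"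
        by (rule pairing_fst(2)[OF int[OF f[THEN bounded_supp_integrable] supp_c[THEN bounded_supp_integrable]]])
      have eq: "(LINT z'|lborel. c z' * ?k (z, z')) - c z = (LINT z'|lborel. (c z' - c z) * ?k (z, z'))" for z
      proof -
        have "integrable lborel (\<lambda>z'. c z' * ?k (z, z'))"
        proof (rule bounded_supp_integrable)
          obtain B' where "\<And>p. \<bar>?k p\<bar> \<le> B'"
            using kernel_bounded(1)[OF h(1)] by blast
          then show "bounded_supp (\<lambda>z'. c z' * ?k (z, z'))"
            using borel_measurable_integrable[OF delta_kernel_snd(1)[OF h(1)], of z]
            by (intro bounded_supp_mult[OF supp_c, where B = B']) simp_all
        qed
        then show ?thesis
          using delta_kernel_snd[OF h(1), of z] by (simp add: left_diff_distrib)
      qed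
      have "pairing ?k f c - (LINT z|lborel. f z * c z) =
          (LINT z|lborel. f z * ((LINT z'|lborel. c z' * ?k (z, z')) - c z))"
        using i prod_int[OF supp_c]
          pairing_fst(1)[OF int[OF f[THEN bounded_supp_integrable] supp_c[THEN bounded_supp_integrable]]]
        by (simp add: right_diff_distrib)
      also have "\<bar>\<dots>\<bar> \<le> (LINT z|lborel. \<bar>f z * (LINT z'|lborel. (c z' - c z) * ?k (z, z'))\<bar>)"
        unfolding eq by (rule integral_abs_bound)
      also have "\<dots> \<le> (LINT z|lborel. e' * \<bar>f z\<bar>)"
      proof (rule integral_mono)
        show "integrable lborel (\<lambda>z. \<bar>f z * (LINT z'|lborel. (c z' - c z) * ?k (z, z'))\<bar>)"
          unfolding eq[symmetric] right_diff_distrib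
          by (intro integrable_abs Bochner_Integration.integrable_diff i prod_int supp_c)
        show "\<bar>f z * (LINT z'|lborel. (c z' - c z) * ?k (z, z'))\<bar> \<le> e' * \<bar>f z\<bar>" for z
          using mult_right_mono[OF close[of z], of "\<bar>f z\<bar>"] by (simp add: abs_mult mult.commute)
      qed simp
      finally show ?thesis
        by (simp add: N_def)
    qed
    have diff: "integrable lborel (\<lambda>z. g z - c z)"
      by simp
    have 2: "\<bar>pairing ?k f (\<lambda>z. g z - c z)\<bar> \<le> B * (LINT z|lborel. \<bar>g z - c z\<bar>)"
    proof -
      have swap: "pairing ?k f (\<lambda>z. g z - c z) = pairing (\<lambda>p. ?k (snd p, fst p)) (\<lambda>z. g z - c z) f"
        by (intro pairing_swap int diff) simp
      have "integrable (lborel \<Otimes>\<^sub>M lborel) (\<lambda>p. (g (fst p) - c (fst p)) * f (snd p) * ?k (snd p, fst p))"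
        using lborel_pair.integrable_product_swap[OF int[OF _ diff, of f]]
        by (simp add: case_prod_unfold mult_ac)
      then show ?thesis
        unfolding swap using B(3) h(1)
        by (intro abs_pairing_le diff average_bound) (auto simp: delta_kernel_fst delta_kernel_nonneg)
    qed
    have 3: "\<bar>(LINT z|lborel. f z * c z) - (LINT z|lborel. f z * g z)\<bar> \<le> B * (LINT z|lborel. \<bar>g z - c z\<bar>)"
    proof -
      have "(LINT z|lborel. f z * c z) - (LINT z|lborel. f z * g z) = (LINT z|lborel. f z * (c z - g z))"
        using prod_int[OF supp_c] prod_int[OF g] by (simp add: right_diff_distrib)
      also have "\<bar>\<dots>\<bar> \<le> (LINT z|lborel. \<bar>f z * (c z - g z)\<bar>)"
        by (rule integral_abs_bound)
      also have "\<dots> \<le> (LINT z|lborel. B * \<bar>g z - c z\<bar>)"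
      proof (rule integral_mono)
        show "integrable lborel (\<lambda>z. \<bar>f z * (c z - g z)\<bar>)"
          using prod_int[OF supp_c] prod_int[OF g] by (simp add: right_diff_distrib)
        show "\<bar>f z * (c z - g z)\<bar> \<le> B * \<bar>g z - c z\<bar>" for z
          unfolding abs_mult by (subst abs_minus_commute) (intro mult_right_mono B(3), simp)
      qed simp
      finally show ?thesis
        by simp
    qed
    have "B * (LINT z|lborel. \<bar>g z - c z\<bar>) \<le> B * e'"
      using B(2) c(3) by (intro mult_left_mono) auto
    then have "\<bar>pairing ?k f g - (LINT z|lborel. f z * g z)\<bar> \<le> e' * (2 * B + N)"
      using 1 2 3 pairing_split_right[OF h(1), of f g c] by (simp add: algebra_simps)
    with e'(2) show ?thesis
      by (simp add: dist_real_def)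
  qed
  then show "\<forall>\<^sub>F h in at_right 0. dist (pairing (delta_kernel h) f g) (LINT z|lborel. f z * g z) < e"
    unfolding eventually_at_right_field using d(1) by (intro exI[of _ "d / 2"]) auto
qed

section \<open>The interaction estimate\<close>

text \<open>The inequality \<open>a_t + b_x \<le> F\<close> in the sense of distributions. It is tested with functions of
arbitrary support, since \<open>a\<close>, \<open>b\<close> and \<open>F\<close> will have compact support.\<close>
definition weak_balance :: "(plane \<Rightarrow> real) \<Rightarrow> (plane \<Rightarrow> real) \<Rightarrow> (plane \<Rightarrow> real) \<Rightarrow> bool" where
  "weak_balance a b F \<longleftrightarrow> (\<forall>\<psi>. smooth \<psi> \<longrightarrow> (\<forall>z. 0 \<le> \<psi> z) \<longrightarrow>
    0 \<le> (LINT z|lborel. a z * dir_deriv (1, 0) \<psi> z + b z * dir_deriv (0, 1) \<psi> z + F z * \<psi> z))"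

lemma smooth_divide: "smooth f \<Longrightarrow> smooth (\<lambda>z. f z / c)"
  using smooth_mult[OF _ smooth_const, of f "1 / c"] by simp

lemma smooth_scaled_mollifier: "smooth f \<Longrightarrow> smooth (\<lambda>z. scaled_mollifier h (f z))"
  unfolding scaled_mollifier_def by (intro smooth_divide smooth_mollifier)

lemma smooth_scaled_step: "smooth f \<Longrightarrow> smooth (\<lambda>z. scaled_step h (f z))"
  unfolding scaled_step_def by (intro smooth_divide smooth_smooth_step)

lemma dir_deriv_tensor:
  assumes "(\<alpha> has_real_derivative a') (at (fst z))" "(\<beta> has_real_derivative b') (at (snd z))"
  shows "dir_deriv v (\<lambda>z. \<alpha> (fst z) * \<beta> (snd z)) z =
    fst v * a' * \<beta> (snd z) + \<alpha> (fst z) * (snd v * b')"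
proof -
  have "((\<lambda>z. \<alpha> (fst z)) has_derivative (\<lambda>v. fst v * a')) (at z)"
    "((\<lambda>z. \<beta> (snd z)) has_derivative (\<lambda>v. snd v * b')) (at z)"
    by (intro DERIV_compose_FDERIV assms has_derivative_fst has_derivative_snd has_derivative_ident)+
  from dir_deriv_eq[OF has_derivative_mult[OF this], of v] show ?thesis
    by simp
qed

lemma DERIV_reflect:
  fixes c x :: real
  assumes "(f has_real_derivative D) (at (c - x))"
  shows "((\<lambda>x. f (c - x)) has_real_derivative - D) (at x)"
proof -
  have "((\<lambda>x. c - x) has_real_derivative - 1) (at x)"
    by (auto intro!: derivative_eq_intros)
  from DERIV_chain2[OF assms this] show ?thesis
    by simp
qed

lemma DERIV_translate:
  fixes c x :: real
  assumes "(f has_real_derivative D) (at (x - c))"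
  shows "((\<lambda>x. f (x - c)) has_real_derivative D) (at x)"
proof -
  have "((\<lambda>x. x - c) has_real_derivative 1) (at x)"
    by (auto intro!: derivative_eq_intros)
  from DERIV_chain2[OF assms this] show ?thesis
    by simp
qed

text \<open>The total mass of \<open>a\<close> at any time is at most the integral of \<open>|F|\<close>, because it vanishes at early
times and grows at most at the rate of the integral of \<open>F\<close>. Time slices are replaced by averages with
the mollifier, and the test function is a smooth step that descends in time.\<close>
lemma weak_balance_time_slice:
  assumes wb: "weak_balance a b F" and supp: "bounded_supp a" "bounded_supp F"
    and a: "\<And>z. 0 \<le> a z" and h: "0 < h"
  shows "(LINT z|lborel. a z * scaled_mollifier h (t - fst z)) \<le> (LINT z|lborel. \<bar>F z\<bar>)"
    and "(LINT z|lborel. a z * scaled_mollifier h (fst z - t)) \<le> (LINT z|lborel. \<bar>F z\<bar>)"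
proof -
  have h': "h \<noteq> 0"
    using h by simp
  have *: "(LINT z|lborel. a z * m (fst z)) \<le> (LINT z|lborel. \<bar>F z\<bar>)"
    if \<psi>: "smooth (\<lambda>z. \<alpha> (fst z))" "\<And>t. 0 \<le> \<alpha> t" "\<And>t. \<alpha> t \<le> 1"
      and D: "\<And>t. (\<alpha> has_real_derivative - m t) (at t)"
      and m: "m \<in> borel_measurable borel" "\<And>t. \<bar>m t\<bar> \<le> B" for \<alpha> m B
  proof -
    have "dir_deriv v (\<lambda>z. \<alpha> (fst z)) z = - (fst v * m (fst z))" for v z
      using dir_deriv_tensor[OF D, of "\<lambda>_. 1" 0 z v] by simp
    then have "0 \<le> (LINT z|lborel. F z * \<alpha> (fst z) - a z * m (fst z))"
      using wb[unfolded weak_balance_def, rule_format, OF \<psi>(1) \<psi>(2)] by (simp add: algebra_simps)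
    moreover have i1: "integrable lborel (\<lambda>z. a z * m (fst z))"
      using measurable_compose[OF borel_measurable_coordinates(1) m(1)] m(2)
      by (intro bounded_supp_integrable bounded_supp_mult[OF supp(1), where B = B]) simp_all
    moreover have i2: "integrable lborel (\<lambda>z. F z * \<alpha> (fst z))"
    proof (intro bounded_supp_integrable bounded_supp_mult[OF supp(2)])
      show "(\<lambda>z::plane. \<alpha> (fst z)) \<in> borel_measurable borel"
        by (intro borel_measurable_continuous_onI smooth_continuous_on \<psi>(1))
      show "\<bar>\<alpha> (fst z)\<bar> \<le> 1" for z :: plane
        using \<psi>(2,3) by simp
    qed
    moreover have "(LINT z|lborel. F z * \<alpha> (fst z)) \<le> (LINT z|lborel. \<bar>F z\<bar>)"
    proof (rule integral_mono[OF i2])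
      show "F z * \<alpha> (fst z) \<le> \<bar>F z\<bar>" for z
        using mult_mono[of "F z" "\<bar>F z\<bar>" "\<alpha> (fst z)" 1] \<psi>(2,3) by simp
    qed (use bounded_supp_integrable[OF supp(2)] in simp)
    ultimately show ?thesis
      by simp
  qed
  obtain B where B: "\<And>x. \<bar>scaled_mollifier h x\<bar> \<le> B"
    using scaled_mollifier_bounded[OF h] by blast
  have [measurable]: "scaled_mollifier h \<in> borel_measurable borel"
    by (rule borel_measurable_scaled_mollifier[OF h'])
  show "(LINT z|lborel. a z * scaled_mollifier h (t - fst z)) \<le> (LINT z|lborel. \<bar>F z\<bar>)"
  proof (rule *)
    show "smooth (\<lambda>z. scaled_step h (t - fst z))"
      by (intro smooth_scaled_step smooth_diff smooth_const smooth_fst)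
    show "((\<lambda>s. scaled_step h (t - s)) has_real_derivative - scaled_mollifier h (t - s)) (at s)" for s
      by (rule DERIV_reflect[OF DERIV_scaled_step[OF h']])
  qed (use scaled_step_bounds B in simp_all)
  show "(LINT z|lborel. a z * scaled_mollifier h (fst z - t)) \<le> (LINT z|lborel. \<bar>F z\<bar>)"
  proof (rule *)
    show "smooth (\<lambda>z. 1 - scaled_step h (fst z - t))"
      by (intro smooth_scaled_step smooth_diff smooth_const smooth_fst)
    show "((\<lambda>s. 1 - scaled_step h (s - t)) has_real_derivative - scaled_mollifier h (s - t)) (at s)" for s
      using DERIV_diff[OF DERIV_const[of 1] DERIV_translate[OF DERIV_scaled_step[OF h']]] by simp
  qed (use scaled_step_bounds B in simp_all)
qed

text \<open>Smooth form of differentiating the integral of \<open>a(t, x) a'(t, y)\<close> over \<open>x < y\<close> in time.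
For each fixed second point test the first inequality with \<open>step_kernel\<close> and integrate the result
against \<open>a'\<close>; for each fixed first point test the second inequality and integrate against \<open>a\<close>. In
the sum the time derivatives of the kernel cancel and its space derivatives leave the pairing of
\<open>b a' - a b'\<close> with \<open>delta_kernel\<close>. The sources contribute a product of a source with a time slice of
the other density. Every test function is a section of the
kernel, so the bounded measurable densities are never differentiated.\<close>
theorem interaction_estimate:
  assumes wb: "weak_balance a b F" "weak_balance a' b' F'"
    and supp: "bounded_supp a" "bounded_supp b" "bounded_supp F"
      "bounded_supp a'" "bounded_supp b'" "bounded_supp F'"
    and nonneg: "\<And>z. 0 \<le> a z" "\<And>z. 0 \<le> a' z"
  shows "(LINT z|lborel. b z * a' z - a z * b' z) \<le> 2 * (LINT z|lborel. \<bar>F z\<bar>) * (LINT z|lborel. \<bar>F' z\<bar>)"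
proof -
  define X where "X = 2 * (LINT z|lborel. \<bar>F z\<bar>) * (LINT z|lborel. \<bar>F' z\<bar>)"
  note ints = supp[THEN bounded_supp_integrable]
  have bound: "pairing (delta_kernel h) b a' - pairing (delta_kernel h) a b' \<le> X" if h: "0 < h" for h
  proof -
    have h': "h \<noteq> 0"
      using h by simp
    note I = integrable_kernel[OF h]
    have S: "smooth (\<lambda>z. scaled_mollifier h (fst z - s) * scaled_step h (y - snd z))"
      and S': "smooth (\<lambda>z. scaled_mollifier h (s - fst z) * scaled_step h (snd z - y))" for s y
      by (intro smooth_mult smooth_scaled_step smooth_scaled_mollifier smooth_diff smooth_const smooth_fst smooth_snd)+
    have pos: "0 \<le> scaled_mollifier h s * scaled_step h y" for s y
      using scaled_mollifier_nonneg[OF h] scaled_step_bounds by simp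
    have first: "0 \<le> (LINT z|lborel. a z * step_kernel_dt h (z, z') - b z * delta_kernel h (z, z')
        + F z * step_kernel h (z, z'))" for z'
    proof -
      have D: "dir_deriv v (\<lambda>z. scaled_mollifier h (fst z - fst z') * scaled_step h (snd z' - snd z)) z =
          fst v * scaled_mollifier_deriv h (fst z - fst z') * scaled_step h (snd z' - snd z)
          + scaled_mollifier h (fst z - fst z') * (snd v * - scaled_mollifier h (snd z' - snd z))" for v z
        by (intro dir_deriv_tensor DERIV_translate DERIV_reflect DERIV_scaled_mollifier DERIV_scaled_step h')
      show ?thesis
        using wb(1)[unfolded weak_balance_def, rule_format, OF S[of "fst z'" "snd z'"] pos]
        unfolding D by (simp add: kernel_defs)
    qed
    have second: "0 \<le> (LINT z'|lborel. - (a' z' * step_kernel_dt h (z, z')) + b' z' * delta_kernel h (z, z')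
        + F' z' * step_kernel h (z, z'))" for z
    proof -
      have D: "dir_deriv v (\<lambda>z'. scaled_mollifier h (fst z - fst z') * scaled_step h (snd z' - snd z)) z' =
          fst v * - scaled_mollifier_deriv h (fst z - fst z') * scaled_step h (snd z' - snd z)
          + scaled_mollifier h (fst z - fst z') * (snd v * scaled_mollifier h (snd z' - snd z))" for v z'
        by (intro dir_deriv_tensor DERIV_translate DERIV_reflect DERIV_scaled_mollifier DERIV_scaled_step h')
      show ?thesis
        using wb(2)[unfolded weak_balance_def, rule_format, OF S'[of "fst z" "snd z"] pos]
        unfolding D by (simp add: kernel_defs)
    qed
    have sum1: "0 \<le> pairing (step_kernel_dt h) a a' - pairing (delta_kernel h) b a' + pairing (step_kernel h) F a'"
    proof -
      let ?f = "\<lambda>p. a (fst p) * a' (snd p) * step_kernel_dt h p - b (fst p) * a' (snd p) * delta_kernel h p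
        + F (fst p) * a' (snd p) * step_kernel h p"
      have int: "integrable (lborel \<Otimes>\<^sub>M lborel) ?f"
        by (intro Bochner_Integration.integrable_add Bochner_Integration.integrable_diff I ints)
      have "0 \<le> (LINT z'|lborel. (LINT z|lborel. ?f (z, z')))"
      proof (rule Bochner_Integration.integral_nonneg)
        fix z'
        have "(LINT z|lborel. ?f (z, z')) = (LINT z|lborel. a' z' * (a z * step_kernel_dt h (z, z')
            - b z * delta_kernel h (z, z') + F z * step_kernel h (z, z')))"
          by (simp add: algebra_simps)
        then show "0 \<le> (LINT z|lborel. ?f (z, z'))"
          using first[of z'] nonneg(2)[of z'] by simp
      qed
      also have "\<dots> = (LINT p|(lborel \<Otimes>\<^sub>M lborel). ?f p)"
        using lborel_pair.integral_snd[of "\<lambda>z z'. ?f (z, z')"] int by (simp add: case_prod_unfold)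
      finally show ?thesis
        using I ints by (simp add: pairing_def)
    qed
    have sum2: "0 \<le> - pairing (step_kernel_dt h) a a' + pairing (delta_kernel h) a b' + pairing (step_kernel h) a F'"
    proof -
      let ?f = "\<lambda>p. - (a (fst p) * a' (snd p) * step_kernel_dt h p) + a (fst p) * b' (snd p) * delta_kernel h p
        + a (fst p) * F' (snd p) * step_kernel h p"
      have int: "integrable (lborel \<Otimes>\<^sub>M lborel) ?f"
        by (intro Bochner_Integration.integrable_add Bochner_Integration.integrable_minus I ints)
      have "0 \<le> (LINT z|lborel. (LINT z'|lborel. ?f (z, z')))"
      proof (rule Bochner_Integration.integral_nonneg)
        fix z
        have "(LINT z'|lborel. ?f (z, z')) = (LINT z'|lborel. a z * (- (a' z' * step_kernel_dt h (z, z'))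
            + b' z' * delta_kernel h (z, z') + F' z' * step_kernel h (z, z')))"
          by (simp add: algebra_simps)
        then show "0 \<le> (LINT z'|lborel. ?f (z, z'))"
          using second[of z] nonneg(1)[of z] by simp
      qed
      also have "\<dots> = (LINT p|(lborel \<Otimes>\<^sub>M lborel). ?f p)"
        using lborel_pair.integral_fst'[OF int] by simp
      finally show ?thesis
        using I ints by (simp add: pairing_def)
    qed
    have slice: "\<bar>LINT z|lborel. c z * (m (fst z) * scaled_step h (u z))\<bar> \<le> (LINT z|lborel. c z * m (fst z))"
      if c: "bounded_supp c" "\<And>z. 0 \<le> c z" and m: "m \<in> borel_measurable borel" "\<And>t. 0 \<le> m t" "\<And>t. m t \<le> B"
        and u: "u \<in> borel_measurable borel" for c m u B
    proof -
      have [measurable]: "scaled_step h \<in> borel_measurable borel"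
        by (rule borel_measurable_scaled_step[OF h'])
      have "\<bar>m t * scaled_step h x\<bar> \<le> B * 1" for t x
        unfolding abs_mult using m scaled_step_bounds[of h x] order_trans[OF m(2) m(3)]
        by (intro mult_mono) auto
      then have i: "integrable lborel (\<lambda>z. c z * (m (fst z) * scaled_step h (u z)))"
        using measurable_compose[OF borel_measurable_coordinates(1) m(1)] u
        by (intro bounded_supp_integrable bounded_supp_mult[OF c(1), where B = "B * 1"]
            borel_measurable_times) simp_all
      have "0 \<le> c z * (m (fst z) * scaled_step h (u z))" for z
        using c m scaled_step_bounds by simp
      then have "\<bar>LINT z|lborel. c z * (m (fst z) * scaled_step h (u z))\<bar> = (LINT z|lborel. c z * (m (fst z) * scaled_step h (u z)))"
        by (intro abs_of_nonneg Bochner_Integration.integral_nonneg)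
      also have "\<dots> \<le> (LINT z|lborel. c z * m (fst z))"
      proof (rule integral_mono[OF i])
        show "integrable lborel (\<lambda>z. c z * m (fst z))"
          using measurable_compose[OF borel_measurable_coordinates(1) m(1)] m(2,3)
          by (intro bounded_supp_integrable bounded_supp_mult[OF c(1), where B = B]) simp_all
        show "c z * (m (fst z) * scaled_step h (u z)) \<le> c z * m (fst z)" for z
          using c m scaled_step_bounds[of h "u z"] by (intro mult_left_mono) (auto simp: mult_left_le)
      qed
      finally show ?thesis .
    qed
    obtain B where B: "\<And>x. \<bar>scaled_mollifier h x\<bar> \<le> B"
      using scaled_mollifier_bounded[OF h] by blast
    then have B': "scaled_mollifier h x \<le> B" for x
      using abs_le_D1 by blast
    have [measurable]: "scaled_mollifier h \<in> borel_measurable borel"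
      by (rule borel_measurable_scaled_mollifier[OF h'])
    have err1: "\<bar>pairing (step_kernel h) F a'\<bar> \<le> (LINT z|lborel. \<bar>F' z\<bar>) * (LINT z|lborel. \<bar>F z\<bar>)"
    proof (rule abs_pairing_le)
      fix z
      have "\<bar>LINT z'|lborel. a' z' * step_kernel h (z, z')\<bar> \<le> (LINT z'|lborel. a' z' * scaled_mollifier h (fst z - fst z'))"
        unfolding step_kernel_def fst_conv snd_conv
        using B' scaled_mollifier_nonneg[OF h] borel_measurable_coordinates by (intro slice supp nonneg) auto
      also have "\<dots> \<le> (LINT z|lborel. \<bar>F' z\<bar>)"
        by (rule weak_balance_time_slice(1)[OF wb(2) supp(4,6) nonneg(2) h])
      finally show "\<bar>LINT z'|lborel. a' z' * step_kernel h (z, z')\<bar> \<le> (LINT z|lborel. \<bar>F' z\<bar>)" .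
    qed (intro I ints)+
    have err2: "\<bar>pairing (step_kernel h) a F'\<bar> \<le> (LINT z|lborel. \<bar>F z\<bar>) * (LINT z|lborel. \<bar>F' z\<bar>)"
      unfolding pairing_swap[OF I(2)[OF ints(1,6)]]
    proof (rule abs_pairing_le)
      show "integrable (lborel \<Otimes>\<^sub>M lborel) (\<lambda>p. F' (fst p) * a (snd p) * step_kernel h (snd p, fst p))"
        using lborel_pair.integrable_product_swap[OF I(2)[OF ints(1,6)]]
        by (simp add: case_prod_unfold mult_ac)
      fix z
      have "\<bar>LINT z'|lborel. a z' * step_kernel h (z', z)\<bar> \<le> (LINT z'|lborel. a z' * scaled_mollifier h (fst z' - fst z))"
        unfolding step_kernel_def fst_conv snd_conv
        using B' scaled_mollifier_nonneg[OF h] borel_measurable_coordinates by (intro slice[where m = "\<lambda>t. scaled_mollifier h (t - fst z)"] supp nonneg) auto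
      also have "\<dots> \<le> (LINT z|lborel. \<bar>F z\<bar>)"
        by (rule weak_balance_time_slice(2)[OF wb(1) supp(1,3) nonneg(1) h])
      finally show "\<bar>LINT z'|lborel. a z' * step_kernel h (snd (z, z'), fst (z, z'))\<bar> \<le> (LINT z|lborel. \<bar>F z\<bar>)"
        by simp
    qed (rule ints)
    have "\<bar>pairing (step_kernel h) F a'\<bar> \<le> X / 2" "\<bar>pairing (step_kernel h) a F'\<bar> \<le> X / 2"
      using err1 err2 by (simp_all add: X_def mult.commute)
    with sum1 sum2 show ?thesis
      by linarith
  qed
  have "((\<lambda>h. pairing (delta_kernel h) b a' - pairing (delta_kernel h) a b') \<longlongrightarrow>
      (LINT z|lborel. b z * a' z) - (LINT z|lborel. a z * b' z)) (at_right 0)"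
    by (intro tendsto_diff pairing_delta_kernel_tendsto supp)
  then have "(LINT z|lborel. b z * a' z) - (LINT z|lborel. a z * b' z) \<le> X"
    by (rule tendsto_upperbound)
       (use bound in \<open>auto simp: eventually_at_right_field intro!: exI[of _ 1]\<close>)
  moreover note integrable_bounded_supp_mult
  ultimately show ?thesis
    unfolding X_def using supp by simp
qed

section \<open>Localisation and the De Giorgi step\<close>

text \<open>Any bound serves; it enters the final constants through the gradient of the cutoffs.\<close>
definition mollifier_bound :: real where
  "mollifier_bound = (SOME B. 0 < B \<and> (\<forall>x. \<bar>mollifier x\<bar> \<le> B))"

lemma mollifier_bound: "0 < mollifier_bound" "\<bar>mollifier x\<bar> \<le> mollifier_bound"
proof -
  have "\<exists>B. 0 < B \<and> (\<forall>x. \<bar>mollifier x\<bar> \<le> B)"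
    using bounded_if_zero_outside[OF isCont_mollifier mollifier_eq_0] by blast
  from someI_ex[OF this] show "0 < mollifier_bound" "\<bar>mollifier x\<bar> \<le> mollifier_bound"
    unfolding mollifier_bound_def by blast+
qed

definition cutoff :: "real \<Rightarrow> real \<Rightarrow> plane \<Rightarrow> real" where
  "cutoff r' r z = smooth_step ((r\<^sup>2 - ((fst z)\<^sup>2 + (snd z)\<^sup>2)) / (r\<^sup>2 - r'\<^sup>2))"

lemma norm_plane: "(fst z)\<^sup>2 + (snd z)\<^sup>2 = (norm z)\<^sup>2" for z :: plane
  by (simp add: norm_prod_def)

lemma smooth_cutoff: "smooth (cutoff r' r)"
  unfolding cutoff_def[abs_def] power2_eq_square
  by (intro smooth_smooth_step smooth_divide smooth_diff smooth_add smooth_mult smooth_const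
      smooth_fst smooth_snd)

lemma cutoff_bounds: "0 \<le> cutoff r' r z" "cutoff r' r z \<le> 1"
  by (simp_all add: cutoff_def smooth_step_bounds)

lemma cutoff_eq_1:
  assumes "0 < r'" "r' < r" "norm z \<le> r'"
  shows "cutoff r' r z = 1"
proof -
  have "(norm z)\<^sup>2 \<le> r'\<^sup>2" "r'\<^sup>2 < r\<^sup>2"
    using assms by (auto intro: power_mono power_strict_mono)
  then show ?thesis
    unfolding cutoff_def norm_plane by (intro smooth_step_eq_1) (simp add: divide_simps)
qed

lemma cutoff_outside:
  assumes "0 < r'" "r' < r" "r \<le> norm z"
  shows "cutoff r' r z = 0"
proof -
  have "r\<^sup>2 \<le> (norm z)\<^sup>2" "r'\<^sup>2 < r\<^sup>2"
    using assms by (auto intro: power_mono power_strict_mono)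
  then show ?thesis
    unfolding cutoff_def norm_plane by (intro smooth_step_eq_0) (simp add: divide_simps)
qed

lemma dir_deriv_cutoff:
  "dir_deriv v (cutoff r' r) z = - (2 * (fst z * fst v + snd z * snd v) / (r\<^sup>2 - r'\<^sup>2)) *
    mollifier ((r\<^sup>2 - ((fst z)\<^sup>2 + (snd z)\<^sup>2)) / (r\<^sup>2 - r'\<^sup>2))"
proof -
  have "((\<lambda>z. (r\<^sup>2 - ((fst z)\<^sup>2 + (snd z)\<^sup>2)) / (r\<^sup>2 - r'\<^sup>2)) has_derivative
      (\<lambda>v. - (2 * (fst z * fst v + snd z * snd v) / (r\<^sup>2 - r'\<^sup>2)))) (at z)"
  proof -
    have "((\<lambda>z. r\<^sup>2 - ((fst z)\<^sup>2 + (snd z)\<^sup>2)) has_derivative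
        (\<lambda>v. - (2 * (fst z * fst v + snd z * snd v)))) (at z)"
      by (auto intro!: derivative_eq_intros ext simp: algebra_simps)
    from has_derivative_mult_left[OF this, of "1 / (r\<^sup>2 - r'\<^sup>2)"] show ?thesis
      by (simp only: times_divide_eq_right mult_1_right minus_divide_left)
  qed
  from dir_deriv_eq[OF DERIV_compose_FDERIV[OF DERIV_smooth_step this], of v] show ?thesis
    by (simp add: cutoff_def[abs_def])
qed

lemma dir_deriv_cutoff_outside:
  assumes "0 < r'" "r' < r" "r \<le> norm z"
  shows "dir_deriv v (cutoff r' r) z = 0"
proof -
  have "r\<^sup>2 \<le> (norm z)\<^sup>2" "r'\<^sup>2 < r\<^sup>2"
    using assms by (auto intro: power_mono power_strict_mono)
  then show ?thesis
    unfolding dir_deriv_cutoff norm_plane by (subst mollifier_eq_0) (simp_all add: divide_simps)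
qed

text \<open>The factor \<open>1 / (r - r')\<close> arises from \<open>2 * norm z / (r\<^sup>2 - r'\<^sup>2)\<close> with
\<open>norm z \<le> r + r'\<close>.\<close>
lemma dir_deriv_cutoff_bound:
  assumes r: "0 < r'" "r' < r" and v: "v = (1, 0) \<or> v = (0, 1)"
  shows "\<bar>dir_deriv v (cutoff r' r) z\<bar> \<le> 2 * mollifier_bound / (r - r')"
proof (cases "norm z < r")
  case True
  define x where "x = fst z * fst v + snd z * snd v"
  have "\<bar>x\<bar> \<le> norm z"
    using v norm_fst_le[of "fst z" "snd z"] norm_snd_le[of "snd z" "fst z"] by (auto simp: x_def)
  also have "\<dots> \<le> r + r'"
    using True r by linarith
  finally have "2 * \<bar>x\<bar> / ((r - r') * (r + r')) \<le> 2 * (r + r') / ((r - r') * (r + r'))"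
    using r by (intro divide_right_mono) auto
  moreover have "r\<^sup>2 - r'\<^sup>2 = (r - r') * (r + r')"
    by (simp add: power2_eq_square algebra_simps)
  moreover have "\<bar>2 * x / ((r - r') * (r + r'))\<bar> = 2 * \<bar>x\<bar> / ((r - r') * (r + r'))"
    using r by (simp add: abs_mult)
  moreover have "2 * (r + r') / ((r - r') * (r + r')) = 2 / (r - r')"
    by (rule mult_divide_mult_cancel_right) (use r in simp)
  ultimately have "\<bar>2 * x / (r\<^sup>2 - r'\<^sup>2)\<bar> \<le> 2 / (r - r')"
    by simp
  then have "\<bar>dir_deriv v (cutoff r' r) z\<bar> \<le> 2 / (r - r') * mollifier_bound"
    unfolding dir_deriv_cutoff abs_mult abs_minus_cancel x_def
    using r mollifier_bound by (intro mult_mono) auto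
  then show ?thesis
    by simp
next
  case False
  then show ?thesis
    using dir_deriv_cutoff_outside[OF r, of z v] r mollifier_bound(1) by simp
qed

definition weak_nonpos_on :: "plane set \<Rightarrow> (plane \<Rightarrow> real) \<Rightarrow> (plane \<Rightarrow> real) \<Rightarrow> bool" where
  "weak_nonpos_on U g h \<longleftrightarrow> (\<forall>\<phi>. test_function U \<phi> \<and> (\<forall>z. 0 \<le> \<phi> z) \<longrightarrow> weak_div U g h \<phi> \<le> 0)"

text \<open>A smooth function times the cutoff is an admissible test function; the product rule moves the
derivative of the cutoff into the source.\<close>
lemma weak_balance_localised:
  assumes weak: "weak_nonpos_on (ball 0 R) E Q" and r: "0 < r'" "r' < r" "r < R"
    and meas: "E \<in> borel_measurable borel" "Q \<in> borel_measurable borel"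
  shows "weak_balance (\<lambda>z. E z * cutoff r' r z) (\<lambda>z. Q z * cutoff r' r z)
    (\<lambda>z. E z * dir_deriv (1, 0) (cutoff r' r) z + Q z * dir_deriv (0, 1) (cutoff r' r) z)"
  unfolding weak_balance_def
proof (intro allI impI)
  fix \<psi> assume \<psi>: "smooth \<psi>" "\<forall>z. 0 \<le> \<psi> z"
  let ?c = "cutoff r' r"
  let ?\<phi> = "\<lambda>z. ?c z * \<psi> z"
  have smooth: "smooth ?\<phi>"
    by (intro smooth_mult smooth_cutoff \<psi>)
  have "{z. ?\<phi> z \<noteq> 0} \<subseteq> cball 0 r"
    using cutoff_outside[OF r(1,2)] by (force simp: not_le)
  then have cl: "closure {z. ?\<phi> z \<noteq> 0} \<subseteq> cball 0 r"
    by (intro closure_minimal) auto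
  then have "compact (closure {z. ?\<phi> z \<noteq> 0})"
    by (meson bounded_cball bounded_subset closed_closure compact_eq_bounded_closed)
  moreover have "closure {z. ?\<phi> z \<noteq> 0} \<subseteq> ball 0 R"
    using cl r(3) by force
  ultimately have "test_function (ball 0 R) ?\<phi>"
    using smooth_C_diff[OF smooth] by (simp add: test_function_def)
  moreover have "\<forall>z. 0 \<le> ?\<phi> z"
    using \<psi>(2) cutoff_bounds by simp
  ultimately have *: "0 \<le> (LINT z:ball 0 R|lebesgue. E z * dir_deriv (1, 0) ?\<phi> z + Q z * dir_deriv (0, 1) ?\<phi> z)"
    using weak unfolding weak_nonpos_on_def weak_div_def by fastforce
  have D: "dir_deriv v ?\<phi> z = ?c z * dir_deriv v \<psi> z + dir_deriv v ?c z * \<psi> z" for v z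
    by (rule dir_deriv_eq[OF has_derivative_mult]) (intro smooth_has_derivative smooth_cutoff \<psi>)+
  have "(LINT z:ball 0 R|lebesgue. E z * dir_deriv (1, 0) ?\<phi> z + Q z * dir_deriv (0, 1) ?\<phi> z) =
      (LINT z|lborel. E z * dir_deriv (1, 0) ?\<phi> z + Q z * dir_deriv (0, 1) ?\<phi> z)"
  proof (rule set_lebesgue_integral_eq_lborel)
    show "(\<lambda>z. E z * dir_deriv (1, 0) ?\<phi> z + Q z * dir_deriv (0, 1) ?\<phi> z) \<in> borel_measurable lborel"
      using meas smooth_measurable[OF smooth_dir_deriv[OF smooth]] by simp
    show "E z * dir_deriv (1, 0) ?\<phi> z + Q z * dir_deriv (0, 1) ?\<phi> z = 0" if "z \<notin> ball 0 R" for z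
      using that r unfolding D by (simp add: cutoff_outside dir_deriv_cutoff_outside)
  qed
  also have "\<dots> = (LINT z|lborel. E z * ?c z * dir_deriv (1, 0) \<psi> z + Q z * ?c z * dir_deriv (0, 1) \<psi> z
      + (E z * dir_deriv (1, 0) ?c z + Q z * dir_deriv (0, 1) ?c z) * \<psi> z)"
    unfolding D by (simp add: algebra_simps)
  finally show "0 \<le> (LINT z|lborel. E z * ?c z * dir_deriv (1, 0) \<psi> z + Q z * ?c z * dir_deriv (0, 1) \<psi> z
      + (E z * dir_deriv (1, 0) ?c z + Q z * dir_deriv (0, 1) ?c z) * \<psi> z)"
    using * by simp
qed

lemma localised_bounds:
  assumes r: "0 < r'" "r' < r"
    and meas: "E \<in> borel_measurable borel" "Q \<in> borel_measurable borel"
    and C: "\<And>z. \<bar>E z\<bar> \<le> C" "\<And>z. \<bar>Q z\<bar> \<le> C"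
    and S: "S \<in> sets borel" "\<And>z. z \<notin> S \<Longrightarrow> E z = 0 \<and> Q z = 0"
  defines "F \<equiv> (\<lambda>z. E z * dir_deriv (1, 0) (cutoff r' r) z + Q z * dir_deriv (0, 1) (cutoff r' r) z)"
  shows "bounded_supp (\<lambda>z. E z * cutoff r' r z)" "bounded_supp (\<lambda>z. Q z * cutoff r' r z)" "bounded_supp F"
    and "(LINT z|lborel. \<bar>F z\<bar>) \<le> 4 * mollifier_bound * C / (r - r') * measure lborel (S \<inter> cball 0 r)"
proof -
  have C0: "0 \<le> C"
    using order_trans[OF abs_ge_zero C(1)] .
  have supp: "bounded {z. f z \<noteq> 0}" if "\<And>z. r \<le> norm z \<Longrightarrow> f z = 0" for f :: "plane \<Rightarrow> real"
  proof -
    have "{z. f z \<noteq> 0} \<subseteq> cball 0 r"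
      using that by (force simp: not_le)
    then show ?thesis
      using bounded_cball bounded_subset by blast
  qed
  have "\<bar>f z * cutoff r' r z\<bar> \<le> C * 1" if "\<And>z. \<bar>f z\<bar> \<le> C" for f z
    unfolding abs_mult using that C0 cutoff_bounds[of r' r z] by (intro mult_mono) auto
  then have *: "bounded_supp (\<lambda>z. f z * cutoff r' r z)"
    if "f \<in> borel_measurable borel" "\<And>z. \<bar>f z\<bar> \<le> C" for f
    unfolding bounded_supp_def using that supp[of "\<lambda>z. f z * cutoff r' r z"] cutoff_outside[OF r]
      smooth_measurable[OF smooth_cutoff] by (intro conjI borel_measurable_times exI[of _ "C * 1"]) auto
  show "bounded_supp (\<lambda>z. E z * cutoff r' r z)" "bounded_supp (\<lambda>z. Q z * cutoff r' r z)"
    by (intro * meas C)+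
  let ?B = "4 * mollifier_bound * C / (r - r')"
  have B0: "0 \<le> ?B"
    using C0 r mollifier_bound(1) by simp
  have F_le: "\<bar>F z\<bar> \<le> ?B * indicator (S \<inter> cball 0 r) z" for z
  proof (cases "z \<in> S \<inter> cball 0 r")
    case True
    have "\<bar>F z\<bar> \<le> C * (2 * mollifier_bound / (r - r')) + C * (2 * mollifier_bound / (r - r'))"
      unfolding F_def
      by (intro order_trans[OF abs_triangle_ineq] add_mono; unfold abs_mult;
          intro mult_mono C C0 dir_deriv_cutoff_bound[OF r]) simp_all
    then show ?thesis
      using True by (simp add: mult_ac)
  next
    case False
    then have "F z = 0"
      using S(2)[of z] dir_deriv_cutoff_outside[OF r, of z] by (auto simp: F_def)
    then show ?thesis
      using B0 by (simp add: indicator_def)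
  qed
  then have "\<bar>F z\<bar> \<le> ?B" for z
    using B0 order_trans[OF F_le[of z], of ?B] by (simp add: indicator_def split: if_splits)
  moreover have "F \<in> borel_measurable borel"
    unfolding F_def using meas smooth_measurable[OF smooth_dir_deriv[OF smooth_cutoff]] by simp
  moreover have "F z = 0" if "r \<le> norm z" for z
    using dir_deriv_cutoff_outside[OF r that] by (simp add: F_def)
  ultimately show F: "bounded_supp F"
    unfolding bounded_supp_def using supp by blast
  have fin: "emeasure lborel (S \<inter> cball 0 r) < \<infinity>"
    by (intro emeasure_bounded_finite bounded_Int) simp
  have "(LINT z|lborel. \<bar>F z\<bar>) \<le> (LINT z|lborel. ?B * indicator (S \<inter> cball 0 r) z)"
  proof (rule integral_mono)
    show "integrable lborel (\<lambda>z. \<bar>F z\<bar>)"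
      using bounded_supp_integrable[OF F] by simp
    show "integrable lborel (\<lambda>z. ?B * indicator (S \<inter> cball 0 r) z)"
      using fin S(1) by (intro integrable_mult_right integrable_real_indicator) auto
  qed (rule F_le)
  also have "\<dots> = ?B * measure lborel (S \<inter> cball 0 r)"
    by simp
  finally show "(LINT z|lborel. \<bar>F z\<bar>) \<le> ?B * measure lborel (S \<inter> cball 0 r)" .
qed

text \<open>The interaction estimate for the localised entropies: both sources are bounded by a multiple of
\<open>C / (r - r')\<close> and supported in \<open>S\<close>, which gives the square of the measure of \<open>S\<close> on the
right, while \<open>Q E' - E Q'\<close> is bounded below on \<open>T\<close>.\<close>
proposition de_giorgi_step:
  assumes weak: "weak_nonpos_on (ball 0 R) E Q" "weak_nonpos_on (ball 0 R) E' Q'"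
    and r: "0 < r'" "r' < r" "r < R"
    and meas: "E \<in> borel_measurable borel" "Q \<in> borel_measurable borel"
      "E' \<in> borel_measurable borel" "Q' \<in> borel_measurable borel"
    and nonneg: "\<And>z. 0 \<le> E z" "\<And>z. 0 \<le> E' z"
    and C: "\<And>z. E z \<le> C" "\<And>z. \<bar>Q z\<bar> \<le> C" "\<And>z. E' z \<le> C" "\<And>z. \<bar>Q' z\<bar> \<le> C"
    and S: "S \<in> sets borel" "\<And>z. z \<notin> S \<Longrightarrow> E z = 0 \<and> Q z = 0" "\<And>z. z \<notin> S \<Longrightarrow> E' z = 0 \<and> Q' z = 0"
    and T: "T \<in> sets borel" "\<And>z. z \<in> T \<Longrightarrow> c \<le> Q z * E' z - E z * Q' z"
    and D: "\<And>z. 0 \<le> Q z * E' z - E z * Q' z"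
  shows "c * measure lborel (T \<inter> cball 0 r') \<le>
    32 * (mollifier_bound * C)\<^sup>2 / (r - r')\<^sup>2 * (measure lborel (S \<inter> cball 0 r))\<^sup>2"
proof -
  let ?\<phi> = "cutoff r' r"
  define a where "a z = E z * ?\<phi> z" for z
  define b where "b z = Q z * ?\<phi> z" for z
  define a' where "a' z = E' z * ?\<phi> z" for z
  define b' where "b' z = Q' z * ?\<phi> z" for z
  define F where "F z = E z * dir_deriv (1, 0) ?\<phi> z + Q z * dir_deriv (0, 1) ?\<phi> z" for z
  define F' where "F' z = E' z * dir_deriv (1, 0) ?\<phi> z + Q' z * dir_deriv (0, 1) ?\<phi> z" for z
  have absE: "\<bar>E z\<bar> \<le> C" "\<bar>E' z\<bar> \<le> C" for z
    using nonneg[of z] C(1,3)[of z] by simp_all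
  note L = localised_bounds[OF r(1,2) meas(1,2) absE(1) C(2) S(1,2),
      folded a_def[abs_def] b_def[abs_def] F_def[abs_def] F_def]
  note L' = localised_bounds[OF r(1,2) meas(3,4) absE(2) C(4) S(1,3),
      folded a'_def[abs_def] b'_def[abs_def] F'_def[abs_def] F'_def]
  let ?B = "4 * mollifier_bound * C / (r - r')" and ?m = "measure lborel (S \<inter> cball 0 r)"
  have pos: "0 \<le> a z" "0 \<le> a' z" for z
    using nonneg[of z] cutoff_bounds[of r' r z] by (simp_all add: a_def a'_def)
  have "(LINT z|lborel. b z * a' z - a z * b' z) \<le> 2 * (LINT z|lborel. \<bar>F z\<bar>) * (LINT z|lborel. \<bar>F' z\<bar>)"
    using weak_balance_localised[OF weak(1) r meas(1,2)] weak_balance_localised[OF weak(2) r meas(3,4)]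
    unfolding a_def[symmetric] b_def[symmetric] a'_def[symmetric] b'_def[symmetric]
      F_def[symmetric] F'_def[symmetric]
    by (intro interaction_estimate L L' pos)
  also have "\<dots> \<le> 2 * (?B * ?m) * (?B * ?m)"
    using L(4) L'(4) order_trans[OF integral_nonneg_AE L(4)] by (intro mult_mono) auto
  also have "\<dots> = 32 * (mollifier_bound * C)\<^sup>2 / (r - r')\<^sup>2 * ?m\<^sup>2"
    by (simp add: power2_eq_square)
  finally have upper: "(LINT z|lborel. b z * a' z - a z * b' z) \<le> 32 * (mollifier_bound * C)\<^sup>2 / (r - r')\<^sup>2 * ?m\<^sup>2" .
  have eq: "b z * a' z - a z * b' z = (Q z * E' z - E z * Q' z) * (?\<phi> z)\<^sup>2" for z
    by (simp add: a_def b_def a'_def b'_def power2_eq_square algebra_simps)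
  have fin: "emeasure lborel (T \<inter> cball 0 r') < \<infinity>"
    by (intro emeasure_bounded_finite bounded_Int) simp
  have "c * measure lborel (T \<inter> cball 0 r') = (LINT z|lborel. c * indicator (T \<inter> cball 0 r') z)"
    by simp
  also have "\<dots> \<le> (LINT z|lborel. b z * a' z - a z * b' z)"
  proof (rule integral_mono)
    show "integrable lborel (\<lambda>z. c * indicator (T \<inter> cball 0 r') z)"
      using fin T(1) by (intro integrable_mult_right integrable_real_indicator) auto
    show "integrable lborel (\<lambda>z. b z * a' z - a z * b' z)"
      by (intro Bochner_Integration.integrable_diff integrable_bounded_supp_mult L L')
    show "c * indicator (T \<inter> cball 0 r') z \<le> b z * a' z - a z * b' z" for z
    proof (cases "z \<in> T \<inter> cball 0 r'")
      case True
      then show ?thesis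
        using T(2)[of z] cutoff_eq_1[OF r(1,2), of z] by (simp add: eq)
    next
      case False
      then show ?thesis
        using D[of z] by (simp add: eq)
    qed
  qed
  finally show ?thesis
    using upper by linarith
qed

text \<open>Levels increase from \<open>\<delta>\<close> to \<open>2 * \<delta>\<close> and radii decrease from \<open>3 / 2\<close> to \<open>1\<close>, both
geometrically with ratio \<open>1 / 2\<close>. One step multiplies the square of the measure by
\<open>12 * K * (\<delta> * h / 4) ^ (- 5) * (h / 4) ^ (- 2)\<close> with \<open>h = 2 ^ (- j)\<close>, that is by
\<open>12 * 4 ^ 7 * K * \<delta> ^ (- 5) * h ^ (- 7)\<close>. A bound \<open>\<beta> * h ^ 7\<close> therefore reproduces itself with
\<open>h / 2\<close> in place of \<open>h\<close> for \<open>\<beta> = \<delta> ^ 5 / (12 * 4 ^ 7 * 2 ^ 7 * K)\<close>.\<close>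
lemma level_set_iteration:
  fixes \<mu> :: "real \<Rightarrow> real \<Rightarrow> real"
  assumes nonneg: "\<And>l r. 0 \<le> \<mu> l r" and mono: "\<And>l l' r r'. l' \<le> l \<Longrightarrow> r \<le> r' \<Longrightarrow> \<mu> l r \<le> \<mu> l' r'"
    and step: "\<And>l d r r'. 0 \<le> l \<Longrightarrow> 0 < d \<Longrightarrow> d \<le> M \<Longrightarrow> 1 \<le> r' \<Longrightarrow> r' < r \<Longrightarrow> r < 2 \<Longrightarrow>
      d ^ 5 / 12 * \<mu> (l + 2 * d) r' \<le> K / (r - r')\<^sup>2 * (\<mu> l r)\<^sup>2"
    and K: "0 < K" and \<delta>: "0 < \<delta>" "\<delta> \<le> M" and start: "\<mu> \<delta> (3 / 2) \<le> \<delta> ^ 5 / (12 * 2 ^ 21 * K)"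
  shows "\<mu> (2 * \<delta>) 1 = 0"
proof -
  define h :: "nat \<Rightarrow> real" where "h j = (1 / 2) ^ j" for j
  define U where "U j = \<mu> (\<delta> * (2 - h j)) (1 + h j / 2)" for j
  define \<beta> where "\<beta> = \<delta> ^ 5 / (12 * 2 ^ 21 * K)"
  have h: "0 < h j" "h j \<le> 1" "h (Suc j) = h j / 2" for j
    by (simp_all add: h_def power_le_one)
  have \<beta>: "0 < \<beta>"
    using \<delta> K by (simp add: \<beta>_def)
  have decay: "U j \<le> \<beta> * h j ^ 7" for j
  proof (induction j)
    case 0
    then show ?case
      using start by (simp add: U_def h_def \<beta>_def)
  next
    case (Suc j)
    let ?h = "h j"
    have "\<delta> * ?h / 4 \<le> M"
      using mult_left_mono[OF h(2)[of j], of \<delta>] \<delta> by linarith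
    then have "(\<delta> * ?h / 4) ^ 5 / 12 * \<mu> (\<delta> * (2 - ?h) + 2 * (\<delta> * ?h / 4)) (1 + ?h / 4) \<le>
        K / ((1 + ?h / 2) - (1 + ?h / 4))\<^sup>2 * (U j)\<^sup>2"
      unfolding U_def using h[of j] \<delta> by (intro step) (auto simp: field_simps)
    moreover have "\<mu> (\<delta> * (2 - ?h) + 2 * (\<delta> * ?h / 4)) (1 + ?h / 4) = U (Suc j)"
      by (simp add: U_def h(3) algebra_simps)
    moreover have "(1 + ?h / 2) - (1 + ?h / 4) = ?h / 4"
      by simp
    ultimately have "(\<delta> * ?h / 4) ^ 5 / 12 * U (Suc j) \<le> K / (?h / 4)\<^sup>2 * (U j)\<^sup>2"
      by simp
    also have "\<dots> \<le> K / (?h / 4)\<^sup>2 * (\<beta> * ?h ^ 7)\<^sup>2"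
      using Suc.IH nonneg K h by (intro mult_left_mono power_mono) (auto simp: U_def)
    finally have "\<delta> ^ 5 * (?h ^ 5 * U (Suc j)) \<le> 12 * 4 ^ 7 * K * \<beta>\<^sup>2 * ?h ^ 12"
      using h(1)[of j] by (simp add: field_simps power_divide power_mult_distrib power2_eq_square eval_nat_numeral)
    also have "\<dots> = \<delta> ^ 5 * (?h ^ 5 * (\<beta> * (?h / 2) ^ 7))"
      using K \<delta> by (simp add: \<beta>_def field_simps power2_eq_square eval_nat_numeral)
    finally show ?case
      using \<delta>(1) h(1)[of j] by (simp add: h(3))
  qed
  have "(\<lambda>j. \<beta> * h j ^ 7) \<longlonglongrightarrow> \<beta> * 0 ^ 7"
    unfolding h_def by (intro tendsto_intros LIMSEQ_power_zero) simp
  moreover have "\<mu> (2 * \<delta>) 1 \<le> \<beta> * h j ^ 7" for j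
    using mono[of "\<delta> * (2 - h j)" "2 * \<delta>" 1 "1 + h j / 2"] decay[of j] h[of j] \<delta>
    by (auto simp: U_def algebra_simps)
  ultimately have "\<mu> (2 * \<delta>) 1 \<le> 0"
    by (intro LIMSEQ_le_const) auto
  with nonneg[of "2 * \<delta>" 1] show ?thesis
    by simp
qed

section \<open>Entropies of the excess over a level\<close>

lemma convex_on_pos_part: "convex_on UNIV (\<lambda>v. pos_part (a * v + b))"
proof (rule convex_onI)
  fix t x y :: real assume t: "0 < t" "t < 1"
  have "(1 - t) * (a * x + b) \<le> (1 - t) * pos_part (a * x + b)" "t * (a * y + b) \<le> t * pos_part (a * y + b)"
    "0 \<le> (1 - t) * pos_part (a * x + b)" "0 \<le> t * pos_part (a * y + b)"
    using t by (auto intro!: mult_left_mono mult_nonneg_nonneg simp: pos_part_def)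
  then show "pos_part (a * ((1 - t) *\<^sub>R x + t *\<^sub>R y) + b) \<le>
      (1 - t) * pos_part (a * x + b) + t * pos_part (a * y + b)"
    unfolding pos_part_def[of "a * ((1 - t) *\<^sub>R x + t *\<^sub>R y) + b"]
    by (intro max.boundedI) (simp_all add: algebra_simps)
qed simp

lemma DERIV_pos_part_power:
  "((\<lambda>x. pos_part x ^ (n + 2)) has_real_derivative real (n + 2) * pos_part x ^ (n + 1)) (at x)"
proof (cases x "0::real" rule: linorder_cases)
  case less
  have "((\<lambda>_. 0) has_real_derivative 0) (at x)"
    by simp
  then have "((\<lambda>x. pos_part x ^ (n + 2)) has_real_derivative 0) (at x)"
    by (rule has_field_derivative_transform_within_open[where S = "{..<0}"])
       (use less in \<open>auto simp: pos_part_def\<close>)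
  then show ?thesis
    using less by (simp add: pos_part_def)
next
  case equal
  have "((\<lambda>h. pos_part h ^ (n + 2) / h) \<longlongrightarrow> 0) (at 0)"
  proof (rule Lim_null_comparison)
    show "((\<lambda>h. \<bar>h\<bar> ^ (n + 1)) \<longlongrightarrow> 0) (at (0::real))"
      by (auto intro!: tendsto_eq_intros)
    have "norm (pos_part h ^ (n + 2) / h) \<le> \<bar>h\<bar> ^ (n + 1)" for h :: real
    proof (cases "h \<le> 0")
      case True
      then have "pos_part h ^ (n + 2) / h = 0"
        by (simp add: pos_part_def)
      then show ?thesis
        by (simp only: norm_zero) (intro zero_le_power abs_ge_zero)
    qed (simp add: pos_part_def)
    then show "\<forall>\<^sub>F h in at 0. norm (pos_part h ^ (n + 2) / h) \<le> \<bar>h\<bar> ^ (n + 1)"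
      by simp
  qed
  then show ?thesis
    using equal by (simp add: DERIV_def pos_part_def)
next
  case greater
  have "((\<lambda>x. x ^ (n + 2)) has_real_derivative real (n + 2) * x ^ (n + 1)) (at x)"
    by (rule derivative_eq_intros refl | simp)+
  then have "((\<lambda>x. pos_part x ^ (n + 2)) has_real_derivative real (n + 2) * x ^ (n + 1)) (at x)"
    by (rule has_field_derivative_transform_within_open[where S = "{0<..}"])
       (use greater in \<open>auto simp: pos_part_def\<close>)
  then show ?thesis
    using greater by (simp add: pos_part_def)
qed

lemma DERIV_pos_part_square: "((\<lambda>x. (pos_part x)\<^sup>2) has_real_derivative 2 * pos_part x) (at x)"
  using DERIV_pos_part_power[of 0 x] by (simp add: numeral_2_eq_2)

lemma DERIV_pos_part_cube: "((\<lambda>x. pos_part x ^ 3) has_real_derivative 3 * (pos_part x)\<^sup>2) (at x)"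
  using DERIV_pos_part_power[of 1 x] by (simp add: numeral_2_eq_2 numeral_3_eq_3)

text \<open>Here \<open>w1\<close> and \<open>w2\<close> are the excesses of the two Riemann invariants over the reference value,
\<open>w1\<close> being the larger one. The two functions are the integrals over \<open>{w2..w1}\<close> of
\<open>pos_part (w - l)\<close> and of its square. In a frame moving with the speed of the level, the second one
is up to sign the flux of the first.\<close>
definition excess_entropy :: "real \<Rightarrow> real \<Rightarrow> real \<Rightarrow> real" where
  "excess_entropy w1 w2 l = ((pos_part (w1 - l))\<^sup>2 - (pos_part (w2 - l))\<^sup>2) / 2"

definition excess_cube :: "real \<Rightarrow> real \<Rightarrow> real \<Rightarrow> real" where
  "excess_cube w1 w2 l = (pos_part (w1 - l) ^ 3 - pos_part (w2 - l) ^ 3) / 3"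

text \<open>The entropy pairs generated by \<open>pos_part (k - l - v)\<close> and, in \<open>upper_pair\<close>, by
\<open>pos_part (v - (k + l))\<close>. The first measures how far \<open>lambda1\<close> falls below \<open>k - l\<close>, the second how far
\<open>lambda2\<close> rises above \<open>k + l\<close>; the two differ by a reflection of space.\<close>
definition lower_pair :: "real \<Rightarrow> real \<Rightarrow> (plane \<Rightarrow> real) \<times> (plane \<Rightarrow> real)" where
  "lower_pair k l =
    ((\<lambda>s. excess_entropy (k - lambda1 s) (k - lambda2 s) l),
     (\<lambda>s. (k - l) * excess_entropy (k - lambda1 s) (k - lambda2 s) l
        - excess_cube (k - lambda1 s) (k - lambda2 s) l))"

definition upper_pair :: "real \<Rightarrow> real \<Rightarrow> (plane \<Rightarrow> real) \<times> (plane \<Rightarrow> real)" where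
  "upper_pair k l =
    ((\<lambda>s. excess_entropy (lambda2 s - k) (lambda1 s - k) l),
     (\<lambda>s. (k + l) * excess_entropy (lambda2 s - k) (lambda1 s - k) l
        + excess_cube (lambda2 s - k) (lambda1 s - k) l))"

lemma entropy_pair_lower: "entropy_pair (fst (lower_pair k l)) (snd (lower_pair k l))"
proof -
  define c where "c = k - l"
  define G where "G v = - (pos_part (c - v))\<^sup>2 / 2" for v
  define P where "P v = - (c * (pos_part (c - v))\<^sup>2 / 2 - pos_part (c - v) ^ 3 / 3)" for v
  have "entropy_pair (kinetic_density G) (kinetic_density P)"
  proof (rule entropy_pair_kinetic)
    show "convex_on UNIV (\<lambda>v. pos_part (c - v))"
      using convex_on_pos_part[of "- 1" c] by simp
    note D2 = DERIV_reflect[OF DERIV_pos_part_square, of c] and D3 = DERIV_reflect[OF DERIV_pos_part_cube, of c]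
    show "(G has_real_derivative pos_part (c - v)) (at v)" for v
      using DERIV_cdivide[OF DERIV_minus[OF D2[of v]], where c = 2] by (simp add: G_def[abs_def])
    show "(P has_real_derivative v * pos_part (c - v)) (at v)" for v
    proof -
      have "(P has_real_derivative - (c * - (2 * pos_part (c - v)) / 2 - - (3 * (pos_part (c - v))\<^sup>2) / 3)) (at v)"
        unfolding P_def[abs_def] by (intro DERIV_minus DERIV_diff DERIV_cdivide DERIV_cmult D2 D3)
      moreover have "- (c * - (2 * pos_part (c - v)) / 2 - - (3 * (pos_part (c - v))\<^sup>2) / 3) = v * pos_part (c - v)"
        by (cases "c \<le> v") (simp_all add: pos_part_def power2_eq_square field_simps)
      ultimately show ?thesis
        by simp
    qed
  qed
  moreover have "kinetic_density G = fst (lower_pair k l)" "kinetic_density P = snd (lower_pair k l)"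
    by (auto simp: kinetic_density_def lower_pair_def excess_entropy_def excess_cube_def G_def P_def c_def
        field_simps intro!: ext)
  ultimately show ?thesis
    by simp
qed

lemma entropy_pair_upper: "entropy_pair (fst (upper_pair k l)) (snd (upper_pair k l))"
proof -
  define c where "c = k + l"
  define G where "G v = (pos_part (v - c))\<^sup>2 / 2" for v
  define P where "P v = c * (pos_part (v - c))\<^sup>2 / 2 + pos_part (v - c) ^ 3 / 3" for v
  have "entropy_pair (kinetic_density G) (kinetic_density P)"
  proof (rule entropy_pair_kinetic)
    show "convex_on UNIV (\<lambda>v. pos_part (v - c))"
      using convex_on_pos_part[of 1 "- c"] by simp
    note D2 = DERIV_translate[OF DERIV_pos_part_square, of c] and D3 = DERIV_translate[OF DERIV_pos_part_cube, of c]
    show "(G has_real_derivative pos_part (v - c)) (at v)" for v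
      using DERIV_cdivide[OF D2[of v], where c = 2] by (simp add: G_def[abs_def])
    show "(P has_real_derivative v * pos_part (v - c)) (at v)" for v
    proof -
      have "(P has_real_derivative c * (2 * pos_part (v - c)) / 2 + (3 * (pos_part (v - c))\<^sup>2) / 3) (at v)"
        unfolding P_def[abs_def] by (intro DERIV_add DERIV_cdivide DERIV_cmult D2 D3)
      moreover have "c * (2 * pos_part (v - c)) / 2 + (3 * (pos_part (v - c))\<^sup>2) / 3 = v * pos_part (v - c)"
        by (cases "v \<le> c") (simp_all add: pos_part_def power2_eq_square field_simps)
      ultimately show ?thesis
        by simp
    qed
  qed
  moreover have "kinetic_density G = fst (upper_pair k l)" "kinetic_density P = snd (upper_pair k l)"
    by (auto simp: kinetic_density_def upper_pair_def excess_entropy_def excess_cube_def G_def P_def c_def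
        field_simps intro!: ext)
  ultimately show ?thesis
    by simp
qed

text \<open>The value of \<open>Q E' - E Q'\<close> for the levels \<open>l\<close> and \<open>l + d\<close>, up to the sign that depends on
the family. The multiple of the entropy in each flux cancels except for the difference \<open>d\<close> of the
levels.\<close>
definition interaction :: "real \<Rightarrow> real \<Rightarrow> real \<Rightarrow> real \<Rightarrow> real" where
  "interaction w1 w2 l d = d * excess_entropy w1 w2 l * excess_entropy w1 w2 (l + d)
    - excess_cube w1 w2 l * excess_entropy w1 w2 (l + d)
    + excess_entropy w1 w2 l * excess_cube w1 w2 (l + d)"

text \<open>The integrals defining the entropies run over the whole interval, over the part above the
level, or over nothing. If both levels lie below the interval, the value is exactly
\<open>d * (w1 - w2) ^ 4 / 12\<close>. If the interval reaches across the level \<open>l + d\<close>, the polynomial factors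
and the remaining factor is estimated with \<open>pos_part (w2 - l) \<le> d\<close>.\<close>
lemma interaction_cases:
  assumes "w2 \<le> w1" "0 \<le> d"
  shows "w1 \<le> l + d \<Longrightarrow> interaction w1 w2 l d = 0"
    and "l + d \<le> w2 \<Longrightarrow> interaction w1 w2 l d = d * (w1 - w2) ^ 4 / 12"
    and "w2 \<le> l + d \<Longrightarrow> l + d \<le> w1 \<Longrightarrow>
      d * (w1 - (l + d))\<^sup>2 * (w1 - l - pos_part (w2 - l))\<^sup>2 / 12 \<le> interaction w1 w2 l d"
proof -
  show "interaction w1 w2 l d = 0" if "w1 \<le> l + d"
    using that assms by (simp add: interaction_def excess_entropy_def excess_cube_def pos_part_def)
  show "interaction w1 w2 l d = d * (w1 - w2) ^ 4 / 12" if "l + d \<le> w2"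
  proof -
    define x where "x = w1 - (l + d)"
    define y where "y = w2 - (l + d)"
    have "0 \<le> x" "0 \<le> y"
      using that assms by (auto simp: x_def y_def)
    moreover have w: "w1 = x + (l + d)" "w2 = y + (l + d)"
      by (auto simp: x_def y_def)
    ultimately have p: "pos_part (w1 - l) = x + d" "pos_part (w2 - l) = y + d"
      "pos_part (w1 - (l + d)) = x" "pos_part (w2 - (l + d)) = y"
      using assms(2) by (auto simp: pos_part_def)
    have "12 * interaction w1 w2 l d = d * (x - y) ^ 4"
      unfolding interaction_def excess_entropy_def excess_cube_def p
      by (simp add: field_simps) (simp add: eval_nat_numeral algebra_simps)
    then show ?thesis
      by (simp add: w)
  qed
  show "d * (w1 - (l + d))\<^sup>2 * (w1 - l - pos_part (w2 - l))\<^sup>2 / 12 \<le> interaction w1 w2 l d"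
    if "w2 \<le> l + d" "l + d \<le> w1"
  proof -
    define s where "s = w1 - (l + d)"
    define q where "q = pos_part (w2 - l)"
    have s: "0 \<le> s" and q: "0 \<le> q" "q \<le> d"
      using that assms by (auto simp: s_def q_def pos_part_def)
    have p: "pos_part (w1 - l) = s + d" "pos_part (w1 - (l + d)) = s" "pos_part (w2 - (l + d)) = 0"
      using that assms(2) by (auto simp: pos_part_def s_def)
    have "12 * interaction w1 w2 l d = s\<^sup>2 * (s + d - q) * (d * (s + d + q) - 2 * q\<^sup>2)"
      unfolding interaction_def excess_entropy_def excess_cube_def p q_def[symmetric]
      by (simp add: field_simps) (simp add: eval_nat_numeral algebra_simps)
    moreover have "s\<^sup>2 * (s + d - q) * (d * (s + d - q)) \<le> s\<^sup>2 * (s + d - q) * (d * (s + d + q) - 2 * q\<^sup>2)"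
    proof (rule mult_left_mono)
      show "d * (s + d - q) \<le> d * (s + d + q) - 2 * q\<^sup>2"
        using mult_right_mono[OF q(2,1)] by (simp add: power2_eq_square algebra_simps)
      show "0 \<le> s\<^sup>2 * (s + d - q)"
        using s q by (intro mult_nonneg_nonneg) auto
    qed
    ultimately have "d * s\<^sup>2 * (s + d - q)\<^sup>2 \<le> 12 * interaction w1 w2 l d"
      by (simp add: power2_eq_square mult_ac)
    moreover have "w1 - l - pos_part (w2 - l) = s + d - q"
      by (simp add: s_def q_def)
    ultimately show ?thesis
      by (simp add: s_def)
  qed
qed

lemma interaction_nonneg:
  assumes "w2 \<le> w1" "0 \<le> d"
  shows "0 \<le> interaction w1 w2 l d"
proof -
  consider "w1 \<le> l + d" | "l + d \<le> w2" | "w2 \<le> l + d" "l + d \<le> w1"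
    by linarith
  then show ?thesis
  proof cases
    case 2
    have "0 \<le> d * (w1 - w2) ^ 4"
      using assms by simp
    with interaction_cases(2)[OF assms 2] show ?thesis
      by linarith
  next
    case 3
    have "0 \<le> d * (w1 - (l + d))\<^sup>2 * (w1 - l - pos_part (w2 - l))\<^sup>2 / 12"
      using assms by simp
    with interaction_cases(3)[OF assms 3] show ?thesis
      by linarith
  qed (use interaction_cases(1)[OF assms, of l] in simp)
qed

text \<open>The gap \<open>d\<close> between \<open>w2\<close> and \<open>w1\<close> keeps the value away from zero; it is supplied by the lower
bound on the density.\<close>
lemma interaction_lower_bound:
  assumes "w2 + d \<le> w1" "0 \<le> d" "l + 2 * d < w1"
  shows "d ^ 5 / 12 \<le> interaction w1 w2 l d"
proof (cases "l + d \<le> w2")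
  case True
  have "d * d ^ 4 \<le> d * (w1 - w2) ^ 4"
    using assms by (intro mult_left_mono power_mono) auto
  then show ?thesis
    using interaction_cases(2)[OF _ assms(2) True] assms by (simp add: eval_nat_numeral)
next
  case False
  have "d * d\<^sup>2 * d\<^sup>2 \<le> d * (w1 - (l + d))\<^sup>2 * (w1 - l - pos_part (w2 - l))\<^sup>2"
    using assms by (intro mult_mono power_mono) (auto simp: pos_part_def)
  moreover have "d * d\<^sup>2 * d\<^sup>2 = d ^ 5"
    by (simp add: eval_nat_numeral)
  ultimately show ?thesis
    using interaction_cases(3)[of w2 w1 d l] assms False by (simp add: field_simps)
qed

lemma excess_bounds:
  assumes "w2 \<le> w1" "w1 - l \<le> B"
  shows "0 \<le> excess_entropy w1 w2 l" "excess_entropy w1 w2 l \<le> B\<^sup>2 / 2"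
    "0 \<le> excess_cube w1 w2 l" "excess_cube w1 w2 l \<le> \<bar>B\<bar> ^ 3 / 3"
    "w1 \<le> l \<Longrightarrow> excess_entropy w1 w2 l = 0" "w1 \<le> l \<Longrightarrow> excess_cube w1 w2 l = 0"
proof -
  let ?x = "pos_part (w1 - l)" and ?y = "pos_part (w2 - l)"
  have xy: "0 \<le> ?y" "?y \<le> ?x" "?x \<le> \<bar>B\<bar>"
    using assms by (auto simp: pos_part_def)
  then have pw: "?y\<^sup>2 \<le> ?x\<^sup>2" "?y ^ 3 \<le> ?x ^ 3" "?x\<^sup>2 \<le> \<bar>B\<bar>\<^sup>2" "?x ^ 3 \<le> \<bar>B\<bar> ^ 3"
    using power_mono[OF xy(2,1)] power_mono[OF xy(3) order_trans[OF xy(1,2)]] by blast+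
  have y0: "0 \<le> ?y\<^sup>2" "0 \<le> ?y ^ 3"
    using xy(1) by simp_all
  have diff: "0 \<le> (x - y) / c \<and> (x - y) / c \<le> X / c"
    if "y \<le> x" "x \<le> X" "0 \<le> y" "0 < c" for x y X c :: real
    using that by (simp add: divide_right_mono)
  have "0 \<le> excess_entropy w1 w2 l \<and> excess_entropy w1 w2 l \<le> \<bar>B\<bar>\<^sup>2 / 2"
    "0 \<le> excess_cube w1 w2 l \<and> excess_cube w1 w2 l \<le> \<bar>B\<bar> ^ 3 / 3"
    unfolding excess_entropy_def excess_cube_def
    by (intro diff[OF pw(1,3) y0(1)] diff[OF pw(2,4) y0(2)]; simp)+
  then show "0 \<le> excess_entropy w1 w2 l" "excess_entropy w1 w2 l \<le> B\<^sup>2 / 2"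
    "0 \<le> excess_cube w1 w2 l" "excess_cube w1 w2 l \<le> \<bar>B\<bar> ^ 3 / 3"
    by simp_all
  show "w1 \<le> l \<Longrightarrow> excess_entropy w1 w2 l = 0" "w1 \<le> l \<Longrightarrow> excess_cube w1 w2 l = 0"
    using assms by (simp_all add: excess_entropy_def excess_cube_def pos_part_def)
qed

text \<open>Both families at once: \<open>\<sigma> = 1\<close> for \<open>lower_pair\<close> and \<open>\<sigma> = - 1\<close> for
\<open>upper_pair\<close>. Since the sign of \<open>Q E' - E Q'\<close> is that of \<open>\<sigma>\<close>, the two levels exchange their
roles in the interaction estimate for the second family.\<close>
proposition level_set_step:
  fixes \<sigma> M k :: real and w1 w2 :: "plane \<Rightarrow> real"
  defines "\<eta> \<equiv> \<lambda>l z. excess_entropy (w1 z) (w2 z) l"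
    and "q \<equiv> \<lambda>l z. (k - \<sigma> * l) * excess_entropy (w1 z) (w2 z) l - \<sigma> * excess_cube (w1 z) (w2 z) l"
  assumes \<sigma>: "\<sigma> = 1 \<or> \<sigma> = - 1"
    and weak: "\<And>l. 0 \<le> l \<Longrightarrow> weak_nonpos_on (ball 0 R) (\<eta> l) (q l)"
    and meas: "w1 \<in> borel_measurable borel" "w2 \<in> borel_measurable borel"
    and C: "\<And>l z. 0 \<le> l \<Longrightarrow> \<eta> l z \<le> C" "\<And>l z. 0 \<le> l \<Longrightarrow> \<bar>q l z\<bar> \<le> C"
    and gap: "\<And>z. w2 z + M \<le> w1 z"
    and l: "0 \<le> l" "0 < d" "d \<le> M" and r: "0 < r'" "r' < r" "r < R"
  shows "d ^ 5 / 12 * measure lborel ({z. l + 2 * d < w1 z} \<inter> cball 0 r') \<le>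
    32 * (mollifier_bound * C)\<^sup>2 / (r - r')\<^sup>2 * (measure lborel ({z. l < w1 z} \<inter> cball 0 r))\<^sup>2"
proof -
  have ld: "0 \<le> l + d"
    using l by simp
  have le: "w2 z \<le> w1 z" "w2 z + d \<le> w1 z" for z
    using gap[of z] l by linarith+
  have [measurable]: "pos_part \<in> borel_measurable borel"
    unfolding pos_part_def[abs_def] by measurable
  note [measurable] = meas
  have m: "\<eta> l \<in> borel_measurable borel" "q l \<in> borel_measurable borel" for l
    unfolding \<eta>_def q_def excess_entropy_def excess_cube_def by measurable
  have S: "{z. l < w1 z} \<in> sets borel" for l
    using borel_measurable_less[OF borel_measurable_const meas(1), of l] by simp
  have nonneg: "0 \<le> \<eta> l z" for l z
    unfolding \<eta>_def using excess_bounds(1)[OF le(1) order_refl] .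
  have zero: "\<eta> l' z = 0 \<and> q l' z = 0" if "z \<notin> {z. l < w1 z}" "l \<le> l'" for l' z
    using that excess_bounds(5,6)[OF le(1) order_refl, of z l'] by (simp add: \<eta>_def q_def)
  have ident: "q l z * \<eta> (l + d) z - \<eta> l z * q (l + d) z = \<sigma> * interaction (w1 z) (w2 z) l d" for z
    by (simp add: \<eta>_def q_def interaction_def algebra_simps)
  have low: "d ^ 5 / 12 \<le> interaction (w1 z) (w2 z) l d" if "z \<in> {z. l + 2 * d < w1 z}" for z
    using that l by (intro interaction_lower_bound le) auto
  have pos: "0 \<le> interaction (w1 z) (w2 z) l d" for z
    using l by (intro interaction_nonneg le) auto
  show ?thesis
  proof (cases "\<sigma> = 1")
    case True
    show ?thesis
    proof (rule de_giorgi_step[OF weak[OF l(1)] weak[OF ld] r m m nonneg nonneg C[OF l(1)] C[OF ld]])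
      show "d ^ 5 / 12 \<le> q l z * \<eta> (l + d) z - \<eta> l z * q (l + d) z" if "z \<in> {z. l + 2 * d < w1 z}" for z
        using low[OF that] True by (simp add: ident)
      show "0 \<le> q l z * \<eta> (l + d) z - \<eta> l z * q (l + d) z" for z
        using pos True by (simp add: ident)
    qed (use S zero l in auto)
  next
    case False
    then have \<sigma>': "\<sigma> = - 1"
      using \<sigma> by simp
    have ident': "q (l + d) z * \<eta> l z - \<eta> (l + d) z * q l z = interaction (w1 z) (w2 z) l d" for z
      using ident[of z] \<sigma>' by (simp add: mult.commute)
    show ?thesis
    proof (rule de_giorgi_step[OF weak[OF ld] weak[OF l(1)] r m m nonneg nonneg C[OF ld] C[OF l(1)]])
      show "d ^ 5 / 12 \<le> q (l + d) z * \<eta> l z - \<eta> (l + d) z * q l z" if "z \<in> {z. l + 2 * d < w1 z}" for z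
        using low[OF that] by (simp add: ident')
      show "0 \<le> q (l + d) z * \<eta> l z - \<eta> (l + d) z * q l z" for z
        using pos by (simp add: ident')
    qed (use S zero l in auto)
  qed
qed

section \<open>A Borel representative of the solution\<close>

lemma integrand_measurable:
  fixes u :: "plane \<Rightarrow> plane" and g h :: "plane \<Rightarrow> real"
  assumes u: "u \<in> borel_measurable (lebesgue_on U)" and U: "U \<in> sets lebesgue"
    and g: "g \<in> borel_measurable borel" and h: "h \<in> borel_measurable borel"
  shows "(\<lambda>z. indicator U z *\<^sub>R (g (u z) * h z)) \<in> borel_measurable lebesgue"
proof -
  have "(\<lambda>z. g (u z)) \<in> borel_measurable (lebesgue_on U)"
    using measurable_compose[OF u g] .
  moreover have "h \<in> borel_measurable (lebesgue_on U)"
    by (intro measurable_restrict_space1 measurable_completion) (use h in simp)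
  ultimately have "(\<lambda>z. g (u z) * h z) \<in> borel_measurable (lebesgue_on U)"
    by (rule borel_measurable_times)
  then show ?thesis
    using U by (subst (asm) borel_measurable_restrict_space_iff) auto
qed

lemma AE_lebesgue_on_iff:
  "U \<in> sets lebesgue \<Longrightarrow> (AE z in lebesgue_on U. P z) \<longleftrightarrow> (AE z in lborel. z \<in> U \<longrightarrow> P z)"
  for U :: "plane set"
  by (simp add: AE_restrict_space_iff AE_completion_iff)

text \<open>Changing \<open>u\<close> on a null set makes it Borel measurable and makes the bounds hold everywhere, also
outside \<open>U\<close>, where a fixed admissible state is used. The entropy inequalities only see the class of
\<open>u\<close> modulo null sets.\<close>
lemma entropy_solution_representative:
  assumes sol: "entropy_solution U u" and U: "open U" "U \<noteq> {}"
    and "Linf_norm U (\<lambda>z. fst (u z)) + Linf_norm U (\<lambda>z. snd (u z) / fst (u z)) \<le> ereal \<Gamma>"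
    and "ereal M \<le> ess_inf_on U (\<lambda>z. fst (u z))"
  shows "\<exists>v. v \<in> borel_measurable borel \<and> (\<forall>z. M \<le> fst (v z) \<and> \<bar>fst (v z)\<bar> + \<bar>snd (v z) / fst (v z)\<bar> \<le> \<Gamma>) \<and>
    (AE z in lborel. z \<in> U \<longrightarrow> u z = v z) \<and>
    (\<forall>\<eta> q. entropy_pair \<eta> q \<and> \<eta> \<in> borel_measurable borel \<and> q \<in> borel_measurable borel \<longrightarrow>
      weak_nonpos_on U (\<lambda>z. \<eta> (v z)) (\<lambda>z. q (v z)))"
proof -
  have Ul: "U \<in> sets lebesgue"
    using U(1) by simp
  have u: "u \<in> borel_measurable (lebesgue_on U)"
    using sol by (simp add: entropy_solution_def)
  have "AE z in lebesgue_on U. M \<le> fst (u z) \<and> \<bar>fst (u z)\<bar> + \<bar>snd (u z) / fst (u z)\<bar> \<le> \<Gamma>"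
    using esssup_AE[of "\<lambda>z. ereal \<bar>fst (u z)\<bar>" "lebesgue_on U"]
      esssup_AE[of "\<lambda>z. ereal \<bar>snd (u z) / fst (u z)\<bar>" "lebesgue_on U"]
      esssup_AE[of "\<lambda>z. ereal (- fst (u z))" "lebesgue_on U"]
  proof eventually_elim
    case (elim z)
    have "ereal (\<bar>fst (u z)\<bar> + \<bar>snd (u z) / fst (u z)\<bar>) \<le> ereal \<Gamma>"
      using order_trans[OF add_mono[OF elim(1,2)], of "ereal \<Gamma>"] assms(4)
      by (simp add: Linf_norm_def ess_sup_on_def)
    moreover have "ereal M \<le> ereal (fst (u z))"
    proof -
      have "ereal M \<le> - esssup (lebesgue_on U) (\<lambda>z. ereal (- fst (u z)))"
        using assms(5) by (simp add: ess_inf_on_def ess_sup_on_def)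
      also have "\<dots> \<le> - ereal (- fst (u z))"
        using elim(3) by (simp only: ereal_minus_le_minus)
      finally show ?thesis
        by simp
    qed
    ultimately show ?case
      by simp
  qed
  then have bounds: "AE z in lborel. z \<in> U \<longrightarrow> M \<le> fst (u z) \<and> \<bar>fst (u z)\<bar> + \<bar>snd (u z) / fst (u z)\<bar> \<le> \<Gamma>"
    by (simp only: AE_lebesgue_on_iff[OF Ul])
  have "\<exists>f\<in>borel_measurable lborel. AE z in lborel. indicator U z *\<^sub>R (g (u z) * 1) = f z"
    if "g \<in> borel_measurable borel" for g :: "plane \<Rightarrow> real"
    using completion_ex_borel_measurable_real[OF integrand_measurable[OF u Ul that borel_measurable_const]] .
  note rep = this
  obtain \<rho> where \<rho>: "\<rho> \<in> borel_measurable borel" "AE z in lborel. indicator U z *\<^sub>R (fst (u z) * 1) = \<rho> z"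
    using rep[OF borel_measurable_coordinates(1)] by (auto simp: measurable_lborel1)
  obtain m where m: "m \<in> borel_measurable borel" "AE z in lborel. indicator U z *\<^sub>R (snd (u z) * 1) = m z"
    using rep[OF borel_measurable_coordinates(2)] by (auto simp: measurable_lborel1)
  define S where "S = {z. M \<le> \<rho> z \<and> \<bar>\<rho> z\<bar> + \<bar>m z / \<rho> z\<bar> \<le> \<Gamma>}"
  have S: "S \<in> sets borel"
  proof -
    note [measurable] = \<rho>(1) m(1)
    have "S = {z \<in> space borel. M \<le> \<rho> z \<and> \<bar>\<rho> z\<bar> + \<bar>m z / \<rho> z\<bar> \<le> \<Gamma>}"
      by (simp add: S_def)
    also have "\<dots> \<in> sets borel"
      by measurable
    finally show ?thesis .
  qed
  have AE_S: "AE z in lborel. z \<in> U \<longrightarrow> z \<in> S \<and> u z = (\<rho> z, m z)"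
    using bounds \<rho>(2) m(2) by eventually_elim (auto simp: S_def prod_eq_iff)
  have "S \<noteq> {}"
  proof
    assume "S = {}"
    then have "AE z in lborel. z \<notin> U"
      using AE_S by simp
    then have "emeasure lborel U = 0"
      using U(1) by (subst (asm) AE_iff_measurable[of U]) auto
    then show False
      using U open_not_negligible[of U] by (simp add: negligible_iff_null_sets null_sets_def)
  qed
  then obtain z0 where z0: "z0 \<in> S"
    by blast
  define v where "v z = (if z \<in> S then (\<rho> z, m z) else (\<rho> z0, m z0))" for z
  have v: "v \<in> borel_measurable borel"
    unfolding v_def[abs_def] using S \<rho>(1) m(1)
    by (intro measurable_If_set borel_measurable_Pair) auto
  have vb: "M \<le> fst (v z) \<and> \<bar>fst (v z)\<bar> + \<bar>snd (v z) / fst (v z)\<bar> \<le> \<Gamma>" for z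
    using z0 by (auto simp: v_def S_def)
  have uv: "AE z in lborel. z \<in> U \<longrightarrow> u z = v z"
    using AE_S by eventually_elim (auto simp: v_def)
  have "weak_nonpos_on U (\<lambda>z. \<eta> (v z)) (\<lambda>z. q (v z))"
    if "entropy_pair \<eta> q" and \<eta>: "\<eta> \<in> borel_measurable borel" and q: "q \<in> borel_measurable borel" for \<eta> q
    unfolding weak_nonpos_on_def
  proof (intro allI impI)
    fix \<phi> assume \<phi>: "test_function U \<phi> \<and> (\<forall>z. 0 \<le> \<phi> z)"
    have D: "dir_deriv w \<phi> \<in> borel_measurable borel" for w
      using C1_on_dir_deriv[OF test_functionD(1)] \<phi> by (intro borel_measurable_continuous_onI) blast
    have vl: "v \<in> borel_measurable (lebesgue_on U)"
      using v by (intro measurable_restrict_space1 measurable_completion) simp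
    have split: "(\<lambda>z. indicator U z *\<^sub>R (\<eta> (f z) * dir_deriv (1, 0) \<phi> z + q (f z) * dir_deriv (0, 1) \<phi> z))
        \<in> borel_measurable lebesgue" if "f \<in> borel_measurable (lebesgue_on U)" for f
      unfolding scaleR_add_right
      by (intro borel_measurable_add integrand_measurable[OF that Ul] \<eta> q D)
    have "weak_div U (\<lambda>z. \<eta> (v z)) (\<lambda>z. q (v z)) \<phi> = weak_div U (\<lambda>z. \<eta> (u z)) (\<lambda>z. q (u z)) \<phi>"
      unfolding weak_div_def set_lebesgue_integral_def
    proof (intro arg_cong[of _ _ uminus] integral_cong_AE split vl u)
      have "AE z in lebesgue. z \<in> U \<longrightarrow> u z = v z"
        using uv by (simp add: AE_completion_iff)
      then show "AE z in lebesgue.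
          indicator U z *\<^sub>R (\<eta> (v z) * dir_deriv (1, 0) \<phi> z + q (v z) * dir_deriv (0, 1) \<phi> z) =
          indicator U z *\<^sub>R (\<eta> (u z) * dir_deriv (1, 0) \<phi> z + q (u z) * dir_deriv (0, 1) \<phi> z)"
        by eventually_elim (auto simp: indicator_def)
    qed
    also have "\<dots> \<le> 0"
      using sol that(1) \<phi> by (auto simp: entropy_solution_def weak_div_nonpos_def)
    finally show "weak_div U (\<lambda>z. \<eta> (v z)) (\<lambda>z. q (v z)) \<phi> \<le> 0" .
  qed
  with v vb uv show ?thesis
    by blast
qed

lemma borel_measurable_lambda:
  "lambda1 \<in> borel_measurable borel" "lambda2 \<in> borel_measurable borel"
proof -
  note [measurable] = borel_measurable_coordinates
  have eq: "lambda1 = (\<lambda>z. snd z / fst z - fst z / 2)" "lambda2 = (\<lambda>z. snd z / fst z + fst z / 2)"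
    by (auto simp: lambda1_def lambda2_def)
  show "lambda1 \<in> borel_measurable borel" "lambda2 \<in> borel_measurable borel"
    unfolding eq by measurable
qed

lemma lambda_bounds:
  assumes "M \<le> fst s" "\<bar>fst s\<bar> + \<bar>snd s / fst s\<bar> \<le> \<Gamma>"
  shows "\<bar>lambda1 s\<bar> \<le> \<Gamma>" "\<bar>lambda2 s\<bar> \<le> \<Gamma>" "lambda1 s + M \<le> lambda2 s"
proof -
  have "lambda1 s = snd s / fst s - fst s / 2" "lambda2 s = snd s / fst s + fst s / 2"
    by (simp_all add: lambda1_def lambda2_def case_prod_unfold)
  then show "\<bar>lambda1 s\<bar> \<le> \<Gamma>" "\<bar>lambda2 s\<bar> \<le> \<Gamma>" "lambda1 s + M \<le> lambda2 s"
    using assms by - (linarith+)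
qed

section \<open>From small integrals to small essential suprema\<close>

text \<open>Both parts use the Markov inequality. The first shows that a small integral forces the excess below
the threshold \<open>c\<close> somewhere; this will bound the reference value. The second starts the De Giorgi
iteration at the level \<open>\<delta>\<close>, where the superlevel set has measure at most \<open>\<epsilon> / \<delta>\<close>.\<close>
lemma ess_sup_from_L1:
  fixes u v :: "plane \<Rightarrow> plane" and W :: "plane \<Rightarrow> real"
  assumes u: "u \<in> borel_measurable (lebesgue_on (ball 0 2))" and v: "v \<in> borel_measurable borel"
    and uv: "AE z in lborel. z \<in> ball 0 2 \<longrightarrow> u z = v z"
    and W: "W \<in> borel_measurable borel" "\<And>z. \<bar>W (v z)\<bar> \<le> B"
    and small: "(LINT z:ball 0 2|lebesgue. pos_part (W (u z))) < \<epsilon>"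
  shows "\<epsilon> \<le> c * measure lborel (ball (0::plane) 2) \<Longrightarrow> \<exists>z. W (v z) < c"
    and "\<lbrakk>\<And>l d r r'. 0 \<le> l \<Longrightarrow> 0 < d \<Longrightarrow> d \<le> M \<Longrightarrow> 1 \<le> r' \<Longrightarrow> r' < r \<Longrightarrow> r < 2 \<Longrightarrow>
        d ^ 5 / 12 * measure lborel ({z. l + 2 * d < W (v z)} \<inter> cball 0 r')
          \<le> K / (r - r')\<^sup>2 * (measure lborel ({z. l < W (v z)} \<inter> cball 0 r))\<^sup>2;
        0 < K; 0 < \<delta>; \<delta> \<le> M; \<epsilon> \<le> \<delta> ^ 6 / (12 * 2 ^ 21 * K)\<rbrakk>
      \<Longrightarrow> ess_sup_on (ball 0 1) (\<lambda>z. pos_part (W (u z))) \<le> ereal (2 * \<delta>)"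
proof -
  let ?w = "\<lambda>z. W (v z)" and ?U = "ball (0::plane) 2"
  have pos: "pos_part \<in> borel_measurable borel"
    unfolding pos_part_def[abs_def] by measurable
  have w: "?w \<in> borel_measurable borel"
    using measurable_compose[OF v W(1)] .
  have meas: "(\<lambda>z. indicator ?U z * pos_part (?w z)) \<in> borel_measurable lborel"
    using measurable_compose[OF w pos] by (intro borel_measurable_times borel_measurable_indicator) auto
  have U: "?U \<in> sets lebesgue"
    by simp
  have fin: "emeasure lborel (A \<inter> cball (0::plane) r) < \<infinity>" for A r
    by (intro emeasure_bounded_finite bounded_Int) simp
  have finU: "emeasure lborel ?U < \<infinity>"
    by (intro emeasure_bounded_finite) simp
  have int: "integrable lborel (\<lambda>z. indicator ?U z * pos_part (?w z))"
  proof (rule Bochner_Integration.integrable_bound[of _ "\<lambda>z. \<bar>B\<bar> * indicator ?U z"])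
    show "integrable lborel (\<lambda>z. \<bar>B\<bar> * indicator ?U z)"
      using finU by (intro integrable_mult_right integrable_real_indicator) auto
    show "(\<lambda>z. indicator ?U z * pos_part (?w z)) \<in> borel_measurable lborel"
      by (rule meas)
    have "\<bar>pos_part (?w z)\<bar> \<le> \<bar>B\<bar>" for z
      using W(2)[of z] by (auto simp: pos_part_def)
    then show "AE z in lborel. norm (indicator ?U z * pos_part (?w z)) \<le> norm (\<bar>B\<bar> * indicator ?U z)"
      by (intro AE_I2) (auto simp: indicator_def)
  qed
  have "(LINT z:?U|lebesgue. pos_part (W (u z))) = (LINT z|lebesgue. indicator ?U z * pos_part (?w z))"
    unfolding set_lebesgue_integral_def
  proof (rule integral_cong_AE)
    show "(\<lambda>z. indicator ?U z *\<^sub>R pos_part (W (u z))) \<in> borel_measurable lebesgue"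
      using integrand_measurable[OF u U measurable_compose[OF W(1) pos] borel_measurable_const[of 1]]
      by simp
    show "(\<lambda>z. indicator ?U z * pos_part (?w z)) \<in> borel_measurable lebesgue"
      by (rule measurable_completion[OF meas])
    have "AE z in lebesgue. z \<in> ?U \<longrightarrow> u z = v z"
      using uv by (simp add: AE_completion_iff)
    then show "AE z in lebesgue. indicator ?U z *\<^sub>R pos_part (W (u z)) = indicator ?U z * pos_part (?w z)"
      by eventually_elim (auto simp: indicator_def)
  qed
  also have "\<dots> = (LINT z|lborel. indicator ?U z * pos_part (?w z))"
    by (rule integral_completion[OF meas])
  finally have small': "(LINT z|lborel. indicator ?U z * pos_part (?w z)) < \<epsilon>"
    using small by simp
  have markov: "c * measure lborel A < \<epsilon>" if A: "A \<in> sets borel" "A \<subseteq> ?U" "\<And>z. z \<in> A \<Longrightarrow> c \<le> ?w z" for A c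
  proof -
    have "A \<inter> cball 0 2 = A"
      using A(2) by auto
    then have finA: "emeasure lborel A < \<infinity>"
      using fin[of A 2] by simp
    have "c * measure lborel A = (LINT z|lborel. c * indicator A z)"
      by simp
    also have "\<dots> \<le> (LINT z|lborel. indicator ?U z * pos_part (?w z))"
    proof (rule integral_mono[OF _ int])
      show "integrable lborel (\<lambda>z. c * indicator A z)"
        using finA A(1) by (intro integrable_mult_right integrable_real_indicator) auto
      show "c * indicator A z \<le> indicator ?U z * pos_part (?w z)" for z
        using A(2) A(3)[of z] by (cases "z \<in> A") (auto simp: pos_part_def)
    qed
    finally show ?thesis
      using small' by simp
  qed
  show "\<exists>z. W (v z) < c" if "\<epsilon> \<le> c * measure lborel ?U"
  proof (rule ccontr)
    assume "\<not> (\<exists>z. W (v z) < c)"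
    then have "c * measure lborel ?U < \<epsilon>"
      by (intro markov) (auto simp: not_less)
    with that show False
      by simp
  qed
  assume step: "\<And>l d r r'. 0 \<le> l \<Longrightarrow> 0 < d \<Longrightarrow> d \<le> M \<Longrightarrow> 1 \<le> r' \<Longrightarrow> r' < r \<Longrightarrow> r < 2 \<Longrightarrow>
        d ^ 5 / 12 * measure lborel ({z. l + 2 * d < W (v z)} \<inter> cball 0 r')
          \<le> K / (r - r')\<^sup>2 * (measure lborel ({z. l < W (v z)} \<inter> cball 0 r))\<^sup>2"
    and K: "0 < K" and \<delta>: "0 < \<delta>" "\<delta> \<le> M" and \<epsilon>: "\<epsilon> \<le> \<delta> ^ 6 / (12 * 2 ^ 21 * K)"
  define \<mu> where "\<mu> l r = measure lborel ({z. l < ?w z} \<inter> cball 0 r)" for l r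
  have S: "{z. l < ?w z} \<in> sets borel" for l
    using borel_measurable_less[OF borel_measurable_const w, of l] by simp
  have "\<mu> (2 * \<delta>) 1 = 0"
  proof (rule level_set_iteration[where M = M and K = K and \<delta> = \<delta>])
    show "\<mu> l r \<le> \<mu> l' r'" if "l' \<le> l" "r \<le> r'" for l l' r r'
      unfolding \<mu>_def
      by (rule measure_mono_fmeasurable)
         (use that S fin[of "{z. l' < ?w z}" r'] in \<open>auto intro!: fmeasurableI\<close>)
    have "\<delta> * \<mu> \<delta> (3 / 2) < \<epsilon>"
      unfolding \<mu>_def using S by (intro markov) auto
    also have "\<dots> \<le> \<delta> * (\<delta> ^ 5 / (12 * 2 ^ 21 * K))"
      using \<epsilon> by (simp add: eval_nat_numeral)
    finally show "\<mu> \<delta> (3 / 2) \<le> \<delta> ^ 5 / (12 * 2 ^ 21 * K)"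
      using \<delta>(1) by (simp only: mult_less_cancel_left_pos)
  qed (use step K \<delta> in \<open>simp_all add: \<mu>_def\<close>)
  then have "{z. 2 * \<delta> < ?w z} \<inter> cball 0 1 \<in> null_sets lborel"
    using fin[of "{z. 2 * \<delta> < ?w z}" 1] S[of "2 * \<delta>"]
    by (auto simp: \<mu>_def null_sets_def measure_def enn2real_eq_0_iff)
  then have "AE z in lborel. z \<notin> {z. 2 * \<delta> < ?w z} \<inter> cball 0 1"
    by (rule AE_not_in)
  with uv have "AE z in lborel. z \<in> ball 0 1 \<longrightarrow> ereal (pos_part (W (u z))) \<le> ereal (2 * \<delta>)"
  proof eventually_elim
    case (elim z)
    show ?case
      using elim \<delta>(1) by (auto simp: pos_part_def)
  qed
  then have ae: "AE z in lebesgue_on (ball 0 1). ereal (pos_part (W (u z))) \<le> ereal (2 * \<delta>)"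
    by (simp only: AE_lebesgue_on_iff[OF lmeasurable_ball[THEN fmeasurableD]])
  have "u \<in> borel_measurable (lebesgue_on (ball 0 1))"
    by (rule measurable_restrict_mono[OF u]) auto
  from measurable_compose[OF measurable_compose[OF this W(1)] pos]
  have [measurable]: "(\<lambda>z. pos_part (W (u z))) \<in> borel_measurable (lebesgue_on (ball 0 1))" .
  show "ess_sup_on (ball 0 1) (\<lambda>z. pos_part (W (u z))) \<le> ereal (2 * \<delta>)"
    unfolding ess_sup_on_def by (rule esssup_I[OF _ ae]) measurable
qed

text \<open>A common bound for entropies and fluxes when \<open>w1 - l \<le> 2 * \<Gamma>\<close> and all speeds are at most \<open>\<Gamma>\<close>:
the entropy is at most \<open>2 * \<Gamma>\<^sup>2\<close>, the flux at most \<open>(2 + 8 / 3) * \<Gamma> ^ 3\<close>; the summand \<open>1\<close> makes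
the bound positive.\<close>
definition entropy_bound :: "real \<Rightarrow> real" where
  "entropy_bound \<Gamma> = 2 * \<Gamma>\<^sup>2 + 5 * \<bar>\<Gamma>\<bar> ^ 3 + 1"

lemma entropy_bound_pos: "0 < entropy_bound \<Gamma>"
proof -
  have "0 \<le> 2 * \<Gamma>\<^sup>2" "0 \<le> 5 * \<bar>\<Gamma>\<bar> ^ 3"
    by simp_all
  then show ?thesis
    unfolding entropy_bound_def by linarith
qed

lemma excess_pair_bound:
  assumes w: "w2 \<le> w1" "w1 - l \<le> 2 * \<Gamma>" and \<kappa>: "l < w1 \<Longrightarrow> \<bar>\<kappa>\<bar> \<le> \<Gamma>"
    and \<sigma>: "\<sigma> = 1 \<or> \<sigma> = - 1"
  shows "excess_entropy w1 w2 l \<le> entropy_bound \<Gamma>"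
    and "\<bar>\<kappa> * excess_entropy w1 w2 l - \<sigma> * excess_cube w1 w2 l\<bar> \<le> entropy_bound \<Gamma>"
proof -
  note b = excess_bounds[OF w]
  have pos: "0 \<le> \<Gamma>\<^sup>2" "0 \<le> \<bar>\<Gamma>\<bar> ^ 3"
    by simp_all
  have e: "excess_entropy w1 w2 l \<le> 2 * \<Gamma>\<^sup>2"
    using b(2) by (simp add: power_mult_distrib)
  then show "excess_entropy w1 w2 l \<le> entropy_bound \<Gamma>"
    using pos(2) unfolding entropy_bound_def by linarith
  show "\<bar>\<kappa> * excess_entropy w1 w2 l - \<sigma> * excess_cube w1 w2 l\<bar> \<le> entropy_bound \<Gamma>"
  proof (cases "l < w1")
    case True
    have \<Gamma>: "0 \<le> \<Gamma>"
      using \<kappa>[OF True] by linarith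
    have "\<bar>\<kappa> * excess_entropy w1 w2 l\<bar> \<le> \<Gamma> * (2 * \<Gamma>\<^sup>2)"
      unfolding abs_mult using \<kappa>[OF True] e b(1) \<Gamma> by (intro mult_mono) auto
    moreover have "\<Gamma> * (2 * \<Gamma>\<^sup>2) = 2 * \<bar>\<Gamma>\<bar> ^ 3"
      using \<Gamma> by (simp add: power2_eq_square power3_eq_cube)
    moreover have "\<bar>\<sigma> * excess_cube w1 w2 l\<bar> \<le> 8 * \<bar>\<Gamma>\<bar> ^ 3 / 3"
      using b(3,4) \<sigma> by (auto simp: abs_mult power_mult_distrib)
    ultimately show ?thesis
      using pos unfolding entropy_bound_def by linarith
  next
    case False
    then show ?thesis
      using b(5,6) entropy_bound_pos[of \<Gamma>] by simp
  qed
qed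

definition step_constant :: "real \<Rightarrow> real" where
  "step_constant \<Gamma> = 32 * (mollifier_bound * entropy_bound \<Gamma>)\<^sup>2"

lemma step_constant_pos: "0 < step_constant \<Gamma>"
  using mollifier_bound(1) entropy_bound_pos[of \<Gamma>] by (simp add: step_constant_def)

text \<open>The condition on \<open>k\<close> bounds the excess by \<open>2 * \<Gamma>\<close>, and where the excess is above a level
the speed of that level lies between the Riemann invariant and \<open>k\<close>, hence in \<open>{- \<Gamma>..\<Gamma>}\<close>.\<close>
lemma level_set_step_lambda:
  assumes v: "v \<in> borel_measurable borel"
    and vb: "\<And>z. M \<le> fst (v z)" "\<And>z. \<bar>fst (v z)\<bar> + \<bar>snd (v z) / fst (v z)\<bar> \<le> \<Gamma>"
    and weak: "\<forall>\<eta> q. entropy_pair \<eta> q \<and> \<eta> \<in> borel_measurable borel \<and> q \<in> borel_measurable borel \<longrightarrow>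
      weak_nonpos_on (ball 0 2) (\<lambda>z. \<eta> (v z)) (\<lambda>z. q (v z))"
    and l: "0 \<le> l" "0 < d" "d \<le> M" and r: "1 \<le> r'" "r' < r" "r < 2"
  shows "k \<le> \<Gamma> \<Longrightarrow>
      d ^ 5 / 12 * measure lborel ({z. l + 2 * d < k - lambda1 (v z)} \<inter> cball 0 r') \<le>
      step_constant \<Gamma> / (r - r')\<^sup>2 * (measure lborel ({z. l < k - lambda1 (v z)} \<inter> cball 0 r))\<^sup>2"
    and "- \<Gamma> \<le> k \<Longrightarrow>
      d ^ 5 / 12 * measure lborel ({z. l + 2 * d < lambda2 (v z) - k} \<inter> cball 0 r') \<le>
      step_constant \<Gamma> / (r - r')\<^sup>2 * (measure lborel ({z. l < lambda2 (v z) - k} \<inter> cball 0 r))\<^sup>2"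
proof -
  note \<lambda> = lambda_bounds[OF vb]
  have [measurable]: "pos_part \<in> borel_measurable borel"
    unfolding pos_part_def[abs_def] by measurable
  note [measurable] = borel_measurable_lambda
  have meas: "(\<lambda>z. lambda1 (v z)) \<in> borel_measurable borel" "(\<lambda>z. lambda2 (v z)) \<in> borel_measurable borel"
    using v by (auto intro: measurable_compose borel_measurable_lambda)
  have r0: "0 < r'"
    using r by simp
  show "d ^ 5 / 12 * measure lborel ({z. l + 2 * d < k - lambda1 (v z)} \<inter> cball 0 r') \<le>
      step_constant \<Gamma> / (r - r')\<^sup>2 * (measure lborel ({z. l < k - lambda1 (v z)} \<inter> cball 0 r))\<^sup>2"
    if k: "k \<le> \<Gamma>"
    unfolding step_constant_def
  proof (rule level_set_step[where \<sigma> = 1 and k = k and M = M and R = 2 and ?w1.0 = "\<lambda>z. k - lambda1 (v z)" and ?w2.0 = "\<lambda>z. k - lambda2 (v z)"])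
    fix l' :: real assume l': "0 \<le> l'"
    have "fst (lower_pair k l') \<in> borel_measurable borel" "snd (lower_pair k l') \<in> borel_measurable borel"
      unfolding lower_pair_def excess_entropy_def excess_cube_def fst_conv snd_conv by measurable
    from weak[rule_format, OF conjI[OF entropy_pair_lower conjI[OF this]]]
    show "weak_nonpos_on (ball 0 2) (\<lambda>z. excess_entropy (k - lambda1 (v z)) (k - lambda2 (v z)) l')
        (\<lambda>z. (k - 1 * l') * excess_entropy (k - lambda1 (v z)) (k - lambda2 (v z)) l'
          - 1 * excess_cube (k - lambda1 (v z)) (k - lambda2 (v z)) l')"
      by (simp add: lower_pair_def)
    fix z
    have w: "k - lambda2 (v z) \<le> k - lambda1 (v z)" "k - lambda1 (v z) - l' \<le> 2 * \<Gamma>"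
      "l' < k - lambda1 (v z) \<Longrightarrow> \<bar>k - 1 * l'\<bar> \<le> \<Gamma>"
      using \<lambda>(1,3)[of z] k l' l by auto
    show "excess_entropy (k - lambda1 (v z)) (k - lambda2 (v z)) l' \<le> entropy_bound \<Gamma>"
      by (rule excess_pair_bound(1)[OF w, where \<sigma> = 1]) simp_all
    show "\<bar>(k - 1 * l') * excess_entropy (k - lambda1 (v z)) (k - lambda2 (v z)) l'
          - 1 * excess_cube (k - lambda1 (v z)) (k - lambda2 (v z)) l'\<bar> \<le> entropy_bound \<Gamma>"
      by (rule excess_pair_bound(2)[OF w]) simp_all
  qed (use meas l r r0 \<lambda>(3) in \<open>auto simp: algebra_simps\<close>)
  show "d ^ 5 / 12 * measure lborel ({z. l + 2 * d < lambda2 (v z) - k} \<inter> cball 0 r') \<le>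
      step_constant \<Gamma> / (r - r')\<^sup>2 * (measure lborel ({z. l < lambda2 (v z) - k} \<inter> cball 0 r))\<^sup>2"
    if k: "- \<Gamma> \<le> k"
    unfolding step_constant_def
  proof (rule level_set_step[where \<sigma> = "- 1" and k = k and M = M and R = 2 and ?w1.0 = "\<lambda>z. lambda2 (v z) - k" and ?w2.0 = "\<lambda>z. lambda1 (v z) - k"])
    fix l' :: real assume l': "0 \<le> l'"
    have "fst (upper_pair k l') \<in> borel_measurable borel" "snd (upper_pair k l') \<in> borel_measurable borel"
      unfolding upper_pair_def excess_entropy_def excess_cube_def fst_conv snd_conv by measurable
    from weak[rule_format, OF conjI[OF entropy_pair_upper conjI[OF this]]]
    show "weak_nonpos_on (ball 0 2) (\<lambda>z. excess_entropy (lambda2 (v z) - k) (lambda1 (v z) - k) l')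
        (\<lambda>z. (k - - 1 * l') * excess_entropy (lambda2 (v z) - k) (lambda1 (v z) - k) l'
          - - 1 * excess_cube (lambda2 (v z) - k) (lambda1 (v z) - k) l')"
      by (simp add: upper_pair_def)
    fix z
    have w: "lambda1 (v z) - k \<le> lambda2 (v z) - k" "lambda2 (v z) - k - l' \<le> 2 * \<Gamma>"
      "l' < lambda2 (v z) - k \<Longrightarrow> \<bar>k - - 1 * l'\<bar> \<le> \<Gamma>"
      using \<lambda>(2,3)[of z] k l' l by auto
    show "excess_entropy (lambda2 (v z) - k) (lambda1 (v z) - k) l' \<le> entropy_bound \<Gamma>"
      by (rule excess_pair_bound(1)[OF w, where \<sigma> = 1]) simp_all
    show "\<bar>(k - - 1 * l') * excess_entropy (lambda2 (v z) - k) (lambda1 (v z) - k) l'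
          - - 1 * excess_cube (lambda2 (v z) - k) (lambda1 (v z) - k) l'\<bar> \<le> entropy_bound \<Gamma>"
      by (rule excess_pair_bound(2)[OF w]) simp_all
  qed (use meas l r r0 \<lambda>(3) in \<open>auto simp: algebra_simps\<close>)
qed

theorem proposition1p1:
  fixes \<Gamma> M :: real
  assumes "M > 0"
  shows "\<exists>\<epsilon>0 C :: real. \<epsilon>0 > 0 \<and>
    (\<forall>(u :: real \<times> real \<Rightarrow> real \<times> real) (ubar :: real \<times> real) (\<epsilon> :: real).
       entropy_solution (ball 0 2) u \<longrightarrow>
       Linf_norm (ball 0 2) (\<lambda>z. fst (u z))
         + Linf_norm (ball 0 2) (\<lambda>z. snd (u z) / fst (u z)) \<le> ereal \<Gamma> \<longrightarrow>
       ereal M \<le> ess_inf_on (ball 0 2) (\<lambda>z. fst (u z)) \<longrightarrow>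
       fst ubar > 0 \<longrightarrow>
       0 < \<epsilon> \<longrightarrow> \<epsilon> < \<epsilon>0 \<longrightarrow>
       ((LINT z:ball 0 2|lebesgue. pos_part (lambda1 ubar - lambda1 (u z))) < \<epsilon> \<longrightarrow>
          ess_sup_on (ball 0 1) (\<lambda>z. pos_part (lambda1 ubar - lambda1 (u z)))
            < ereal (C * \<epsilon> powr (1 / 21))) \<and>
       ((LINT z:ball 0 2|lebesgue. pos_part (lambda2 (u z) - lambda2 ubar)) < \<epsilon> \<longrightarrow>
          ess_sup_on (ball 0 1) (\<lambda>z. pos_part (lambda2 (u z) - lambda2 ubar))
            < ereal (C * \<epsilon> powr (1 / 21))))"
proof -
  define K where "K = step_constant \<Gamma>"
  define c where "c = 1 / (12 * 2 ^ 21 * K)"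
  define \<delta>0 where "\<delta>0 = min 1 (min M c)"
  define A where "A = M * measure lborel (ball (0::plane) 2)"
  have K: "0 < K"
    unfolding K_def by (rule step_constant_pos)
  have \<delta>0: "0 < \<delta>0"
    using assms K by (simp add: \<delta>0_def c_def)
  have A: "0 < A"
    using assms content_ball_pos[of 2 "0::plane"] by (simp add: A_def)
  show ?thesis
  proof (rule exI[of _ "min A (\<delta>0 ^ 21)"], rule exI[of _ 3], intro conjI allI impI)
    show "0 < min A (\<delta>0 ^ 21)"
      using A \<delta>0 by simp
    fix u :: "plane \<Rightarrow> plane" and ubar :: plane and \<epsilon> :: real
    assume sol: "entropy_solution (ball 0 2) u"
      and upper: "Linf_norm (ball 0 2) (\<lambda>z. fst (u z)) + Linf_norm (ball 0 2) (\<lambda>z. snd (u z) / fst (u z)) \<le> ereal \<Gamma>"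
      and lower: "ereal M \<le> ess_inf_on (ball 0 2) (\<lambda>z. fst (u z))"
      and \<epsilon>: "0 < \<epsilon>" "\<epsilon> < min A (\<delta>0 ^ 21)"
    have "ball (0::plane) 2 \<noteq> {}"
      by simp
    from entropy_solution_representative[OF sol open_ball this upper lower] obtain v where
      v: "v \<in> borel_measurable borel"
      and vb: "\<And>z. M \<le> fst (v z)" "\<And>z. \<bar>fst (v z)\<bar> + \<bar>snd (v z) / fst (v z)\<bar> \<le> \<Gamma>"
      and uv: "AE z in lborel. z \<in> ball 0 2 \<longrightarrow> u z = v z"
      and weak: "\<forall>\<eta> q. entropy_pair \<eta> q \<and> \<eta> \<in> borel_measurable borel \<and> q \<in> borel_measurable borel \<longrightarrow>
        weak_nonpos_on (ball 0 2) (\<lambda>z. \<eta> (v z)) (\<lambda>z. q (v z))"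
      by blast
    note \<lambda> = lambda_bounds[OF vb]
    have u: "u \<in> borel_measurable (lebesgue_on (ball 0 2))"
      using sol by (simp add: entropy_solution_def)
    (* The iteration requires \<delta> \<le> M and \<epsilon> \<le> c * \<delta> ^ 6. Since \<delta> \<le> min 1 c, the second follows from
       \<epsilon> = \<delta> ^ 6 * \<delta> ^ 15 \<le> \<delta> ^ 6 * \<delta>. *)
    define \<delta> where "\<delta> = \<epsilon> powr (1 / 21)"
    have \<delta>: "0 < \<delta>"
      using \<epsilon>(1) by (simp add: \<delta>_def)
    have \<delta>21: "\<delta> ^ 21 = \<epsilon>"
      using \<epsilon>(1) by (simp add: \<delta>_def powr_power)
    have "\<delta> ^ 21 < \<delta>0 ^ 21"
      using \<epsilon>(2) \<delta>21 by simp
    then have "\<delta> < \<delta>0"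
      by (rule power_less_imp_less_base) (use \<delta>0 in simp)
    then have \<delta>_less: "\<delta> \<le> 1" "\<delta> \<le> M" "\<delta> \<le> c"
      by (auto simp: \<delta>0_def)
    have "\<epsilon> \<le> \<delta> ^ 6 / (12 * 2 ^ 21 * K)"
    proof -
      have "\<delta> ^ 14 * \<delta> \<le> 1 * c"
        using \<delta> \<delta>_less by (intro mult_mono power_le_one) auto
      then have "\<delta> ^ 6 * (\<delta> ^ 14 * \<delta>) \<le> \<delta> ^ 6 * c"
        using \<delta> by (intro mult_left_mono) auto
      moreover have "\<delta> ^ 6 * (\<delta> ^ 14 * \<delta>) = \<epsilon>"
        unfolding \<delta>21[symmetric] by (simp add: eval_nat_numeral mult.assoc)
      ultimately show ?thesis
        by (simp add: c_def)
    qed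
    note small_\<epsilon> = this
    have less: "ereal (2 * \<delta>) < ereal (3 * \<epsilon> powr (1 / 21))"
      using \<delta> by (simp add: \<delta>_def[symmetric])
    have \<epsilon>A: "\<epsilon> \<le> M * measure lborel (ball (0::plane) 2)"
      using \<epsilon>(2) by (simp add: A_def)
    show "ess_sup_on (ball 0 1) (\<lambda>z. pos_part (lambda1 ubar - lambda1 (u z))) < ereal (3 * \<epsilon> powr (1 / 21))"
      if small: "(LINT z:ball 0 2|lebesgue. pos_part (lambda1 ubar - lambda1 (u z))) < \<epsilon>"
    proof -
      let ?W = "\<lambda>s. lambda1 ubar - lambda1 s"
      have W: "?W \<in> borel_measurable borel" "\<bar>?W (v z)\<bar> \<le> \<bar>lambda1 ubar\<bar> + \<Gamma>" for z
        using borel_measurable_lambda \<lambda>(1)[of z] by auto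
      note L1 = ess_sup_from_L1[where W = ?W, OF u v uv W small]
      (* Otherwise the excess would be at least the density everywhere. *)
      have k: "lambda1 ubar \<le> \<Gamma>"
      proof -
        obtain z where "?W (v z) < M"
          using L1(1)[OF \<epsilon>A] by blast
        then show ?thesis
          using \<lambda>(2,3)[of z] by linarith
      qed
      have "ess_sup_on (ball 0 1) (\<lambda>z. pos_part (?W (u z))) \<le> ereal (2 * \<delta>)"
      proof (rule L1(2)[where M = M and K = K])
        fix l d r r' :: real
        assume "0 \<le> l" "0 < d" "d \<le> M" "1 \<le> r'" "r' < r" "r < 2"
        from level_set_step_lambda(1)[OF v vb weak this k]
        show "d ^ 5 / 12 * measure lborel ({z. l + 2 * d < ?W (v z)} \<inter> cball 0 r')
          \<le> K / (r - r')\<^sup>2 * (measure lborel ({z. l < ?W (v z)} \<inter> cball 0 r))\<^sup>2"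
          unfolding K_def .
      qed (use K \<delta> \<delta>_less small_\<epsilon> in simp_all)
      then show ?thesis
        using less by (rule le_less_trans)
    qed
    show "ess_sup_on (ball 0 1) (\<lambda>z. pos_part (lambda2 (u z) - lambda2 ubar)) < ereal (3 * \<epsilon> powr (1 / 21))"
      if small: "(LINT z:ball 0 2|lebesgue. pos_part (lambda2 (u z) - lambda2 ubar)) < \<epsilon>"
    proof -
      let ?W = "\<lambda>s. lambda2 s - lambda2 ubar"
      have W: "?W \<in> borel_measurable borel" "\<bar>?W (v z)\<bar> \<le> \<bar>lambda2 ubar\<bar> + \<Gamma>" for z
        using borel_measurable_lambda \<lambda>(2)[of z] by auto
      note L1 = ess_sup_from_L1[where W = ?W, OF u v uv W small]
      have k: "- \<Gamma> \<le> lambda2 ubar"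
      proof -
        obtain z where "?W (v z) < M"
          using L1(1)[OF \<epsilon>A] by blast
        then show ?thesis
          using \<lambda>(1,3)[of z] by linarith
      qed
      have "ess_sup_on (ball 0 1) (\<lambda>z. pos_part (?W (u z))) \<le> ereal (2 * \<delta>)"
      proof (rule L1(2)[where M = M and K = K])
        fix l d r r' :: real
        assume "0 \<le> l" "0 < d" "d \<le> M" "1 \<le> r'" "r' < r" "r < 2"
        from level_set_step_lambda(2)[OF v vb weak this k]
        show "d ^ 5 / 12 * measure lborel ({z. l + 2 * d < ?W (v z)} \<inter> cball 0 r')
          \<le> K / (r - r')\<^sup>2 * (measure lborel ({z. l < ?W (v z)} \<inter> cball 0 r))\<^sup>2"
          unfolding K_def .
      qed (use K \<delta> \<delta>_less small_\<epsilon> in simp_all)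
      then show ?thesis
        using less by (rule le_less_trans)
    qed
  qed
qed

end
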